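(* Let $\beta\subset\{1,\dots,n\}$, $0\le k_1\le|\beta^1|$, $0\le k_2\le|\beta^2|$ and $A\in\mathcal F^G_{k_1,k_2}(\mathbb X_\beta)$. Then $$\mathbb F^\wedge(A)=\inf\sum_{i_1,i_2\in\{0,1\}}\mathbb M^\wedge(B^{i_1,i_2}),$$ where the infimum runs over the decompositions $$A=B^{0,0}+\partial_1B^{1,0}+\partial_2B^{0,1}+\partial_1\partial_2B^{1,1}$$ with $B^{i_1,i_2}\in\mathcal F^G_{k_1+i_1,k_2+i_2}(\mathbb X_\beta)$ for $i_1,i_2\in\{0,1\}$.
   Context: $(G,+,|\cdot|_G)$ is a complete Abelian normed group: Abelian group with $|\cdot|_G:G\to[0,\infty)$, $|g+g'|_G\le|g|_G+|g'|_G$, $|g|_G=0\iff g=0$, and $d_G(g,g')=|g'-g|_G$ complete. $n_1,n_2\ge0$, $n=n_1+n_2\ge1$, $\alpha=\{1,\dots,n_1\}$. For $\beta\subset\{1,\dots,n\}$: $\mathbb X_\beta=\mathrm{span}\{e_j:j\in\beta\}\subset\mathbb R^n$, $\beta^1=\beta\cap\alpha$, $\beta^2=\beta\setminus\alpha$. Polyhedral chains. A $k$-cell of $X=\mathbb X_\beta$ is $p=(q,\xi)$, $q$ closed convex $k$-polyhedron, $\xi$ unit simple $k$-vector orienting it; $-p=(q,-\xi)$. $\mathcal P_k^G(X)$: formal finite sums $\sum g_ip_i$ modulo $gp+g(-p)=0$, $gp+g'p=(g+g')p$, and $gp'+gp''=gp$ if the orientations agree and $p=p'\cup p''$ with $p',p''$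 meeting along a common $(k-1)$-face. $\mathbb M(P)=\min\sum|g_i|_G\mathcal H^k(p_i)$ over representations. $\partial p$: sum of the $(k-1)$-faces oriented by $\xi'$ with $\nu\wedge\xi'=\xi$, $\nu$ the exterior normal. Tensor chains. For cells $p^1=(q^1,\xi^1)$ in $\mathbb X_{\beta^1}$, $p^2=(q^2,\xi^2)$ in $\mathbb X_{\beta^2}$, $p^1\wedge p^2$ is the cell with support $q^1+q^2$ and orientation $\xi^1\wedge\xi^2$. $\mathcal P^G_{k_1,k_2}(\mathbb X_\beta)$ is the subgroup of $\mathcal P^G_{k_1+k_2}(\mathbb X_\beta)$ of chains $P=\sum g_ip_i^1\wedge p_i^2$ with $p_i^l$ a $k_l$-cell of $\mathbb X_{\beta^l}$. $\partial_1P=\sum g_i(\partial p_i^1)\wedge p_i^2$, $\partial_2P=(-1)^{k_1}\sum g_ip_i^1\wedge(\partial p_i^2)$. For polyhedral $P$, $\mathbb F^\wedge(P)=\inf\sum_{i_1,i_2\in\{0,1\}}\mathbb M(Q^{i_1,i_2})$ over $P=Q^{0,0}+\partial_1Q^{1,0}+\partial_2Q^{0,1}+\partial_1\partial_2Q^{1,1}$ with $Q^{i_1,i_2}\in\mathcal P^G_{k_1+i_1,k_2+i_2}(\mathbb X_\beta)$. $\mathcal F^G_{k_1,k_2}(\mathbb X_\beta)$ is the completion of $(\mathcal P^G_{k_1,k_2}(\mathbb X_\beta),\mathbb F^\wedge)$, with the norm still denoted $\mathbb F^\wedge$ (the group is $\{0\}$ unless $0\le k_l\le|\beta^l|$); $\partial_1,\partial_2$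 extend by continuity. For $A\in\mathcal F^G_{k_1,k_2}(\mathbb X_\beta)$, $\mathbb M^\wedge(A)=\inf\{\liminf\mathbb M(P_j):P_j\in\mathcal P^G_{k_1,k_2}(\mathbb X_\beta),\ \mathbb F^\wedge(P_j-A)\to0\}\in[0,\infty]$. *)

theory Defs
  imports "HOL-Analysis.Analysis" "HOL-Library.Poly_Mapping"
begin

section \<open>Normed coefficient groups\<close>

text \<open>
  The norm is a parameter \<open>gn\<close>. Requiring that \<open>d(g,g') = gn (g' - g)\<close> is a metric
  includes its symmetry, that is \<open>gn (- g) = gn g\<close>.
\<close>

locale complete_normed_group =
  fixes gn :: "'g::ab_group_add \<Rightarrow> real"
  assumes nonneg: "gn g \<ge> 0"
    and triangle: "gn (g + g') \<le> gn g + gn g'"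
    and zero_iff: "gn g = 0 \<longleftrightarrow> g = 0"
    and metric: "Metric_space UNIV (\<lambda>g g'. gn (g' - g))"
    and complete: "Metric_space.mcomplete UNIV (\<lambda>g g'. gn (g' - g))"


section \<open>Multivectors\<close>

text \<open>
  The Grassmann algebra of \<open>real ^ 'n\<close> is \<open>real ^ ('n set)\<close>: the coordinate at
  \<open>I = {i\<^sub>1 < \<dots> < i\<^sub>k}\<close> is the coefficient of \<open>e\<^bsub>i\<^sub>1\<^esub> \<and> \<dots> \<and> e\<^bsub>i\<^sub>k\<^esub>\<close>. The library norm
  of \<open>real ^ ('n set)\<close> is then the usual Euclidean norm on multivectors. The exponent
  of \<open>- 1\<close> counts the inversions between \<open>I\<close> and \<open>K - I\<close>.
\<close>

type_synonym 'n mvec = "real ^ ('n set)"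

definition wedge :: "'n::{finite,linorder} mvec \<Rightarrow> 'n mvec \<Rightarrow> 'n mvec" where
  "wedge \<xi> \<eta> = (\<chi> K. \<Sum>I\<in>Pow K.
      (- 1) ^ card {(i, j). i \<in> I \<and> j \<in> K - I \<and> j < i} * (\<xi> $ I) * (\<eta> $ (K - I)))"

definition mvec_of :: "(real, 'n) vec \<Rightarrow> 'n::{finite,linorder} mvec" where
  "mvec_of v = (\<Sum>j\<in>UNIV. (v $ j) *\<^sub>R axis {j} 1)"

definition wedge_list :: "(real, 'n) vec list \<Rightarrow> 'n::{finite,linorder} mvec" where
  "wedge_list vs = foldr (\<lambda>v \<xi>. wedge (mvec_of v) \<xi>) vs (axis {} 1)"

definition directions :: "(real ^ 'n) set \<Rightarrow> (real ^ 'n::finite) set" where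
  "directions q = span {x - y | x y. x \<in> q \<and> y \<in> q}"

text \<open>
  Unit simple \<open>k\<close>-vectors orienting \<open>q\<close>. The scalar \<open>c\<close> only matters for \<open>k = 0\<close>, where
  both \<open>1\<close> and \<open>- 1\<close> orient a point.
\<close>

definition orients :: "nat \<Rightarrow> (real, 'n) vec set \<Rightarrow> 'n::{finite,linorder} mvec \<Rightarrow> bool" where
  "orients k q \<xi> \<longleftrightarrow> norm \<xi> = 1 \<and>
     (\<exists>c vs. length vs = k \<and> set vs \<subseteq> directions q \<and> \<xi> = c *\<^sub>R wedge_list vs)"


section \<open>Cells\<close>

type_synonym 'n cell = "(real ^ 'n) set \<times> 'n mvec"

text \<open>Polyhedra supporting cells are bounded, as is implicit in finiteness of their mass.\<close>

definition cells :: "nat \<Rightarrow> (real, 'n) vec set \<Rightarrow> 'n::{finite,linorder} cell set" where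
  "cells k X = {(q, \<xi>). polytope q \<and> aff_dim q = int k \<and> q \<subseteq> X \<and> orients k q \<xi>}"

definition outer_normal :: "(real ^ 'n) set \<Rightarrow> (real ^ 'n) set \<Rightarrow> real ^ 'n::finite \<Rightarrow> bool" where
  "outer_normal q F \<nu> \<longleftrightarrow> norm \<nu> = 1 \<and> \<nu> \<in> directions q \<and>
     (\<forall>x\<in>F. \<forall>y\<in>F. \<nu> \<bullet> (x - y) = 0) \<and> (\<forall>x\<in>q. \<forall>y\<in>F. \<nu> \<bullet> (x - y) \<le> 0)"

text \<open>
  The cells whose sum is the boundary of a \<open>k\<close>-cell. A point has no facets, so its
  boundary is zero.
\<close>

definition bd_cells :: "nat \<Rightarrow> 'n::{finite,linorder} cell \<Rightarrow> 'n cell set" where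
  "bd_cells k p = {(F, \<xi>'). F facet_of fst p \<and> orients (k - 1) F \<xi>' \<and>
     (\<exists>\<nu>. outer_normal (fst p) F \<nu> \<and> wedge (mvec_of \<nu>) \<xi>' = snd p)}"

definition wedge_cell :: "'n::{finite,linorder} cell \<Rightarrow> 'n cell \<Rightarrow> 'n cell" where
  "wedge_cell p1 p2 = ({x + y | x y. x \<in> fst p1 \<and> y \<in> fst p2}, wedge (snd p1) (snd p2))"

definition hausdorff_measure :: "nat \<Rightarrow> 'a::metric_space set \<Rightarrow> ennreal" where
  "hausdorff_measure k S = (SUP \<delta>\<in>{0<..}.
     INF C\<in>{C :: nat \<Rightarrow> 'a set. S \<subseteq> (\<Union>i. C i) \<and> (\<forall>i. bounded (C i) \<and> diameter (C i) \<le> \<delta>)}.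
       suminf (\<lambda>i. if C i = {} then 0
         else ennreal (unit_ball_vol (real k) * (diameter (C i) / 2) ^ k)))"


section \<open>Polyhedral chains\<close>

text \<open>
  A formal finite sum of cells is a finitely supported function from cells to the group;
  this already accounts for \<open>g p + g' p = (g + g') p\<close>. The other two relations generate
  the subgroup below.
\<close>

inductive_set null_sums :: "('n::{finite,linorder} cell \<Rightarrow>\<^sub>0 'g::ab_group_add) set" where
  flip: "(q, \<xi>) \<in> cells k UNIV \<Longrightarrow>
    Poly_Mapping.single (q, \<xi>) g + Poly_Mapping.single (q, - \<xi>) g \<in> null_sums"
| split: "\<lbrakk>(q, \<xi>) \<in> cells k UNIV; (q', \<xi>) \<in> cells k UNIV; (q'', \<xi>) \<in> cells k UNIV;
     q = q' \<union> q''; (q' \<inter> q'') facet_of q'; (q' \<inter> q'') facet_of q''\<rbrakk> \<Longrightarrow>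
    Poly_Mapping.single (q', \<xi>) g + Poly_Mapping.single (q'', \<xi>) g
      - Poly_Mapping.single (q, \<xi>) g \<in> null_sums"
| zero: "0 \<in> null_sums"
| diff: "\<lbrakk>S \<in> null_sums; T \<in> null_sums\<rbrakk> \<Longrightarrow> S - T \<in> null_sums"

lemma null_sums_uminus: "S \<in> null_sums \<Longrightarrow> - S \<in> null_sums"
  using null_sums.diff[OF null_sums.zero, of S] by simp

lemma null_sums_add: "\<lbrakk>S \<in> null_sums; T \<in> null_sums\<rbrakk> \<Longrightarrow> S + T \<in> null_sums"
  using null_sums.diff[of S "- T"] null_sums_uminus[of T] by simp

definition sum_rel ::
  "('n::{finite,linorder} cell \<Rightarrow>\<^sub>0 'g::ab_group_add) \<Rightarrow> ('n cell \<Rightarrow>\<^sub>0 'g) \<Rightarrow> bool" where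
  "sum_rel S T \<longleftrightarrow> S - T \<in> null_sums"

lemma sum_rel_trans: "sum_rel S T \<Longrightarrow> sum_rel T U \<Longrightarrow> sum_rel S U"
  using null_sums_add[of "S - T" "T - U"] by (simp add: sum_rel_def)

lemma sum_rel_sym: "sum_rel S T \<Longrightarrow> sum_rel T S"
  using null_sums_uminus[of "S - T"] by (simp add: sum_rel_def)

lemma equivp_sum_rel: "equivp sum_rel"
proof (rule equivpI)
  show "reflp sum_rel" by (rule reflpI) (simp add: sum_rel_def null_sums.zero)
  show "symp sum_rel" by (rule sympI) (rule sum_rel_sym)
  show "transp sum_rel" by (rule transpI) (rule sum_rel_trans)
qed

lemma sum_rel_add: "sum_rel S S' \<Longrightarrow> sum_rel T T' \<Longrightarrow> sum_rel (S + T) (S' + T')"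
  using null_sums_add[of "S - S'" "T - T'"] by (simp add: sum_rel_def algebra_simps)

lemma sum_rel_uminus: "sum_rel S S' \<Longrightarrow> sum_rel (- S) (- S')"
  using null_sums_uminus[of "S - S'"] by (simp add: sum_rel_def algebra_simps)

lemma sum_rel_diff: "sum_rel S S' \<Longrightarrow> sum_rel T T' \<Longrightarrow> sum_rel (S - T) (S' - T')"
  using null_sums.diff[of "S - S'" "T - T'"] by (simp add: sum_rel_def algebra_simps)

text \<open>
  The group of polyhedral chains of all dimensions in \<open>real ^ 'n\<close>. A generator of
  \<open>null_sums\<close> involves cells of a single dimension, and for a subspace \<open>X\<close> its cells
  either all lie in \<open>X\<close> or all fail to. Hence imposing the relations only among
  \<open>k\<close>-cells of \<open>X\<close> gives the same group as the subgroup \<open>poly_chains k X\<close> below.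
\<close>

quotient_type (overloaded) ('n, 'g) pchain =
  "('n::{finite,linorder} cell) \<Rightarrow>\<^sub>0 ('g::ab_group_add)" / sum_rel
  by (rule equivp_sum_rel)

instantiation pchain :: ("{finite,linorder}", ab_group_add) ab_group_add
begin

lift_definition zero_pchain :: "('a, 'b) pchain" is 0 .

lift_definition plus_pchain :: "('a, 'b) pchain \<Rightarrow> ('a, 'b) pchain \<Rightarrow> ('a, 'b) pchain" is "(+)"
  by (rule sum_rel_add)

lift_definition uminus_pchain :: "('a, 'b) pchain \<Rightarrow> ('a, 'b) pchain" is uminus
  by (rule sum_rel_uminus)

lift_definition minus_pchain :: "('a, 'b) pchain \<Rightarrow> ('a, 'b) pchain \<Rightarrow> ('a, 'b) pchain" is "(-)"
  by (rule sum_rel_diff)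

instance
proof
  fix a b c :: "('a, 'b) pchain"
  show "a + b + c = a + (b + c)"
    by transfer (simp add: sum_rel_def null_sums.zero add.assoc)
  show "a + b = b + a"
    by transfer (simp add: sum_rel_def null_sums.zero add.commute)
  show "0 + a = a"
    by transfer (simp add: sum_rel_def null_sums.zero)
  show "- a + a = 0"
    by transfer (simp add: sum_rel_def null_sums.zero)
  show "a - b = a + - b"
    by transfer (simp add: sum_rel_def null_sums.zero)
qed

end

abbreviation chain_of ::
  "('n::{finite,linorder} cell \<Rightarrow>\<^sub>0 'g::ab_group_add) \<Rightarrow> ('n, 'g) pchain" where
  "chain_of \<equiv> abs_pchain"

definition cell_chain :: "'g::ab_group_add \<Rightarrow> 'n::{finite,linorder} cell \<Rightarrow> ('n, 'g) pchain" where
  "cell_chain g p = chain_of (Poly_Mapping.single p g)"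

definition poly_chains ::
  "nat \<Rightarrow> (real, 'n) vec set \<Rightarrow> ('n::{finite,linorder}, 'g::ab_group_add) pchain set" where
  "poly_chains k X = {chain_of S | S. Poly_Mapping.keys S \<subseteq> cells k X}"

text \<open>
  The mass of an element of \<open>poly_chains k X\<close>; the Hausdorff measure of a \<open>k\<close>-cell is
  finite, so nothing is lost by \<open>enn2real\<close>. The infimum is attained, by any representation
  with non-overlapping cells.
\<close>

definition mass ::
  "('g::ab_group_add \<Rightarrow> real) \<Rightarrow> nat \<Rightarrow> (real, 'n) vec set \<Rightarrow> ('n::{finite,linorder}, 'g) pchain \<Rightarrow> real"
  where
  "mass gn k X P = Inf {(\<Sum>p\<in>Poly_Mapping.keys S.
      gn (Poly_Mapping.lookup S p) * enn2real (hausdorff_measure k (fst p))) | S.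
      Poly_Mapping.keys S \<subseteq> cells k X \<and> chain_of S = P}"


section \<open>Polyhedral tensor chains\<close>

definition coord_space :: "'n set \<Rightarrow> (real ^ 'n::finite) set" where
  "coord_space \<beta> = span ((\<lambda>j. axis j 1) ` \<beta>)"

text \<open>The index type \<open>'n\<close> stands for \<open>{1, \<dots>, n}\<close>; this is its subset \<open>{1, \<dots>, m}\<close>.\<close>

definition first_indices :: "nat \<Rightarrow> 'n::{finite,linorder} set" where
  "first_indices m = {j. card {i. i < j} < m}"

text \<open>
  A sum \<open>\<Sum> g\<^sub>i p\<^sub>i\<^sup>1 \<and> p\<^sub>i\<^sup>2\<close> is represented by a finitely supported function on pairs of cells.
\<close>

definition tensor_sums ::
  "'n set \<Rightarrow> 'n set \<Rightarrow> nat \<Rightarrow> nat \<Rightarrow>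
   ('n::{finite,linorder} cell \<times> 'n cell \<Rightarrow>\<^sub>0 'g::ab_group_add) set" where
  "tensor_sums \<alpha> \<beta> k1 k2 = {T. Poly_Mapping.keys T \<subseteq>
     cells k1 (coord_space (\<beta> \<inter> \<alpha>)) \<times> cells k2 (coord_space (\<beta> - \<alpha>))}"

definition tensor_chain_of ::
  "('n::{finite,linorder} cell \<times> 'n cell \<Rightarrow>\<^sub>0 'g::ab_group_add) \<Rightarrow> ('n, 'g) pchain" where
  "tensor_chain_of T = (\<Sum>(p1, p2)\<in>Poly_Mapping.keys T.
     cell_chain (Poly_Mapping.lookup T (p1, p2)) (wedge_cell p1 p2))"

definition tensor_chains ::
  "'n set \<Rightarrow> 'n set \<Rightarrow> nat \<Rightarrow> nat \<Rightarrow> ('n::{finite,linorder}, 'g::ab_group_add) pchain set" where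
  "tensor_chains \<alpha> \<beta> k1 k2 = tensor_chain_of ` tensor_sums \<alpha> \<beta> k1 k2"

definition bd1_sum ::
  "nat \<Rightarrow> ('n::{finite,linorder} cell \<times> 'n cell \<Rightarrow>\<^sub>0 'g::ab_group_add) \<Rightarrow> ('n, 'g) pchain" where
  "bd1_sum k1 T = (\<Sum>(p1, p2)\<in>Poly_Mapping.keys T. \<Sum>p'\<in>bd_cells k1 p1.
     cell_chain (Poly_Mapping.lookup T (p1, p2)) (wedge_cell p' p2))"

definition bd2_sum ::
  "nat \<Rightarrow> nat \<Rightarrow> ('n::{finite,linorder} cell \<times> 'n cell \<Rightarrow>\<^sub>0 'g::ab_group_add) \<Rightarrow> ('n, 'g) pchain"
  where
  "bd2_sum k1 k2 T =
     (let R = \<Sum>(p1, p2)\<in>Poly_Mapping.keys T. \<Sum>p'\<in>bd_cells k2 p2.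
        cell_chain (Poly_Mapping.lookup T (p1, p2)) (wedge_cell p1 p')
      in if even k1 then R else - R)"

text \<open>
  The partial boundaries of a tensor chain do not depend on the representation: two
  representations have a common subdivision into products of cells.
\<close>

definition bd1 ::
  "'n set \<Rightarrow> 'n set \<Rightarrow> nat \<Rightarrow> nat \<Rightarrow> ('n::{finite,linorder}, 'g::ab_group_add) pchain \<Rightarrow> ('n, 'g) pchain"
  where
  "bd1 \<alpha> \<beta> k1 k2 P =
     (THE Q. \<exists>T\<in>tensor_sums \<alpha> \<beta> k1 k2. tensor_chain_of T = P \<and> bd1_sum k1 T = Q)"

definition bd2 ::
  "'n set \<Rightarrow> 'n set \<Rightarrow> nat \<Rightarrow> nat \<Rightarrow> ('n::{finite,linorder}, 'g::ab_group_add) pchain \<Rightarrow> ('n, 'g) pchain"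
  where
  "bd2 \<alpha> \<beta> k1 k2 P =
     (THE Q. \<exists>T\<in>tensor_sums \<alpha> \<beta> k1 k2. tensor_chain_of T = P \<and> bd2_sum k1 k2 T = Q)"

text \<open>
  In the operators below, \<open>k1\<close> and \<open>k2\<close> are the degrees of the argument; the summand
  \<open>Q i1 i2\<close> has degrees \<open>k1 + i1\<close> and \<open>k2 + i2\<close>.
\<close>

definition poly_flat_norm ::
  "('g::ab_group_add \<Rightarrow> real) \<Rightarrow> 'n set \<Rightarrow> 'n set \<Rightarrow> nat \<Rightarrow> nat \<Rightarrow>
   ('n::{finite,linorder}, 'g) pchain \<Rightarrow> real" where
  "poly_flat_norm gn \<alpha> \<beta> k1 k2 P = Inf {
     (\<Sum>i1\<in>{0, 1}. \<Sum>i2\<in>{0, 1}. mass gn ((k1 + i1) + (k2 + i2)) (coord_space \<beta>) (Q i1 i2)) | Q.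
     (\<forall>i1\<in>{0, 1}. \<forall>i2\<in>{0, 1}. Q i1 i2 \<in> tensor_chains \<alpha> \<beta> (k1 + i1) (k2 + i2)) \<and>
     P = Q 0 0 + bd1 \<alpha> \<beta> (k1 + 1) k2 (Q 1 0) + bd2 \<alpha> \<beta> k1 (k2 + 1) (Q 0 1)
       + bd1 \<alpha> \<beta> (k1 + 1) k2 (bd2 \<alpha> \<beta> (k1 + 1) (k2 + 1) (Q 1 1))}"


section \<open>Flat tensor chains\<close>

text \<open>
  The completion of \<open>tensor_chains \<alpha> \<beta> k1 k2\<close>: its elements are the classes of Cauchy
  sequences modulo sequences tending to zero.
\<close>

definition cauchy_seqs ::
  "('g::ab_group_add \<Rightarrow> real) \<Rightarrow> 'n set \<Rightarrow> 'n set \<Rightarrow> nat \<Rightarrow> nat \<Rightarrow>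
   (nat \<Rightarrow> ('n::{finite,linorder}, 'g) pchain) set" where
  "cauchy_seqs gn \<alpha> \<beta> k1 k2 = {s. (\<forall>j. s j \<in> tensor_chains \<alpha> \<beta> k1 k2) \<and>
     (\<forall>e>0. \<exists>N. \<forall>i\<ge>N. \<forall>j\<ge>N. poly_flat_norm gn \<alpha> \<beta> k1 k2 (s i - s j) < e)}"

definition seq_rel ::
  "('g::ab_group_add \<Rightarrow> real) \<Rightarrow> 'n set \<Rightarrow> 'n set \<Rightarrow> nat \<Rightarrow> nat \<Rightarrow>
   (nat \<Rightarrow> ('n::{finite,linorder}, 'g) pchain) rel" where
  "seq_rel gn \<alpha> \<beta> k1 k2 = {(s, t). s \<in> cauchy_seqs gn \<alpha> \<beta> k1 k2 \<and> t \<in> cauchy_seqs gn \<alpha> \<beta> k1 k2 \<and>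
     (\<lambda>j. poly_flat_norm gn \<alpha> \<beta> k1 k2 (s j - t j)) \<longlonglongrightarrow> 0}"

type_synonym ('n, 'g) fchain = "(nat \<Rightarrow> ('n, 'g) pchain) set"

definition flat_chains ::
  "('g::ab_group_add \<Rightarrow> real) \<Rightarrow> 'n set \<Rightarrow> 'n set \<Rightarrow> nat \<Rightarrow> nat \<Rightarrow>
   ('n::{finite,linorder}, 'g) fchain set" where
  "flat_chains gn \<alpha> \<beta> k1 k2 = cauchy_seqs gn \<alpha> \<beta> k1 k2 // seq_rel gn \<alpha> \<beta> k1 k2"

definition fclass ::
  "('g::ab_group_add \<Rightarrow> real) \<Rightarrow> 'n set \<Rightarrow> 'n set \<Rightarrow> nat \<Rightarrow> nat \<Rightarrow>
   (nat \<Rightarrow> ('n::{finite,linorder}, 'g) pchain) \<Rightarrow> ('n, 'g) fchain" where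
  "fclass gn \<alpha> \<beta> k1 k2 s = seq_rel gn \<alpha> \<beta> k1 k2 `` {s}"

definition flat_of ::
  "('g::ab_group_add \<Rightarrow> real) \<Rightarrow> 'n set \<Rightarrow> 'n set \<Rightarrow> nat \<Rightarrow> nat \<Rightarrow>
   ('n::{finite,linorder}, 'g) pchain \<Rightarrow> ('n, 'g) fchain" where
  "flat_of gn \<alpha> \<beta> k1 k2 P = fclass gn \<alpha> \<beta> k1 k2 (\<lambda>j. P)"

definition fadd ::
  "('g::ab_group_add \<Rightarrow> real) \<Rightarrow> 'n set \<Rightarrow> 'n set \<Rightarrow> nat \<Rightarrow> nat \<Rightarrow>
   ('n::{finite,linorder}, 'g) fchain \<Rightarrow> ('n, 'g) fchain \<Rightarrow> ('n, 'g) fchain" where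
  "fadd gn \<alpha> \<beta> k1 k2 A B = (\<Union>a\<in>A. \<Union>b\<in>B. fclass gn \<alpha> \<beta> k1 k2 (\<lambda>j. a j + b j))"

definition fdiff ::
  "('g::ab_group_add \<Rightarrow> real) \<Rightarrow> 'n set \<Rightarrow> 'n set \<Rightarrow> nat \<Rightarrow> nat \<Rightarrow>
   ('n::{finite,linorder}, 'g) fchain \<Rightarrow> ('n, 'g) fchain \<Rightarrow> ('n, 'g) fchain" where
  "fdiff gn \<alpha> \<beta> k1 k2 A B = (\<Union>a\<in>A. \<Union>b\<in>B. fclass gn \<alpha> \<beta> k1 k2 (\<lambda>j. a j - b j))"

text \<open>For \<open>k1 = 0\<close> the target should be the zero group; all representatives are then zero.\<close>

definition fbd1 ::
  "('g::ab_group_add \<Rightarrow> real) \<Rightarrow> 'n set \<Rightarrow> 'n set \<Rightarrow> nat \<Rightarrow> nat \<Rightarrow>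
   ('n::{finite,linorder}, 'g) fchain \<Rightarrow> ('n, 'g) fchain" where
  "fbd1 gn \<alpha> \<beta> k1 k2 A = (\<Union>a\<in>A. fclass gn \<alpha> \<beta> (k1 - 1) k2 (\<lambda>j. bd1 \<alpha> \<beta> k1 k2 (a j)))"

definition fbd2 ::
  "('g::ab_group_add \<Rightarrow> real) \<Rightarrow> 'n set \<Rightarrow> 'n set \<Rightarrow> nat \<Rightarrow> nat \<Rightarrow>
   ('n::{finite,linorder}, 'g) fchain \<Rightarrow> ('n, 'g) fchain" where
  "fbd2 gn \<alpha> \<beta> k1 k2 A = (\<Union>a\<in>A. fclass gn \<alpha> \<beta> k1 (k2 - 1) (\<lambda>j. bd2 \<alpha> \<beta> k1 k2 (a j)))"

definition flat_norm ::
  "('g::ab_group_add \<Rightarrow> real) \<Rightarrow> 'n set \<Rightarrow> 'n set \<Rightarrow> nat \<Rightarrow> nat \<Rightarrow>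
   ('n::{finite,linorder}, 'g) fchain \<Rightarrow> real" where
  "flat_norm gn \<alpha> \<beta> k1 k2 A =
     (THE l. \<exists>a\<in>A. (\<lambda>j. poly_flat_norm gn \<alpha> \<beta> k1 k2 (a j)) \<longlonglongrightarrow> l)"

definition flat_mass ::
  "('g::ab_group_add \<Rightarrow> real) \<Rightarrow> 'n set \<Rightarrow> 'n set \<Rightarrow> nat \<Rightarrow> nat \<Rightarrow>
   ('n::{finite,linorder}, 'g) fchain \<Rightarrow> ennreal" where
  "flat_mass gn \<alpha> \<beta> k1 k2 A = Inf {
     liminf (\<lambda>j. ennreal (mass gn (k1 + k2) (coord_space \<beta>) (P j))) | P.
     (\<forall>j. P j \<in> tensor_chains \<alpha> \<beta> k1 k2) \<and>
     (\<lambda>j. flat_norm gn \<alpha> \<beta> k1 k2 (fdiff gn \<alpha> \<beta> k1 k2 (flat_of gn \<alpha> \<beta> k1 k2 (P j)) A)) \<longlonglongrightarrow> 0}"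

end

theory Submission
  imports Defs
begin

text \<open>
  The boundary of a formal sum of cells respects the flip and splitting relations, and these relations
  only involve cells with the same direction space. A facet of a product cell is a facet of one factor
  times the other factor, and its direction space tells which factor was replaced. So \<open>\<partial>\<^sub>1 P\<close> and
  \<open>\<partial>\<^sub>2 P\<close> are the parts of the total boundary of \<open>P\<close> of given type; in particular they do not depend
  on the representation of \<open>P\<close>. Since every ridge of a polytope lies in exactly two facets, which induce
  opposite orientations on it, \<open>\<partial>\<^sub>1\<partial>\<^sub>1 = \<partial>\<^sub>2\<partial>\<^sub>2 = 0\<close> and \<open>\<partial>\<^sub>2\<partial>\<^sub>1 = - \<partial>\<^sub>1\<partial>\<^sub>2\<close>, so both boundaries do not increase
  the flat norm.

  Given a decomposition of \<open>A\<close> with finite masses, replace each term by a polyhedral chain of almost the same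
  mass that is close to it in the flat norm: this bounds the flat norm of \<open>A\<close> by the masses. Conversely,
  write \<open>A\<close> as a polyhedral chain of almost the same flat norm plus a series of polyhedral chains of small
  total flat norm, decompose every term almost optimally, and sum the pieces.
\<close>

subsection \<open>The exterior algebra\<close>

text \<open>Two formal sums represent the same chain when they differ by some combination of flips
  and splittings, and such a combination may pass through cells that are not products. Comparing
  \<open>bd1_sum\<close> on two representations directly would call for a common subdivision into
  products. Filtering the ordinary boundary by the direction spaces of the facets avoids this: the
  filter makes sense for every cell and is compatible with each generating relation separately. What
  remains is convex geometry. A splitting has to be recognised as a cut by a hyperplane, and a ridge
  has to be shown to lie in exactly two facets.

  That boundaries do not increase the flat norm serves twice: it lets them act on classes of Cauchy
  sequences, and it keeps the chain assembled from polyhedral approximations of four pieces close to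
  the one assembled from the pieces themselves. The mass of a limit is bounded by any uniform bound
  on the masses of an approximating sequence, which is why the pieces of the optimal decomposition
  are built as series with summable masses.\<close>

definition inv_sign :: "'n::{finite,linorder} set \<Rightarrow> 'n set \<Rightarrow> real" where
  "inv_sign I J = (- 1) ^ card {(i, j). i \<in> I \<and> j \<in> J \<and> j < i}"

lemma wedge_nth: "wedge \<xi> \<eta> $ K = (\<Sum>I\<in>Pow K. inv_sign I (K - I) * (\<xi> $ I) * (\<eta> $ (K - I)))"
  by (simp add: wedge_def inv_sign_def)

lemma inv_sign_empty [simp]: "inv_sign {} J = 1" "inv_sign I {} = 1"
  by (simp_all add: inv_sign_def)

text \<open>Inversions are counted pair by pair, so the sign is multiplicative over disjoint unions
  in each argument. This is the identity behind the associativity of \<open>wedge\<close>.\<close>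

lemma inv_sign_Un_left:
  assumes "I \<inter> J = {}"
  shows "inv_sign (I \<union> J) K = inv_sign I K * inv_sign J K"
proof -
  have "{(i, j). i \<in> I \<union> J \<and> j \<in> K \<and> j < i} =
    {(i, j). i \<in> I \<and> j \<in> K \<and> j < i} \<union> {(i, j). i \<in> J \<and> j \<in> K \<and> j < i}" by auto
  moreover have "{(i, j). i \<in> I \<and> j \<in> K \<and> j < i} \<inter> {(i, j). i \<in> J \<and> j \<in> K \<and> j < i} = {}"
    using assms by auto
  ultimately show ?thesis
    unfolding inv_sign_def by (simp add: card_Un_disjoint power_add)
qed

lemma inv_sign_Un_right:
  assumes "J \<inter> K = {}"
  shows "inv_sign I (J \<union> K) = inv_sign I J * inv_sign I K"
proof -
  have "{(i, j). i \<in> I \<and> j \<in> J \<union> K \<and> j < i} =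
    {(i, j). i \<in> I \<and> j \<in> J \<and> j < i} \<union> {(i, j). i \<in> I \<and> j \<in> K \<and> j < i}" by auto
  moreover have "{(i, j). i \<in> I \<and> j \<in> J \<and> j < i} \<inter> {(i, j). i \<in> I \<and> j \<in> K \<and> j < i} = {}"
    using assms by auto
  ultimately show ?thesis
    unfolding inv_sign_def by (simp add: card_Un_disjoint power_add)
qed

lemma inv_sign_square [simp]: "inv_sign I J * inv_sign I J = 1"
  by (simp add: inv_sign_def flip: power_add mult_2)

lemma inv_sign_singletons: "inv_sign {i} {j} = (if j < i then - 1 else 1)"
proof -
  have "{(i', j'). i' \<in> {i} \<and> j' \<in> {j} \<and> j' < i'} = (if j < i then {(i, j)} else {})" by auto
  thus ?thesis by (simp add: inv_sign_def)
qed

lemma inv_sign_swap: "i \<noteq> j \<Longrightarrow> inv_sign {i} {j} = - inv_sign {j} {i}"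
  by (auto simp: inv_sign_singletons)

lemma inv_sign_insert: "j \<notin> K \<Longrightarrow> inv_sign {i} (insert j K) = inv_sign {i} {j} * inv_sign {i} K"
  using inv_sign_Un_right[of "{j}" K "{i}"] by simp

section \<open>Algebra of the exterior product\<close>

lemma wedge_add_left: "wedge (\<xi> + \<xi>') \<eta> = wedge \<xi> \<eta> + wedge \<xi>' \<eta>"
  by (simp add: vec_eq_iff wedge_nth algebra_simps sum.distrib)

lemma wedge_add_right: "wedge \<xi> (\<eta> + \<eta>') = wedge \<xi> \<eta> + wedge \<xi> \<eta>'"
  by (simp add: vec_eq_iff wedge_nth algebra_simps sum.distrib)

lemma wedge_scaleR_left [simp]: "wedge (c *\<^sub>R \<xi>) \<eta> = c *\<^sub>R wedge \<xi> \<eta>"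
  by (simp add: vec_eq_iff wedge_nth algebra_simps sum_distrib_left)

lemma wedge_scaleR_right [simp]: "wedge \<xi> (c *\<^sub>R \<eta>) = c *\<^sub>R wedge \<xi> \<eta>"
  by (simp add: vec_eq_iff wedge_nth algebra_simps sum_distrib_left)

lemma wedge_zero [simp]: "wedge 0 \<eta> = 0" "wedge \<xi> 0 = 0"
  by (simp_all add: vec_eq_iff wedge_nth)

lemma wedge_minus_left [simp]: "wedge (- \<xi>) \<eta> = - wedge \<xi> \<eta>"
  using wedge_scaleR_left[of "-1"] by simp

lemma wedge_minus_right [simp]: "wedge \<xi> (- \<eta>) = - wedge \<xi> \<eta>"
  using wedge_scaleR_right[of _ "-1"] by simp

lemma wedge_one_left [simp]: "wedge (axis {} 1) \<eta> = \<eta>"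
proof -
  have "(\<Sum>I\<in>Pow K. inv_sign I (K - I) * (axis {} 1 $ I) * (\<eta> $ (K - I))) = \<eta> $ K" for K
  proof -
    have "(\<Sum>I\<in>Pow K. inv_sign I (K - I) * (axis {} 1 $ I) * (\<eta> $ (K - I)))
      = (\<Sum>I\<in>{{}}. inv_sign I (K - I) * (axis {} 1 $ I) * (\<eta> $ (K - I)))"
      by (rule sum.mono_neutral_right) (auto simp: axis_def)
    thus ?thesis by (simp add: axis_def)
  qed
  thus ?thesis by (simp add: vec_eq_iff wedge_nth)
qed

text \<open>Both sides sum over the ways to cut \<open>K\<close> into three disjoint blocks
  \<open>I\<close>, \<open>L - I\<close>, \<open>K - L\<close>; by multiplicativity both signs equal
  the product of the signs of the three pairs of blocks.\<close>

lemma wedge_assoc: "wedge (wedge \<xi> \<eta>) \<zeta> = wedge \<xi> (wedge \<eta> \<zeta>)"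
proof -
  have "wedge (wedge \<xi> \<eta>) \<zeta> $ K = wedge \<xi> (wedge \<eta> \<zeta>) $ K" for K
  proof -
    let ?f = "\<lambda>(L, I). inv_sign L (K - L) * (inv_sign I (L - I) * \<xi> $ I * \<eta> $ (L - I)) * \<zeta> $ (K - L)"
    let ?g = "\<lambda>(I, J). inv_sign I (K - I) * \<xi> $ I * (inv_sign J (K - I - J) * \<eta> $ J * \<zeta> $ (K - I - J))"
    have "wedge (wedge \<xi> \<eta>) \<zeta> $ K = sum ?f (SIGMA L:Pow K. Pow L)"
      by (subst sum.Sigma[symmetric]) (simp_all add: wedge_nth sum_distrib_left sum_distrib_right)
    also have "\<dots> = sum ?g (SIGMA I:Pow K. Pow (K - I))"
    proof -
      have key: "?g (I, L - I) = ?f (L, I)" if LI: "L \<subseteq> K" "I \<subseteq> L" for L I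
      proof -
      have 1: "inv_sign I (K - I) = inv_sign I (L - I) * inv_sign I (K - L)"
      proof -
        have "K - I = (L - I) \<union> (K - L)" using LI by auto
        moreover have "(L - I) \<inter> (K - L) = {}" by auto
        ultimately show ?thesis by (simp only: inv_sign_Un_right)
      qed
      have 2: "inv_sign L (K - L) = inv_sign I (K - L) * inv_sign (L - I) (K - L)"
        using inv_sign_Un_left[of I "L - I" "K - L"] LI by (simp add: Un_absorb1)
      have 3: "K - I - (L - I) = K - L" using LI by auto
        show ?thesis by (simp add: 1 2 3)
      qed
      show ?thesis
      proof (rule sum.reindex_bij_witness[where i = "\<lambda>(I, J). (I \<union> J, I)" and j = "\<lambda>(L, I). (I, L - I)"],
          goal_cases)
        case (5 a)
        thus ?case using key by (cases a) auto
      qed auto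
    qed
    also have "\<dots> = wedge \<xi> (wedge \<eta> \<zeta>) $ K"
      by (subst sum.Sigma[symmetric]) (simp_all add: wedge_nth sum_distrib_left sum_distrib_right)
    finally show ?thesis .
  qed
  thus ?thesis by (simp add: vec_eq_iff)
qed

lemma mvec_of_nth_singleton [simp]: "mvec_of v $ {j} = v $ j"
  by (simp add: mvec_of_def axis_def if_distrib cong: if_cong)

lemma mvec_of_nth_other: "(\<And>j. K \<noteq> {j}) \<Longrightarrow> mvec_of v $ K = 0"
  by (simp add: mvec_of_def axis_def)

lemma linear_mvec_of: "linear mvec_of"
  by (rule linearI) (simp_all add: mvec_of_def algebra_simps sum.distrib scaleR_sum_right)

lemmas mvec_of_add = linear_add[OF linear_mvec_of]
  and mvec_of_scaleR = linear_scale[OF linear_mvec_of]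
  and mvec_of_minus = linear_neg[OF linear_mvec_of]
  and mvec_of_diff = linear_diff[OF linear_mvec_of]
  and mvec_of_zero = linear_0[OF linear_mvec_of]

lemma wedge_mvec_nth:
  "wedge (mvec_of v) \<eta> $ K = (\<Sum>j\<in>K. inv_sign {j} (K - {j}) * v $ j * \<eta> $ (K - {j}))"
proof -
  let ?f = "\<lambda>I. inv_sign I (K - I) * (mvec_of v $ I) * (\<eta> $ (K - I))"
  have "wedge (mvec_of v) \<eta> $ K = sum ?f ((\<lambda>j. {j}) ` K)"
    unfolding wedge_nth
  proof (rule sum.mono_neutral_right)
    show "\<forall>I\<in>Pow K - (\<lambda>j. {j}) ` K. ?f I = 0"
    proof
      fix I assume "I \<in> Pow K - (\<lambda>j. {j}) ` K"
      hence "mvec_of v $ I = 0" by (intro mvec_of_nth_other) auto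
      thus "?f I = 0" by simp
    qed
  qed auto
  also have "\<dots> = (\<Sum>j\<in>K. inv_sign {j} (K - {j}) * v $ j * \<eta> $ (K - {j}))"
    by (subst sum.reindex) (auto simp: inj_on_def)
  finally show ?thesis .
qed

text \<open>Removing \<open>i\<close> and then \<open>j\<close> from \<open>K\<close> leaves the
  same set as removing them in the other order, and exactly one of the two orders has an inversion
  between \<open>i\<close> and \<open>j\<close>.\<close>

lemma wedge_mvec_anticommute:
  "wedge (mvec_of v) (wedge (mvec_of w) \<eta>) = - wedge (mvec_of w) (wedge (mvec_of v) \<eta>)"
proof -
  have "wedge (mvec_of v) (wedge (mvec_of w) \<eta>) $ K = - (wedge (mvec_of w) (wedge (mvec_of v) \<eta>) $ K)"
    for K
  proof -
    let ?f = "\<lambda>v w i j. inv_sign {i} (K - {i}) * v $ i *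
        (inv_sign {j} (K - {i} - {j}) * w $ j * \<eta> $ (K - {i} - {j}))"
    have expand: "wedge (mvec_of v) (wedge (mvec_of w) \<eta>) $ K =
        sum (\<lambda>(i, j). ?f v w i j) (SIGMA i:K. K - {i})" for v w
      by (subst sum.Sigma[symmetric]) (simp_all add: wedge_mvec_nth sum_distrib_left)
    have "sum (\<lambda>(i, j). ?f v w i j) (SIGMA i:K. K - {i}) = sum (\<lambda>(i, j). - ?f w v i j) (SIGMA i:K. K - {i})"
    proof -
      have key: "- ?f w v j i = ?f v w i j" if ij: "i \<in> K" "j \<in> K" "j \<noteq> i" for i j
      proof -
      define M where "M = K - {i} - {j}"
        have K: "K - {j} - {i} = M" "K - {i} - {j} = M" "K - {i} = insert j M" "K - {j} = insert i M"
          "i \<notin> M" "j \<notin> M"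
          using ij by (auto simp: M_def)
        show ?thesis
          unfolding K(1,2) unfolding K(3,4) inv_sign_insert[OF K(5)] inv_sign_insert[OF K(6)] inv_sign_swap[OF ij(3)[symmetric]]
          by (simp add: algebra_simps)
      qed
      show ?thesis
      proof (rule sum.reindex_bij_witness[where i = "\<lambda>(i, j). (j, i)" and j = "\<lambda>(i, j). (j, i)"],
          goal_cases)
        case (5 a)
        thus ?case using key by (cases a) auto
      qed auto
    qed
    also have "\<dots> = - sum (\<lambda>(i, j). ?f w v i j) (SIGMA i:K. K - {i})"
      by (simp add: sum_negf[symmetric] split_def)
    finally show ?thesis by (simp only: expand)
  qed
  thus ?thesis by (simp add: vec_eq_iff)
qed

lemma wedge_mvec_same [simp]: "wedge (mvec_of v) (wedge (mvec_of v) \<eta>) = 0"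
  using wedge_mvec_anticommute[of v v \<eta>] by (simp add: vec_eq_iff)

text \<open>The interior product with \<open>v\<close>. It enters as the adjoint of exterior
  multiplication by \<open>v\<close>, which gives access to the norms of wedge products.\<close>

definition contract :: "(real, 'n) vec \<Rightarrow> 'n::{finite,linorder} mvec \<Rightarrow> 'n mvec" where
  "contract v \<eta> = (\<chi> K. \<Sum>j\<in>- K. inv_sign {j} K * v $ j * \<eta> $ (insert j K))"

text \<open>An index set with a marked member corresponds to the smaller set with a new index; this
  bijection turns one double sum into the other.\<close>

lemma inner_wedge_mvec: "wedge (mvec_of v) \<eta> \<bullet> \<zeta> = \<eta> \<bullet> contract v \<zeta>"
proof -
  have "wedge (mvec_of v) \<eta> \<bullet> \<zeta> =
    (\<Sum>(K, j)\<in>(SIGMA K:UNIV. K). inv_sign {j} (K - {j}) * v $ j * \<eta> $ (K - {j}) * \<zeta> $ K)"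
    by (subst sum.Sigma[symmetric]) (simp_all add: inner_vec_def wedge_mvec_nth sum_distrib_right)
  also have "\<dots> = (\<Sum>(L, j)\<in>(SIGMA L:UNIV. - L). \<eta> $ L * (inv_sign {j} L * v $ j * \<zeta> $ (insert j L)))"
    by (rule sum.reindex_bij_witness[where i = "\<lambda>(L, j). (insert j L, j)" and j = "\<lambda>(K, j). (K - {j}, j)"])
       (auto simp: insert_absorb)
  also have "\<dots> = \<eta> \<bullet> contract v \<zeta>"
    by (subst sum.Sigma[symmetric]) (simp_all add: inner_vec_def contract_def sum_distrib_left)
  finally show ?thesis .
qed

text \<open>The antiderivation rule. Equal indices contribute \<open>v $ j * w $ j\<close>, for
  \<open>j\<close> outside \<open>K\<close> from the left side and for \<open>j\<close> inside
  \<open>K\<close> from the last term, together the full inner product; the terms with two different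
  indices cancel.\<close>

lemma contract_wedge:
  "contract v (wedge (mvec_of w) \<eta>) = (v \<bullet> w) *\<^sub>R \<eta> - wedge (mvec_of w) (contract v \<eta>)"
proof -
  have "contract v (wedge (mvec_of w) \<eta>) $ K + wedge (mvec_of w) (contract v \<eta>) $ K
     = (v \<bullet> w) * \<eta> $ K" for K
  proof -
    have 1: "contract v (wedge (mvec_of w) \<eta>) $ K = (\<Sum>j\<in>- K. v $ j * w $ j * \<eta> $ K)
      + (\<Sum>j\<in>- K. \<Sum>i\<in>K. inv_sign {j} K * v $ j *
          (inv_sign {i} (insert j K - {i}) * w $ i * \<eta> $ (insert j K - {i})))"
    proof -
      have "inv_sign {j} K * v $ j * (wedge (mvec_of w) \<eta> $ insert j K) =
        v $ j * w $ j * \<eta> $ K + (\<Sum>i\<in>K. inv_sign {j} K * v $ j *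
          (inv_sign {i} (insert j K - {i}) * w $ i * \<eta> $ (insert j K - {i})))" if "j \<in> - K" for j
      proof -
        have "inv_sign {j} K * v $ j * (inv_sign {j} K * w $ j * \<eta> $ K) =
           (inv_sign {j} K * inv_sign {j} K) * (v $ j * w $ j * \<eta> $ K)" by (simp only: ac_simps)
        thus ?thesis using that
          by (simp add: wedge_mvec_nth sum_distrib_left distrib_left)
      qed
      thus ?thesis by (simp add: contract_def sum.distrib)
    qed
    have 2: "wedge (mvec_of w) (contract v \<eta>) $ K = (\<Sum>i\<in>K. v $ i * w $ i * \<eta> $ K)
      + (\<Sum>i\<in>K. \<Sum>j\<in>- K. inv_sign {i} (K - {i}) * w $ i *
          (inv_sign {j} (K - {i}) * v $ j * \<eta> $ (insert j (K - {i}))))"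
    proof -
      have "inv_sign {i} (K - {i}) * w $ i * (contract v \<eta> $ (K - {i})) =
        v $ i * w $ i * \<eta> $ K + (\<Sum>j\<in>- K. inv_sign {i} (K - {i}) * w $ i *
          (inv_sign {j} (K - {i}) * v $ j * \<eta> $ (insert j (K - {i}))))" if "i \<in> K" for i
      proof -
        have "- (K - {i}) = insert i (- K)" using that by auto
        moreover have "inv_sign {i} (K - {i}) * w $ i * (inv_sign {i} (K - {i}) * v $ i * \<eta> $ K) =
           (inv_sign {i} (K - {i}) * inv_sign {i} (K - {i})) * (v $ i * w $ i * \<eta> $ K)"
          by (simp only: ac_simps)
        ultimately show ?thesis using that
          by (simp add: contract_def sum_distrib_left distrib_left insert_absorb)
      qed
      thus ?thesis by (simp add: wedge_mvec_nth sum.distrib)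
    qed
    \<comment> \<open>Inserting \<open>j\<close> before or after removing \<open>i\<close> differs
      by one sign, because \<open>inv_sign {i} {j}\<close> and \<open>inv_sign {j} {i}\<close> are
      opposite.\<close>
    have 3: "inv_sign {j} K * v $ j * (inv_sign {i} (insert j K - {i}) * w $ i * \<eta> $ (insert j K - {i}))
      = - (inv_sign {i} (K - {i}) * w $ i * (inv_sign {j} (K - {i}) * v $ j * \<eta> $ (insert j (K - {i}))))"
      if ij: "i \<in> K" "j \<in> - K" for i j
    proof -
      obtain M where K: "K = insert i M" "i \<notin> M" using ij(1) by (rule Set.set_insert)
      have K': "j \<notin> M" "i \<noteq> j" "insert j (insert i M) - {i} = insert j M" using K ij by blast+
      have "inv_sign {j} (insert i M) * v $ j * (inv_sign {i} (insert j M) * w $ i * \<eta> $ (insert j M))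
        = (inv_sign {j} {i} * inv_sign {i} {j}) *
          (inv_sign {i} M * w $ i * (inv_sign {j} M * v $ j * \<eta> $ (insert j M)))"
        unfolding inv_sign_insert[OF K(2)] inv_sign_insert[OF K'(1)] by simp
      also have "inv_sign {j} {i} * inv_sign {i} {j} = - 1"
        using inv_sign_swap[OF K'(2)] by (simp add: inv_sign_singletons)
      finally show ?thesis using K(2) K' by (simp add: K(1))
    qed
    have "(\<Sum>j\<in>- K. \<Sum>i\<in>K. inv_sign {j} K * v $ j *
          (inv_sign {i} (insert j K - {i}) * w $ i * \<eta> $ (insert j K - {i})))
      = - (\<Sum>i\<in>K. \<Sum>j\<in>- K. inv_sign {i} (K - {i}) * w $ i *
          (inv_sign {j} (K - {i}) * v $ j * \<eta> $ (insert j (K - {i}))))"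
      unfolding sum_negf[symmetric] by (subst sum.swap) (intro sum.cong refl 3, auto)
    moreover have "(\<Sum>j\<in>- K. v $ j * w $ j * \<eta> $ K) + (\<Sum>i\<in>K. v $ i * w $ i * \<eta> $ K)
      = (v \<bullet> w) * \<eta> $ K"
      by (subst sum.union_disjoint[symmetric])
         (auto simp: inner_vec_def sum_distrib_right Compl_partition2 intro!: sum.cong)
    ultimately show ?thesis unfolding 1 2 by simp
  qed
  hence "contract v (wedge (mvec_of w) \<eta>) $ K = (v \<bullet> w) * \<eta> $ K - wedge (mvec_of w) (contract v \<eta>) $ K" for K
    by (simp add: eq_diff_eq)
  thus ?thesis by (simp add: vec_eq_iff)
qed

text \<open>Adjointness and the antiderivation rule reduce the squared norm to
  \<open>\<eta> \<bullet> \<eta>\<close> once the contraction vanishes.\<close>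

lemma norm_wedge_mvec:
  assumes "contract v \<eta> = 0" "norm v = 1"
  shows "norm (wedge (mvec_of v) \<eta>) = norm \<eta>"
proof -
  have "wedge (mvec_of v) \<eta> \<bullet> wedge (mvec_of v) \<eta> =
      \<eta> \<bullet> ((v \<bullet> v) *\<^sub>R \<eta> - wedge (mvec_of v) (contract v \<eta>))"
    by (simp only: inner_wedge_mvec contract_wedge)
  also have "\<dots> = \<eta> \<bullet> \<eta>"
    using assms by (simp add: power2_norm_eq_inner[symmetric, of v])
  finally show ?thesis by (simp add: norm_eq_sqrt_inner)
qed

section \<open>Wedges of lists and the top exterior power\<close>

lemma wedge_list_simps [simp]:
  "wedge_list [] = axis {} 1" "wedge_list (v # vs) = wedge (mvec_of v) (wedge_list vs)"
  by (simp_all add: wedge_list_def)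

lemma wedge_list_append: "wedge_list (vs @ ws) = wedge (wedge_list vs) (wedge_list ws)"
  by (induction vs) (simp_all add: wedge_assoc)

lemma contract_scaleR: "contract v (c *\<^sub>R \<eta>) = c *\<^sub>R contract v \<eta>"
  by (simp add: vec_eq_iff contract_def sum_distrib_left algebra_simps)

lemma contract_wedge_list:
  assumes "\<And>w. w \<in> set vs \<Longrightarrow> v \<bullet> w = 0"
  shows "contract v (wedge_list vs) = 0"
  using assms
proof (induction vs)
  case Nil
  show ?case by (simp add: vec_eq_iff contract_def axis_def)
qed (simp add: contract_wedge)

lemma norm_wedge_list_orthonormal:
  assumes "distinct vs" "pairwise orthogonal (set vs)" "\<And>v. v \<in> set vs \<Longrightarrow> norm v = 1"
  shows "norm (wedge_list vs) = 1"
  using assms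
proof (induction vs)
  case (Cons v vs)
  have "contract v (wedge_list vs) = 0"
    by (rule contract_wedge_list) (use Cons.prems in \<open>auto simp: pairwise_def orthogonal_def\<close>)
  thus ?case using Cons by (auto simp: norm_wedge_mvec pairwise_insert)
qed simp

lemma wedge_list_move:
  "wedge_list (xs @ b # ys) = (- 1) ^ length xs *\<^sub>R wedge_list (b # xs @ ys)"
proof (induction xs)
  case (Cons x xs)
  thus ?case
    by simp (subst wedge_mvec_anticommute, simp)
qed simp

lemma wedge_list_commute_mvec:
  "wedge (wedge_list xs) (wedge (mvec_of b) \<eta>) = (- 1) ^ length xs *\<^sub>R wedge (mvec_of b) (wedge (wedge_list xs) \<eta>)"
proof (induction xs)
  case (Cons x xs)
  thus ?case
    by (simp add: wedge_assoc) (subst wedge_mvec_anticommute, simp)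
qed simp

text \<open>Two copies of the repeated vector are moved to the front, where they annihilate each
  other.\<close>

lemma wedge_list_not_distinct:
  assumes "\<not> distinct vs"
  shows "wedge_list vs = 0"
proof -
  obtain xs ys zs y where "vs = xs @ [y] @ ys @ [y] @ zs"
    using not_distinct_decomp[OF assms] by blast
  hence "wedge_list vs = (- 1) ^ length xs *\<^sub>R (- 1) ^ (length (xs @ ys)) *\<^sub>R
     wedge (mvec_of y) (wedge (mvec_of y) (wedge_list (xs @ ys @ zs)))"
    using wedge_list_move[of xs y "ys @ y # zs"] wedge_list_move[of "xs @ ys" y zs] by simp
  thus ?thesis by simp
qed

lemma wedge_list_permute:
  assumes "distinct us" "distinct bs" "set us = set bs"
  shows "\<exists>c. \<bar>c\<bar> = 1 \<and> wedge_list us = c *\<^sub>R wedge_list bs"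
  using assms
proof (induction bs arbitrary: us)
  case Nil
  thus ?case by (intro exI[of _ 1]) simp
next
  case (Cons b bs)
  then obtain xs ys where us: "us = xs @ b # ys" by (metis list.set_intros(1) split_list)
  have "distinct (xs @ ys)" "set (xs @ ys) = set bs" using Cons.prems us by auto
  then obtain c where c: "\<bar>c\<bar> = 1" "wedge_list (xs @ ys) = c *\<^sub>R wedge_list bs"
    using Cons.IH[of "xs @ ys"] Cons.prems by auto
  have "wedge_list us = ((- 1) ^ length xs * c) *\<^sub>R wedge_list (b # bs)"
    using c(2) wedge_list_move[of xs b ys] us by simp
  thus ?case using c(1) by (intro exI[of _ "(- 1) ^ length xs * c"]) (simp add: abs_mult power_abs)
qed

text \<open>Multilinear expansion: the outer induction is on the list, the inner ones on linear
  combinations of wedges and of vectors of \<open>B\<close>.\<close>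

lemma wedge_list_in_span:
  assumes "set vs \<subseteq> span B"
  shows "wedge_list vs \<in> span {wedge_list us |us. length us = length vs \<and> set us \<subseteq> B}"
  using assms
proof (induction vs)
  case Nil
  show ?case by (intro span_base) auto
next
  case (Cons v vs)
  let ?W = "\<lambda>k. {wedge_list us |us. length us = k \<and> set us \<subseteq> B}"
  have "wedge (mvec_of v) \<omega> \<in> span (?W (Suc (length vs)))" if "\<omega> \<in> span (?W (length vs))" for \<omega>
    using that
  proof (induction rule: span_induct_alt)
    case (step c \<omega> y)
    then obtain us where us: "\<omega> = wedge_list us" "length us = length vs" "set us \<subseteq> B" by auto
    have "v \<in> span B" using Cons.prems by simp
    hence "wedge (mvec_of v) \<omega> \<in> span (?W (Suc (length vs)))"
    proof (induction rule: span_induct_alt)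
      case base
      show ?case by (simp add: mvec_of_zero span_zero)
    next
      case (step d b z)
      have "wedge (mvec_of b) \<omega> \<in> ?W (Suc (length vs))"
        using us step by (intro CollectI exI[of _ "b # us"]) auto
      thus ?case
        by (simp add: mvec_of_add mvec_of_scaleR wedge_add_left span_add span_scale span_base step)
    qed
    thus ?case by (simp add: wedge_add_right span_add span_scale step)
  qed (simp add: span_zero)
  thus ?case using Cons by simp
qed

text \<open>The top exterior power is a line. In the expansion over \<open>bs\<close>, lists with a
  repetition vanish and, by counting, all others are permutations of \<open>bs\<close>.\<close>

lemma wedge_list_full_dim:
  assumes "distinct bs" "length vs = length bs" "set vs \<subseteq> span (set bs)"
  shows "\<exists>c. wedge_list vs = c *\<^sub>R wedge_list bs"
proof -
  have "{wedge_list us |us. length us = length vs \<and> set us \<subseteq> set bs} \<subseteq> span {wedge_list bs}"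
  proof clarify
    fix us assume us: "length us = length vs" "set us \<subseteq> set bs"
    show "wedge_list us \<in> span {wedge_list bs}"
    proof (cases "distinct us")
      case True
      hence "set us = set bs" using us assms distinct_card
        by (metis List.finite_set card_subset_eq)
      thus ?thesis using wedge_list_permute[OF True assms(1)] by (auto simp: span_singleton)
    next
      case False
      thus ?thesis by (simp add: wedge_list_not_distinct span_zero)
    qed
  qed
  hence "wedge_list vs \<in> span {wedge_list bs}"
    using wedge_list_in_span[OF assms(3)] span_minimal subspace_span by blast
  thus ?thesis by (auto simp: span_singleton)
qed


subsection \<open>Direction spaces\<close>

lemma subspace_directions [simp]: "subspace (directions S)"
  by (simp add: directions_def)

lemma diff_in_directions: "x \<in> S \<Longrightarrow> y \<in> S \<Longrightarrow> x - y \<in> directions S"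
  unfolding directions_def by (rule span_base) auto

lemma directions_mono: "S \<subseteq> T \<Longrightarrow> directions S \<subseteq> directions T"
  unfolding directions_def by (rule span_mono) auto

lemma directions_least:
  assumes "subspace V" "\<And>x y. x \<in> S \<Longrightarrow> y \<in> S \<Longrightarrow> x - y \<in> V"
  shows "directions S \<subseteq> V"
  unfolding directions_def using assms by (intro span_minimal) auto

lemma directions_eq_span:
  assumes "a \<in> S"
  shows "directions S = span ((\<lambda>x. x - a) ` S)"
proof
  show "directions S \<subseteq> span ((\<lambda>x. x - a) ` S)"
  proof (rule directions_least)
    fix x y assume "x \<in> S" "y \<in> S"
    hence "(x - a) - (y - a) \<in> span ((\<lambda>x. x - a) ` S)" by (intro span_diff span_base) auto
    thus "x - y \<in> span ((\<lambda>x. x - a) ` S)" by simp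
  qed simp
  show "span ((\<lambda>x. x - a) ` S) \<subseteq> directions S"
    using assms by (intro span_minimal) (auto intro: diff_in_directions)
qed

lemma affine_hull_iff_directions:
  assumes "a \<in> S"
  shows "x \<in> affine hull S \<longleftrightarrow> x - a \<in> directions S"
  unfolding directions_eq_span[OF assms] diffs_affine_hull_span[OF assms, symmetric]
  by auto

lemma aff_dim_eq_directions:
  assumes "S \<noteq> {}"
  shows "aff_dim S = int (dim (directions S))"
proof -
  obtain a where a: "a \<in> S" using assms by auto
  have "aff_dim S = aff_dim (affine hull S)" by simp
  also have "\<dots> = int (dim ((\<lambda>x. x - a) ` (affine hull S)))"
    using a by (intro aff_dim_dim_affine_diffs) (auto simp: hull_inc)
  also have "\<dots> = int (dim (directions S))"
    by (simp add: diffs_affine_hull_span[OF a] directions_eq_span[OF a])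
  finally show ?thesis .
qed

text \<open>Gives a piece of full dimension the direction space of the whole, so that the same
  multivectors orient both.\<close>

lemma directions_eqI:
  assumes "S \<subseteq> T" "aff_dim S = aff_dim T" "S \<noteq> {}"
  shows "directions S = directions T"
proof (rule subspace_dim_equal)
  show "dim (directions T) \<le> dim (directions S)"
    using assms(2) aff_dim_eq_directions[OF assms(3)] aff_dim_eq_directions[of T] assms(1,3) by fastforce
qed (use assms directions_mono in auto)

lemma directions_orthogonalI:
  assumes "\<And>x y. x \<in> S \<Longrightarrow> y \<in> S \<Longrightarrow> v \<bullet> (x - y) = 0" "u \<in> directions S"
  shows "v \<bullet> u = 0"
proof -
  have "directions S \<subseteq> {u. v \<bullet> u = 0}"
    using assms(1) by (intro directions_least subspace_hyperplane) auto
  thus ?thesis using assms(2) by auto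
qed

text \<open>By dimension, \<open>V\<close> is spanned by \<open>U\<close> and \<open>\<nu>\<close>;
  the inner product with \<open>\<nu>\<close> identifies the coefficient.\<close>

lemma codim1_decompose:
  fixes \<nu> :: "'a::euclidean_space"
  assumes "subspace U" "subspace V" "U \<subseteq> V" "dim V = Suc (dim U)" "\<nu> \<in> V" "norm \<nu> = 1"
    and orth: "\<And>u. u \<in> U \<Longrightarrow> \<nu> \<bullet> u = 0" and "x \<in> V"
  shows "x - (\<nu> \<bullet> x) *\<^sub>R \<nu> \<in> U"
proof -
  have nu: "\<nu> \<bullet> \<nu> = 1" using assms(6) by (simp add: norm_eq_1)
  hence "\<nu> \<notin> span U" using orth assms(1) by (metis span_eq_iff zero_neq_one)
  hence "dim (span (insert \<nu> U)) = Suc (dim U)"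
    by (simp add: dim_insert)
  hence "span (insert \<nu> U) = V"
    using assms by (intro subspace_dim_equal span_minimal) auto
  then obtain c where c: "x - c *\<^sub>R \<nu> \<in> U"
    using assms(1,8) by (metis span_breakdown_eq span_eq_iff)
  hence "\<nu> \<bullet> (x - c *\<^sub>R \<nu>) = 0" by (rule orth)
  hence "c = \<nu> \<bullet> x" using nu by (simp add: inner_diff_right)
  thus ?thesis using c by simp
qed


subsection \<open>Orientations\<close>

lemma orients_cong: "directions q = directions q' \<Longrightarrow> orients k q \<xi> \<longleftrightarrow> orients k q' \<xi>"
  by (simp add: orients_def)

lemma orients_minus: "orients k q \<xi> \<Longrightarrow> orients k q (- \<xi>)"
  unfolding orients_def by (metis norm_minus_cancel scaleR_minus_left)

lemma orthonormal_basis_list: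
  fixes V :: "'a::euclidean_space set"
  assumes "subspace V"
  obtains bs where "distinct bs" "length bs = dim V" "span (set bs) = V"
    "pairwise orthogonal (set bs)" "\<And>b. b \<in> set bs \<Longrightarrow> norm b = 1"
proof -
  obtain B where B: "B \<subseteq> V" "pairwise orthogonal B" "\<And>x. x \<in> B \<Longrightarrow> norm x = 1" "independent B"
    "card B = dim V" "span B = V"
    using orthonormal_basis_subspace[OF assms] by blast
  have "finite B" using B(4) by (rule independent_imp_finite)
  then obtain bs where "set bs = B" "distinct bs" using finite_distinct_list by blast
  thus ?thesis using that B distinct_card by metis
qed

text \<open>An orthonormal basis has a wedge of norm 1, every wedge of as many directions is a
  multiple of it, and norm 1 leaves only two multiples. An arbitrary orientation can thus be
  replaced by a signed orthonormal list.\<close>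

lemma orients_basis:
  obtains bs where "distinct bs" "length bs = dim (directions q)" "set bs \<subseteq> directions q"
    "pairwise orthogonal (set bs)" "\<And>b. b \<in> set bs \<Longrightarrow> norm b = 1"
    "orients (dim (directions q)) q (wedge_list bs)"
    "\<And>\<xi>. orients (dim (directions q)) q \<xi> \<Longrightarrow> \<xi> = wedge_list bs \<or> \<xi> = - wedge_list bs"
proof -
  obtain bs where bs: "distinct bs" "length bs = dim (directions q)" "span (set bs) = directions q"
    "pairwise orthogonal (set bs)" "\<And>b. b \<in> set bs \<Longrightarrow> norm b = 1"
    using orthonormal_basis_list[OF subspace_directions] by blast
  have sub: "set bs \<subseteq> directions q" using bs(3) span_superset by blast
  have n1: "norm (wedge_list bs) = 1"
    by (rule norm_wedge_list_orthonormal) (use bs in auto)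
  show ?thesis
  proof (rule that[OF bs(1,2) sub bs(4,5)])
    show "orients (dim (directions q)) q (wedge_list bs)"
      unfolding orients_def using n1 bs sub
      by (metis scaleR_one)
    fix \<xi> assume "orients (dim (directions q)) q \<xi>"
    then obtain c vs where c: "norm \<xi> = 1" "length vs = dim (directions q)" "set vs \<subseteq> directions q"
      "\<xi> = c *\<^sub>R wedge_list vs" by (auto simp: orients_def)
    obtain d where d: "wedge_list vs = d *\<^sub>R wedge_list bs"
      using wedge_list_full_dim[OF bs(1), of vs] c bs by auto
    have "\<bar>c * d\<bar> = 1" using c(1,4) d n1 by simp
    thus "\<xi> = wedge_list bs \<or> \<xi> = - wedge_list bs"
      using c(4) d by (auto simp: abs_if split: if_splits)
  qed
qed

lemma orients_unique:
  assumes "dim (directions q) = k" "orients k q \<xi>" "orients k q \<eta>"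
  shows "\<eta> = \<xi> \<or> \<eta> = - \<xi>"
  using orients_basis[of q] assms by (metis minus_equation_iff)

lemma orients_exists:
  assumes "dim (directions q) = k"
  obtains \<xi> where "orients k q \<xi>"
  using orients_basis[of q] assms by metis

text \<open>Since \<open>\<nu>\<close> is orthogonal to the directions of \<open>F\<close>, the
  contraction of \<open>\<eta>\<close> by \<open>\<nu>\<close> vanishes and wedging with
  \<open>\<nu>\<close> preserves norm 1.\<close>

lemma orients_wedge_normal:
  assumes "orients k F \<eta>" "directions F \<subseteq> directions q" "\<nu> \<in> directions q" "norm \<nu> = 1"
    and "\<And>u. u \<in> directions F \<Longrightarrow> \<nu> \<bullet> u = 0"
  shows "orients (Suc k) q (wedge (mvec_of \<nu>) \<eta>)"
proof -
  obtain c vs where c: "norm \<eta> = 1" "length vs = k" "set vs \<subseteq> directions F" "\<eta> = c *\<^sub>R wedge_list vs"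
    using assms(1) by (auto simp: orients_def)
  have "contract \<nu> \<eta> = 0"
    unfolding c(4) contract_scaleR using c(3) assms(5) by (subst contract_wedge_list) auto
  hence "norm (wedge (mvec_of \<nu>) \<eta>) = 1" using c(1) assms(4) by (simp add: norm_wedge_mvec)
  moreover have "wedge (mvec_of \<nu>) \<eta> = c *\<^sub>R wedge_list (\<nu> # vs)" by (simp add: c(4))
  ultimately show ?thesis unfolding orients_def
    using c assms(2,3) by (intro conjI exI[of _ c] exI[of _ "\<nu> # vs"]) auto
qed

text \<open>The source of the sign in the second partial boundary: the normal of a facet of the
  second factor has to pass the \<open>k\<close> vectors that orient the first.\<close>

lemma wedge_orientations_commute:
  assumes "orients k q \<xi>"
  shows "wedge (mvec_of v) (wedge \<xi> \<eta>) = (- 1) ^ k *\<^sub>R wedge \<xi> (wedge (mvec_of v) \<eta>)"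
proof -
  obtain c vs where "length vs = k" "\<xi> = c *\<^sub>R wedge_list vs"
    using assms by (auto simp: orients_def)
  thus ?thesis by (simp add: wedge_list_commute_mvec flip: power_add mult_2)
qed

lemma cellsD:
  assumes "(q, \<xi>) \<in> cells k X"
  shows "polytope q" "aff_dim q = int k" "q \<subseteq> X" "orients k q \<xi>" "dim (directions q) = k" "convex q" "q \<noteq> {}"
    "polyhedron q"
proof -
  show *: "polytope q" "aff_dim q = int k" "q \<subseteq> X" "orients k q \<xi>" using assms by (auto simp: cells_def)
  thus ne: "q \<noteq> {}" by auto
  show "dim (directions q) = k" using aff_dim_eq_directions[OF ne] * by simp
  show "convex q" "polyhedron q" using * polytope_imp_convex polytope_imp_polyhedron by auto
qed

lemma cells_minus: "(q, \<xi>) \<in> cells k X \<Longrightarrow> (q, - \<xi>) \<in> cells k X"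
  by (auto simp: cells_def orients_minus)


subsection \<open>Outer normals and oriented facets\<close>

lemma outer_normal_orthogonal: "outer_normal q F \<nu> \<Longrightarrow> u \<in> directions F \<Longrightarrow> \<nu> \<bullet> u = 0"
  by (rule directions_orthogonalI) (auto simp: outer_normal_def)

lemma facet_dim:
  assumes "F facet_of q"
  shows "F \<noteq> {}" "q \<noteq> {}" "dim (directions q) = Suc (dim (directions F))" "directions F \<subseteq> directions q"
proof -
  show F: "F \<noteq> {}" "q \<noteq> {}" using assms facet_of_imp_subset[OF assms] by (auto simp: facet_of_def)
  show "dim (directions q) = Suc (dim (directions F))"
    using assms aff_dim_eq_directions[OF F(1)] aff_dim_eq_directions[OF F(2)] by (simp add: facet_of_def)
  show "directions F \<subseteq> directions q" by (rule directions_mono[OF facet_of_imp_subset[OF assms]])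
qed

text \<open>The vector of a supporting inequality may leave \<open>directions q\<close>. Its
  orthogonal projection has the same inner products with differences of points of \<open>q\<close>,
  and it is not zero, since otherwise the inequality would be an equality on all of
  \<open>q\<close>.\<close>

lemma outer_normal_exists:
  assumes "polyhedron q" "F facet_of q"
  obtains \<nu> where "outer_normal q F \<nu>"
proof -
  obtain a b where ab: "q \<subseteq> {x. a \<bullet> x \<le> b}" "F = q \<inter> {x. a \<bullet> x = b}"
    using facet_of_polyhedron[OF assms] by blast
  obtain p z where pz: "p \<in> span (directions q)" "\<And>w. w \<in> span (directions q) \<Longrightarrow> orthogonal z w" "a = p + z"
    using orthogonal_subspace_decomp_exists by blast
  have sp: "span (directions q) = directions q" by simp
  have az: "a \<bullet> (x - y) = p \<bullet> (x - y)" if "x \<in> q" "y \<in> q" for x y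
    using pz(2)[of "x - y"] diff_in_directions[OF that] sp unfolding pz(3)
    by (simp add: orthogonal_def inner_add_left)
  have "p \<noteq> 0"
  proof
    assume "p = 0"
    hence "a \<bullet> x = a \<bullet> y" if "x \<in> q" "y \<in> q" for x y using az[OF that] by (simp add: inner_diff_right)
    hence "F = q" using facet_dim(1)[OF assms(2)] ab by blast
    thus False using assms(2) by simp
  qed
  have "outer_normal q F (p /\<^sub>R norm p)"
    unfolding outer_normal_def
  proof (intro conjI ballI)
    show "p /\<^sub>R norm p \<in> directions q" using pz(1) sp by (simp add: subspace_scale)
    show "(p /\<^sub>R norm p) \<bullet> (x - y) = 0" if "x \<in> F" "y \<in> F" for x y
      using az[of x y] that ab by (simp add: inner_diff_right)
    show "(p /\<^sub>R norm p) \<bullet> (x - y) \<le> 0" if "x \<in> q" "y \<in> F" for x y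
    proof -
      have "p \<bullet> (x - y) \<le> 0" using az[of x y] that ab by (auto simp: inner_diff_right)
      thus ?thesis by (simp add: mult_nonneg_nonpos)
    qed
  qed (use \<open>p \<noteq> 0\<close> in simp)
  thus ?thesis by (rule that)
qed

lemma facet_decompose:
  assumes "F facet_of q" "\<nu> \<in> directions q" "norm \<nu> = 1" "\<And>u. u \<in> directions F \<Longrightarrow> \<nu> \<bullet> u = 0"
    and "x \<in> directions q"
  shows "x - (\<nu> \<bullet> x) *\<^sub>R \<nu> \<in> directions F"
  by (rule codim1_decompose[of "directions F" "directions q"]) (use assms facet_dim[OF assms(1)] in auto)

lemma outer_normalD: "outer_normal q F \<nu> \<Longrightarrow> \<nu> \<in> directions q" "outer_normal q F \<nu> \<Longrightarrow> norm \<nu> = 1"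
  by (simp_all add: outer_normal_def)

lemma unit_normal_pm:
  assumes "F facet_of q" "\<nu> \<in> directions q" "norm \<nu> = 1" "\<And>u. u \<in> directions F \<Longrightarrow> \<nu> \<bullet> u = 0"
    and "\<mu> \<in> directions q" "norm \<mu> = 1" "\<And>u. u \<in> directions F \<Longrightarrow> \<mu> \<bullet> u = 0"
  shows "\<mu> = \<nu> \<or> \<mu> = - \<nu>"
proof -
  define c where "c = \<nu> \<bullet> \<mu>"
  have w: "\<mu> - c *\<^sub>R \<nu> \<in> directions F"
    unfolding c_def by (rule facet_decompose[OF assms(1-4,5)])
  have "(\<mu> - c *\<^sub>R \<nu>) \<bullet> (\<mu> - c *\<^sub>R \<nu>) = 0"
    using assms(4)[OF w] assms(7)[OF w] by (simp add: inner_diff_left)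
  hence mu: "\<mu> = c *\<^sub>R \<nu>" by simp
  hence "\<bar>c\<bar> = 1" using assms(3,6) by simp
  thus ?thesis using mu by (auto simp: abs_if split: if_splits)
qed

lemma outer_normal_le:
  assumes "outer_normal q F \<nu>" "x \<in> q" "y \<in> F"
  shows "\<nu> \<bullet> x \<le> \<nu> \<bullet> y"
proof -
  have "\<nu> \<bullet> (x - y) \<le> 0" using assms by (simp add: outer_normal_def)
  thus ?thesis by (simp add: inner_diff_right)
qed

lemma outer_normal_eq:
  assumes "outer_normal q F \<nu>" "x \<in> F" "y \<in> F"
  shows "\<nu> \<bullet> x = \<nu> \<bullet> y"
proof -
  have "\<nu> \<bullet> (x - y) = 0" using assms by (simp add: outer_normal_def)
  thus ?thesis by (simp add: inner_diff_right)
qed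

text \<open>Otherwise \<open>\<nu>\<close> would be constant on \<open>q\<close>, hence orthogonal
  to all directions of \<open>q\<close>, itself included.\<close>

lemma outer_normal_strict:
  assumes "outer_normal q F \<nu>" "y \<in> F"
  shows "\<exists>z\<in>q. \<nu> \<bullet> z < \<nu> \<bullet> y"
proof (rule ccontr)
  assume "\<not> ?thesis"
  hence ge: "\<nu> \<bullet> z \<ge> \<nu> \<bullet> y" if "z \<in> q" for z using that by force
  have eq: "\<nu> \<bullet> z = \<nu> \<bullet> y" if "z \<in> q" for z
    using ge[OF that] outer_normal_le[OF assms(1) that assms(2)] by simp
  have "\<nu> \<bullet> \<nu> = 0"
  proof (rule directions_orthogonalI)
    show "\<nu> \<in> directions q" using assms by (simp add: outer_normal_def)
    fix x x' assume "x \<in> q" "x' \<in> q"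
    thus "\<nu> \<bullet> (x - x') = 0" using eq[of x] eq[of x'] by (simp add: inner_diff_right)
  qed
  thus False using assms(1) by (simp add: outer_normal_def norm_eq_1)
qed

lemma outer_normal_unique:
  assumes "F facet_of q" "outer_normal q F \<nu>" "outer_normal q F \<mu>"
  shows "\<mu> = \<nu>"
proof -
  obtain y where y: "y \<in> F" using facet_dim(1)[OF assms(1)] by auto
  obtain z where z: "z \<in> q" "\<nu> \<bullet> z < \<nu> \<bullet> y" using outer_normal_strict[OF assms(2) y] by blast
  have "\<mu> = \<nu> \<or> \<mu> = - \<nu>"
    by (rule unit_normal_pm[OF assms(1) outer_normalD[OF assms(2)] outer_normal_orthogonal[OF assms(2)]
          outer_normalD[OF assms(3)] outer_normal_orthogonal[OF assms(3)]])
  thus ?thesis using outer_normal_le[OF assms(3) z(1) y] z(2) by auto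
qed

text \<open>The exposed face contains \<open>F\<close> and is proper because of \<open>z\<close>; by
  dimension, no proper face is strictly larger than a facet.\<close>

lemma facet_eq_exposed:
  assumes "convex q" "F facet_of q" "y \<in> F"
    and "\<And>x. x \<in> q \<Longrightarrow> a \<bullet> x \<le> a \<bullet> y" "\<And>x. x \<in> F \<Longrightarrow> a \<bullet> x = a \<bullet> y"
    and "z \<in> q" "a \<bullet> z \<noteq> a \<bullet> y"
  shows "F = q \<inter> {x. a \<bullet> x = a \<bullet> y}"
proof -
  let ?E = "q \<inter> {x. a \<bullet> x = a \<bullet> y}"
  have E: "?E face_of q" by (rule face_of_Int_supporting_hyperplane_le[OF assms(1,4)])
  have sub: "F \<subseteq> ?E" using assms(5) facet_of_imp_subset[OF assms(2)] by auto
  have "?E \<noteq> q" using assms(6,7) by auto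
  hence lt: "aff_dim ?E < aff_dim q" by (rule face_of_aff_dim_lt[OF assms(1) E])
  have FE: "F face_of ?E"
    using face_of_subset[OF facet_of_imp_face_of[OF assms(2)] sub] by auto
  show ?thesis
  proof (rule ccontr)
    assume "F \<noteq> ?E"
    hence "aff_dim F < aff_dim ?E" using face_of_aff_dim_lt[OF face_of_imp_convex[OF E] FE] by simp
    thus False using lt assms(2) by (simp add: facet_of_def)
  qed
qed

lemma facet_eq_outer_normal:
  assumes "convex q" "F facet_of q" "outer_normal q F \<nu>" "y \<in> F"
  shows "F = q \<inter> {x. \<nu> \<bullet> x = \<nu> \<bullet> y}"
proof -
  obtain z where "z \<in> q" "\<nu> \<bullet> z < \<nu> \<bullet> y" using outer_normal_strict[OF assms(3,4)] by blast
  thus ?thesis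
    by (intro facet_eq_exposed[OF assms(1,2,4), of \<nu> z] outer_normal_le[OF assms(3)]
      outer_normal_eq[OF assms(3)] assms(4)) simp_all
qed

text \<open>Wedging \<open>\<nu>\<close> with any orientation of the facet gives one of the two
  orientations of \<open>q\<close>; a change of sign makes it \<open>\<xi>\<close>.\<close>

lemma facet_orientation_exists:
  assumes "(q, \<xi>) \<in> cells k X" "F facet_of q" "outer_normal q F \<nu>"
  obtains \<xi>' where "orients (k - 1) F \<xi>'" "wedge (mvec_of \<nu>) \<xi>' = \<xi>"
proof -
  have k: "k = Suc (dim (directions F))" using facet_dim[OF assms(2)] cellsD(5)[OF assms(1)] by simp
  obtain \<eta> where \<eta>: "orients (k - 1) F \<eta>" using orients_exists[of F "k - 1"] k by auto
  have "orients k q (wedge (mvec_of \<nu>) \<eta>)"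
    using orients_wedge_normal[OF \<eta>, of q \<nu>] facet_dim[OF assms(2)] assms(3) k
      outer_normal_orthogonal[OF assms(3)] by (simp add: outer_normal_def)
  hence "\<xi> = wedge (mvec_of \<nu>) \<eta> \<or> \<xi> = wedge (mvec_of \<nu>) (- \<eta>)"
    using orients_unique[OF cellsD(5)[OF assms(1)] _ cellsD(4)[OF assms(1)]] by simp
  thus ?thesis using that \<eta> orients_minus by metis
qed

lemma facet_orientation_unique:
  assumes "F facet_of q" "dim (directions q) = k" "norm \<xi> = 1" "orients (k - 1) F \<xi>'" "wedge (mvec_of \<nu>) \<xi>' = \<xi>"
    "orients (k - 1) F \<xi>''" "wedge (mvec_of \<nu>) \<xi>'' = \<xi>"
  shows "\<xi>'' = \<xi>'"
proof -
  have "dim (directions F) = k - 1" using facet_dim[OF assms(1)] assms(2) by simp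
  hence "\<xi>'' = \<xi>' \<or> \<xi>'' = - \<xi>'" by (rule orients_unique[OF _ assms(4,6)])
  moreover have False if "\<xi>'' = - \<xi>'"
  proof -
    have "\<xi> = - \<xi>" using that assms(5,7) by auto
    hence "\<xi> = 0" by (simp add: vec_eq_iff)
    thus False using assms(3) by simp
  qed
  ultimately show ?thesis by blast
qed

text \<open>For a facet of a cell the induced orientation exists and is unique, so
  \<open>bd_cells\<close> is the graph of this function and boundary sums can be indexed by
  facets.\<close>

definition facet_or :: "nat \<Rightarrow> (real, 'n) vec set \<Rightarrow> 'n::{finite,linorder} mvec \<Rightarrow> (real, 'n) vec set \<Rightarrow> 'n mvec" where
  "facet_or k q \<xi> F = (THE \<xi>'. (F, \<xi>') \<in> bd_cells k (q, \<xi>))"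

lemma bd_cells_unique:
  assumes "(q, \<xi>) \<in> cells k X" "(F, \<xi>') \<in> bd_cells k (q, \<xi>)" "(F, \<xi>'') \<in> bd_cells k (q, \<xi>)"
  shows "\<xi>'' = \<xi>'"
proof -
  obtain \<nu> \<mu> where *: "F facet_of q" "outer_normal q F \<nu>" "outer_normal q F \<mu>"
    "orients (k - 1) F \<xi>'" "wedge (mvec_of \<nu>) \<xi>' = \<xi>" "orients (k - 1) F \<xi>''" "wedge (mvec_of \<mu>) \<xi>'' = \<xi>"
    using assms(2,3) by (auto simp: bd_cells_def)
  have "\<mu> = \<nu>" by (rule outer_normal_unique[OF *(1-3)])
  hence "wedge (mvec_of \<nu>) \<xi>'' = \<xi>" using *(7) by simp
  moreover have "norm \<xi> = 1" using cellsD(4)[OF assms(1)] by (simp add: orients_def)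
  ultimately show ?thesis
    using facet_orientation_unique[OF *(1) cellsD(5)[OF assms(1)] _ *(4,5,6)] by blast
qed

lemma facet_or_bd_cells:
  assumes "(q, \<xi>) \<in> cells k X" "F facet_of q"
  shows "(F, facet_or k q \<xi> F) \<in> bd_cells k (q, \<xi>)"
proof -
  obtain \<nu> where nu: "outer_normal q F \<nu>"
    using outer_normal_exists[OF cellsD(8)[OF assms(1)] assms(2)] .
  obtain \<xi>' where "orients (k - 1) F \<xi>'" "wedge (mvec_of \<nu>) \<xi>' = \<xi>"
    using facet_orientation_exists[OF assms nu] .
  hence *: "(F, \<xi>') \<in> bd_cells k (q, \<xi>)" using nu assms(2) by (auto simp: bd_cells_def)
  hence "\<exists>!\<xi>'. (F, \<xi>') \<in> bd_cells k (q, \<xi>)" using bd_cells_unique[OF assms(1)] by blast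
  thus ?thesis unfolding facet_or_def by (rule theI')
qed

lemma facet_or_eqI:
  assumes "(q, \<xi>) \<in> cells k X" "(F, \<xi>') \<in> bd_cells k (q, \<xi>)"
  shows "facet_or k q \<xi> F = \<xi>'"
proof -
  have "F facet_of q" using assms(2) by (auto simp: bd_cells_def)
  thus ?thesis using bd_cells_unique[OF assms(1,2) facet_or_bd_cells[OF assms(1)]] by simp
qed

lemma bd_cells_eq:
  assumes "(q, \<xi>) \<in> cells k X"
  shows "bd_cells k (q, \<xi>) = (\<lambda>F. (F, facet_or k q \<xi> F)) ` {F. F facet_of q}"
proof -
  have "F facet_of q" if "(F, \<xi>') \<in> bd_cells k (q, \<xi>)" for F \<xi>'
    using that by (auto simp: bd_cells_def)
  thus ?thesis using facet_or_bd_cells[OF assms] facet_or_eqI[OF assms] by force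
qed

lemma finite_facets: "(q, \<xi>) \<in> cells k X \<Longrightarrow> finite {F. F facet_of q}"
  by (rule finite_polytope_facets[OF cellsD(1)])

lemma sum_bd_cells:
  assumes "(q, \<xi>) \<in> cells k X"
  shows "(\<Sum>p\<in>bd_cells k (q, \<xi>). f p) = (\<Sum>F | F facet_of q. f (F, facet_or k q \<xi> F))"
  unfolding bd_cells_eq[OF assms] by (subst sum.reindex) (auto simp: inj_on_def)

lemma facet_or_props:
  assumes "(q, \<xi>) \<in> cells k X" "F facet_of q" "outer_normal q F \<nu>"
  shows "orients (k - 1) F (facet_or k q \<xi> F)" "wedge (mvec_of \<nu>) (facet_or k q \<xi> F) = \<xi>"
proof -
  obtain \<mu> where "orients (k - 1) F (facet_or k q \<xi> F)" "outer_normal q F \<mu>"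
    "wedge (mvec_of \<mu>) (facet_or k q \<xi> F) = \<xi>"
    using facet_or_bd_cells[OF assms(1,2)] by (auto simp: bd_cells_def)
  thus "orients (k - 1) F (facet_or k q \<xi> F)" "wedge (mvec_of \<nu>) (facet_or k q \<xi> F) = \<xi>"
    using outer_normal_unique[OF assms(2,3)] by auto
qed

lemma facet_or_eqI_normal:
  assumes "(q, \<xi>) \<in> cells k X" "F facet_of q" "outer_normal q F \<nu>" "orients (k - 1) F \<xi>'"
    "wedge (mvec_of \<nu>) \<xi>' = \<xi>"
  shows "facet_or k q \<xi> F = \<xi>'"
  by (rule facet_or_eqI[OF assms(1)]) (use assms in \<open>auto simp: bd_cells_def\<close>)

lemma facet_or_minus:
  assumes "(q, \<xi>) \<in> cells k X" "F facet_of q"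
  shows "facet_or k q (- \<xi>) F = - facet_or k q \<xi> F"
proof -
  obtain \<nu> where nu: "outer_normal q F \<nu>"
    using outer_normal_exists[OF cellsD(8)[OF assms(1)] assms(2)] .
  show ?thesis
    by (rule facet_or_eqI_normal[OF cells_minus[OF assms(1)] assms(2) nu])
       (use facet_or_props[OF assms nu] orients_minus in auto)
qed

lemma facet_cell:
  assumes "(q, \<xi>) \<in> cells k X" "F facet_of q"
  shows "(F, facet_or k q \<xi> F) \<in> cells (k - 1) X" "k \<ge> 1"
proof -
  obtain \<nu> where nu: "outer_normal q F \<nu>"
    using outer_normal_exists[OF cellsD(8)[OF assms(1)] assms(2)] .
  show k: "k \<ge> 1" using facet_dim(3)[OF assms(2)] cellsD(5)[OF assms(1)] by simp
  show "(F, facet_or k q \<xi> F) \<in> cells (k - 1) X"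
    unfolding cells_def
  proof (clarify, intro conjI)
    show "polytope F" using cellsD(1)[OF assms(1)] assms(2) face_of_polytope_polytope facet_of_imp_face_of by blast
    show "aff_dim F = int (k - 1)"
      using assms(2) cellsD(2)[OF assms(1)] k by (simp add: facet_of_def of_nat_diff)
    show "F \<subseteq> X" using facet_of_imp_subset[OF assms(2)] cellsD(3)[OF assms(1)] by blast
    show "orients (k - 1) F (facet_or k q \<xi> F)" by (rule facet_or_props(1)[OF assms nu])
  qed
qed

lemma bd_cells_subset:
  assumes "p \<in> cells k X"
  shows "bd_cells k p \<subseteq> cells (k - 1) X"
  using assms facet_cell(1) by (cases p) (auto simp: bd_cells_eq)


subsection \<open>Cutting a polytope by a hyperplane\<close>

text \<open>The relative interior is dense in \<open>F\<close> and connected, so it contains a point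
  of the hyperplane. Near that point \<open>F\<close> fills its affine hull, which the hyperplane
  meets properly, so the dimension drops by exactly one.\<close>

lemma aff_dim_convex_Int_hyperplane:
  fixes F :: "'a::euclidean_space set"
  assumes "convex F" "x \<in> F" "a \<bullet> x < c" "y \<in> F" "a \<bullet> y > c"
  shows "aff_dim (F \<inter> {z. a \<bullet> z = c}) = aff_dim F - 1"
proof -
  let ?H = "{z. a \<bullet> z = c}"
  have meets: "rel_interior F \<inter> T \<noteq> {}" if "open T" "F \<inter> T \<noteq> {}" for T
  proof -
    have "closure (rel_interior F) \<inter> T \<noteq> {}"
      using that(2) convex_closure_rel_interior[OF assms(1)] closure_subset[of F] by auto
    thus ?thesis using open_Int_closure_eq_empty[OF that(1), of "rel_interior F"] by (simp add: Int_commute)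
  qed
  have "rel_interior F \<inter> {z. a \<bullet> z < c} \<noteq> {}"
    by (rule meets[OF open_halfspace_lt]) (use assms in auto)
  moreover have "rel_interior F \<inter> {z. a \<bullet> z > c} \<noteq> {}"
    by (rule meets[OF open_halfspace_gt]) (use assms in auto)
  ultimately obtain u v where uv: "u \<in> rel_interior F" "a \<bullet> u < c" "v \<in> rel_interior F" "a \<bullet> v > c"
    by auto
  have "convex (rel_interior F)" by (rule convex_rel_interior[OF assms(1)])
  hence "connected (rel_interior F)" by (rule convex_connected)
  then obtain z where z: "z \<in> rel_interior F" "a \<bullet> z = c"
    using connected_ivt_hyperplane[of "rel_interior F" u v a c] uv by auto
  obtain e where e: "e > 0" "ball z e \<inter> affine hull F \<subseteq> F"
    using z(1) by (auto simp: mem_rel_interior_ball)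
  have zF: "z \<in> affine hull F" using z(1) rel_interior_subset hull_subset[of F affine] by blast
  have aff: "affine (affine hull F \<inter> ?H)" by (intro affine_Int affine_affine_hull affine_hyperplane)
  have "aff_dim (affine hull F \<inter> ?H) = aff_dim (affine hull F) - 1"
  proof -
    have "\<not> affine hull F \<subseteq> ?H" using assms(2,3) hull_subset[of F affine] by auto
    moreover have "affine hull F \<inter> ?H \<noteq> {}" using z zF by auto
    ultimately show ?thesis by (subst aff_dim_affine_Int_hyperplane) auto
  qed
  hence dim: "aff_dim (affine hull F \<inter> ?H) = aff_dim F - 1" by simp
  have "aff_dim (affine hull F \<inter> ?H) = aff_dim ((affine hull F \<inter> ?H) \<inter> ball z e)"
  proof (rule aff_dim_convex_Int_open[symmetric])
    show "convex (affine hull F \<inter> ?H)" by (rule affine_imp_convex[OF aff])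
    show "(affine hull F \<inter> ?H) \<inter> ball z e \<noteq> {}" using z zF e(1) by (auto intro!: exI[of _ z])
  qed simp
  also have "\<dots> \<le> aff_dim (F \<inter> ?H)" using e(2) by (intro aff_dim_subset) auto
  finally have "aff_dim F - 1 \<le> aff_dim (F \<inter> ?H)" using dim by simp
  moreover have "aff_dim (F \<inter> ?H) \<le> aff_dim (affine hull F \<inter> ?H)"
    by (intro aff_dim_subset Int_mono hull_subset order_refl)
  ultimately show ?thesis using dim by simp
qed

text \<open>If \<open>q'\<close> and \<open>q''\<close> are on the same side of \<open>D\<close>, a point of \<open>q''\<close> close to a relative interior point
  of \<open>D\<close> lies on a segment from \<open>D\<close> to a point of \<open>q'\<close>.\<close>

lemma facets_same_side_overlap:
  assumes "convex q'" "convex q''" "D facet_of q'" "D \<subseteq> q''" "directions q'' = directions q'"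
    and "outer_normal q' D \<nu>" "outer_normal q'' D \<nu>" "convex D"
  shows "\<not> q' \<inter> q'' \<subseteq> D"
proof
  assume sub: "q' \<inter> q'' \<subseteq> D"
  obtain d where d: "d \<in> rel_interior D"
    using rel_interior_eq_empty[OF assms(8)] facet_dim(1)[OF assms(3)] by auto
  obtain e where e: "e > 0" "ball d e \<inter> affine hull D \<subseteq> D" and dD: "d \<in> D"
    using d by (auto simp: mem_rel_interior_ball)
  have dq: "d \<in> q'" "d \<in> q''" using dD facet_of_imp_subset[OF assms(3)] assms(4) by auto
  obtain x' where x': "x' \<in> q'" "\<nu> \<bullet> x' < \<nu> \<bullet> d" using outer_normal_strict[OF assms(6) dD] by blast
  obtain x'' where x'': "x'' \<in> q''" "\<nu> \<bullet> x'' < \<nu> \<bullet> d" using outer_normal_strict[OF assms(7) dD] by blast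
  \<comment> \<open>\<open>h\<close> matches the components along \<open>\<nu>\<close>, so that
    \<open>x'' - d\<close> and \<open>h\<close> times \<open>x' - d\<close> differ by a vector
    \<open>w\<close> tangent to \<open>D\<close>.\<close>
  define h where "h = (\<nu> \<bullet> d - \<nu> \<bullet> x'') / (\<nu> \<bullet> d - \<nu> \<bullet> x')"
  have h: "h > 0" using x' x'' by (simp add: h_def)
  define w where "w = (x'' - d) - h *\<^sub>R (x' - d)"
  have nw: "\<nu> \<bullet> w = 0"
  proof -
    have "\<nu> \<bullet> w = (\<nu> \<bullet> x'' - \<nu> \<bullet> d) - h * (\<nu> \<bullet> x' - \<nu> \<bullet> d)"
      by (simp add: w_def inner_diff_right)
    also have "\<dots> = 0" using x' by (simp add: h_def field_simps)
    finally show ?thesis .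
  qed
  have "w \<in> directions q'"
    unfolding w_def
    by (intro subspace_diff[OF subspace_directions] subspace_scale[OF subspace_directions]
      diff_in_directions[OF x'(1) dq(1)] diff_in_directions[OF x''(1) dq(2), unfolded assms(5)])
  hence "w - (\<nu> \<bullet> w) *\<^sub>R \<nu> \<in> directions D"
    by (intro facet_decompose[OF assms(3)] outer_normalD[OF assms(6)] outer_normal_orthogonal[OF assms(6)])
  hence w: "w \<in> directions D" using nw by simp
  \<comment> \<open>The three bounds make \<open>p\<close> a convex combination, keep
    \<open>s\<close> at most one half, and keep \<open>d'\<close> in the ball where \<open>D\<close>
    fills its affine hull.\<close>
  define t where "t = min 1 (min (1 / (2 * h)) (e / (4 * (norm w + 1))))"
  have t: "t > 0" "t \<le> 1" "t * h \<le> 1 / 2" "2 * t * norm w < e"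
  proof -
    have n: "norm w + 1 > 0" using norm_ge_zero[of w] by linarith
    show "t > 0" using h e(1) n by (simp add: t_def)
    show "t \<le> 1" by (simp add: t_def)
    have "t \<le> 1 / (2 * h)" by (simp add: t_def)
    thus "t * h \<le> 1 / 2" using h by (simp add: field_simps)
    have "t \<le> e / (4 * (norm w + 1))" by (simp add: t_def)
    hence "t * (4 * (norm w + 1)) \<le> e" using n by (simp add: field_simps)
    moreover have "2 * t * norm w < t * (4 * (norm w + 1))"
      using \<open>t > 0\<close> norm_ge_zero[of w] by (simp add: algebra_simps add_pos_nonneg)
    ultimately show "2 * t * norm w < e" by linarith
  qed
  define s where "s = t * h"
  have s: "s \<ge> 0" "s \<le> 1 / 2" using t h by (auto simp: s_def)
  define d' where "d' = d + (t / (1 - s)) *\<^sub>R w"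
  have "d' \<in> affine hull D"
    using affine_hull_iff_directions[OF dD, of d'] w by (simp add: d'_def subspace_scale)
  moreover have "dist d d' < e"
  proof -
    have "dist d d' = t / (1 - s) * norm w" using t s by (simp add: d'_def dist_norm)
    also have "\<dots> \<le> (2 * t) * norm w"
    proof (rule mult_right_mono)
      have "t * 1 \<le> t * (2 * (1 - s))" using s t by (intro mult_left_mono) auto
      thus "t / (1 - s) \<le> 2 * t" using s by (simp add: divide_simps algebra_simps)
    qed simp
    finally show ?thesis using t by simp
  qed
  ultimately have d'D: "d' \<in> D" using e(2) by auto
  define p where "p = (1 - t) *\<^sub>R d + t *\<^sub>R x''"
  have "p \<in> q''" unfolding p_def using assms(2) dq(2) x''(1) t by (intro convexD_alt) auto
  moreover have "p = (1 - s) *\<^sub>R d' + s *\<^sub>R x'"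
  proof -
    have "(1 - s) *\<^sub>R d' = (1 - s) *\<^sub>R d + t *\<^sub>R w"
      using s by (simp add: d'_def scaleR_add_right)
    thus ?thesis by (simp add: p_def w_def s_def algebra_simps)
  qed
  hence "p \<in> q'" using assms(1) d'D facet_of_imp_subset[OF assms(3)] x'(1) s
    by (simp add: convexD_alt subset_iff)
  ultimately have "p \<in> D" using sub by auto
  hence "\<nu> \<bullet> p = \<nu> \<bullet> d" by (rule outer_normal_eq[OF assms(6) _ dD])
  hence "t * (\<nu> \<bullet> x'' - \<nu> \<bullet> d) = 0" by (simp add: p_def inner_add_right algebra_simps)
  thus False using t x'' by simp
qed

text \<open>Here the splitting relation is recognised as a cut by a hyperplane through
  \<open>D\<close>: the outer normals of the two pieces along \<open>D\<close> agree up to sign, and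
  equal normals would make the pieces overlap outside \<open>D\<close>.\<close>

lemma split_halfspaces:
  assumes "convex q'" "convex q''" "q = q' \<union> q''" "D = q' \<inter> q''" "D facet_of q'" "D facet_of q''"
    and "directions q' = directions q''" "polyhedron q''"
    and "outer_normal q' D \<nu>" "y \<in> D"
  shows "outer_normal q'' D (- \<nu>)" "q' = q \<inter> {x. \<nu> \<bullet> x \<le> \<nu> \<bullet> y}" "q'' = q \<inter> {x. \<nu> \<bullet> x \<ge> \<nu> \<bullet> y}"
    "D = q \<inter> {x. \<nu> \<bullet> x = \<nu> \<bullet> y}"
proof -
  obtain \<mu> where mu: "outer_normal q'' D \<mu>" using outer_normal_exists[OF assms(8,6)] .
  have "\<mu> = \<nu> \<or> \<mu> = - \<nu>"
    using assms(7) outer_normalD[OF mu] outer_normalD[OF assms(9)]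
      outer_normal_orthogonal[OF mu] outer_normal_orthogonal[OF assms(9)]
    by (intro unit_normal_pm[OF assms(5)]) auto
  moreover have "\<mu> \<noteq> \<nu>"
    using facets_same_side_overlap[of q' q'' D \<nu>] assms mu by (auto intro: convex_Int)
  ultimately show n: "outer_normal q'' D (- \<nu>)" using mu by auto
  have D': "D = q' \<inter> {x. \<nu> \<bullet> x = \<nu> \<bullet> y}"
    by (rule facet_eq_outer_normal[OF assms(1,5,9,10)])
  have D'': "D = q'' \<inter> {x. \<nu> \<bullet> x = \<nu> \<bullet> y}"
    using facet_eq_outer_normal[OF assms(2,6) n assms(10)] by simp
  have le: "\<nu> \<bullet> x \<le> \<nu> \<bullet> y" if "x \<in> q'" for x by (rule outer_normal_le[OF assms(9) that assms(10)])
  have ge: "\<nu> \<bullet> x \<ge> \<nu> \<bullet> y" if "x \<in> q''" for x using outer_normal_le[OF n that assms(10)] by simp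
  have "x \<in> q'" if "x \<in> q''" "\<nu> \<bullet> x \<le> \<nu> \<bullet> y" for x
  proof -
    have "x \<in> D" using that ge[OF that(1)] D'' by auto
    thus ?thesis using assms(4) by simp
  qed
  thus "q' = q \<inter> {x. \<nu> \<bullet> x \<le> \<nu> \<bullet> y}" using le assms(3) by blast
  have "x \<in> q''" if "x \<in> q'" "\<nu> \<bullet> x \<ge> \<nu> \<bullet> y" for x
  proof -
    have "x \<in> D" using that le[OF that(1)] D' by auto
    thus ?thesis using assms(4) by simp
  qed
  thus "q'' = q \<inter> {x. \<nu> \<bullet> x \<ge> \<nu> \<bullet> y}" using ge assms(3) by blast
  show "D = q \<inter> {x. \<nu> \<bullet> x = \<nu> \<bullet> y}" using D' D'' assms(3) by blast
qed

lemma aff_dim_Int_halfspace: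
  fixes F :: "'a::euclidean_space set"
  assumes "convex F" "x \<in> F" "a \<bullet> x < c"
  shows "aff_dim (F \<inter> {z. a \<bullet> z \<le> c}) = aff_dim F"
proof -
  have "aff_dim F = aff_dim (F \<inter> {z. a \<bullet> z < c})"
    using assms by (intro aff_dim_convex_Int_open[symmetric] open_halfspace_lt) auto
  also have "\<dots> \<le> aff_dim (F \<inter> {z. a \<bullet> z \<le> c})" by (intro aff_dim_subset) auto
  finally show ?thesis using aff_dim_subset[of "F \<inter> {z. a \<bullet> z \<le> c}" F] by auto
qed

lemma facet_Int_halfspace:
  assumes "convex q" "F facet_of q" "x \<in> F" "a \<bullet> x < c"
  shows "(F \<inter> {z. a \<bullet> z \<le> c}) facet_of (q \<inter> {z. a \<bullet> z \<le> c})"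
proof -
  have cF: "convex F" by (rule face_of_imp_convex[OF facet_of_imp_face_of[OF assms(2)]])
  have xq: "x \<in> q" using assms(2,3) facet_of_imp_subset by blast
  have "(F \<inter> {z. a \<bullet> z \<le> c}) face_of (q \<inter> {z. a \<bullet> z \<le> c})"
    by (rule face_of_slice[OF facet_of_imp_face_of[OF assms(2)] convex_halfspace_le])
  thus ?thesis
    using assms(2,3,4) aff_dim_Int_halfspace[OF cF assms(3,4)] aff_dim_Int_halfspace[OF assms(1) xq assms(4)]
    by (auto simp: facet_of_def)
qed

lemma outer_normal_Int_halfspace:
  assumes "convex q" "F facet_of q" "outer_normal q F \<mu>" "x \<in> F" "a \<bullet> x < c"
  shows "outer_normal (q \<inter> {z. a \<bullet> z \<le> c}) (F \<inter> {z. a \<bullet> z \<le> c}) \<mu>"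
proof -
  have xq: "x \<in> q" using assms(2,4) facet_of_imp_subset by blast
  have "directions (q \<inter> {z. a \<bullet> z \<le> c}) = directions q"
    using xq assms(5) by (intro directions_eqI aff_dim_Int_halfspace[OF assms(1) xq assms(5)]) auto
  thus ?thesis using assms(3) unfolding outer_normal_def by blast
qed

text \<open>Truncation changes neither the direction space of the facet nor its outer normal, hence
  not the induced orientation.\<close>

lemma facet_or_Int_halfspace:
  assumes "(q, \<xi>) \<in> cells k X" "(q \<inter> {z. a \<bullet> z \<le> c}, \<xi>) \<in> cells k X" "F facet_of q" "x \<in> F" "a \<bullet> x < c"
  shows "facet_or k (q \<inter> {z. a \<bullet> z \<le> c}) \<xi> (F \<inter> {z. a \<bullet> z \<le> c}) = facet_or k q \<xi> F"
proof -
  have cq: "convex q" by (rule cellsD(6)[OF assms(1)])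
  have cF: "convex F" by (rule face_of_imp_convex[OF facet_of_imp_face_of[OF assms(3)]])
  obtain \<mu> where mu: "outer_normal q F \<mu>"
    using outer_normal_exists[OF cellsD(8)[OF assms(1)] assms(3)] .
  have "directions (F \<inter> {z. a \<bullet> z \<le> c}) = directions F"
    using assms(4,5) by (intro directions_eqI aff_dim_Int_halfspace[OF cF assms(4,5)]) auto
  hence "orients (k - 1) (F \<inter> {z. a \<bullet> z \<le> c}) (facet_or k q \<xi> F)"
    using facet_or_props(1)[OF assms(1,3) mu] orients_cong by blast
  thus ?thesis
    by (rule facet_or_eqI_normal[OF assms(2) facet_Int_halfspace[OF cq assms(3-5)]
          outer_normal_Int_halfspace[OF cq assms(3) mu assms(4,5)] _ facet_or_props(2)[OF assms(1,3) mu]])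
qed

text \<open>Near \<open>x\<close> the cut is not felt: a short initial piece of the segment from
  \<open>x\<close> to any point of \<open>q\<close> stays in the halfspace, so the outer normal of
  \<open>F'\<close> supports all of \<open>q\<close>.\<close>

lemma facet_of_Int_halfspace_cases:
  fixes q :: "(real ^ 'n::finite) set"
  assumes "polyhedron q" "polyhedron (q \<inter> {z. a \<bullet> z \<le> c})" "F' facet_of (q \<inter> {z. a \<bullet> z \<le> c})"
    and "x \<in> F'" "a \<bullet> x < c"
  obtains F where "F facet_of q" "F' = F \<inter> {z. a \<bullet> z \<le> c}"
proof -
  let ?q = "q \<inter> {z. a \<bullet> z \<le> c}"
  have cq: "convex q" "convex ?q" using assms(1,2) polyhedron_imp_convex by auto
  obtain \<mu> where mu: "outer_normal ?q F' \<mu>" using outer_normal_exists[OF assms(2,3)] .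
  have xq: "x \<in> q" using facet_of_imp_subset[OF assms(3)] assms(4) by auto
  have le: "\<mu> \<bullet> y \<le> \<mu> \<bullet> x" if "y \<in> q" for y
  proof -
    \<comment> \<open>Small enough that the fraction \<open>t\<close> of the way from
      \<open>x\<close> to \<open>y\<close> does not cross the hyperplane; the summand 1 avoids a
      zero denominator.\<close>
    define t where "t = min 1 ((c - a \<bullet> x) / (\<bar>a \<bullet> (y - x)\<bar> + 1))"
    have t: "t > 0" "t \<le> 1" using assms(5) by (auto simp: t_def)
    have "t * (\<bar>a \<bullet> (y - x)\<bar> + 1) \<le> c - a \<bullet> x"
    proof -
      have "t \<le> (c - a \<bullet> x) / (\<bar>a \<bullet> (y - x)\<bar> + 1)" by (simp add: t_def)
      thus ?thesis by (simp add: pos_le_divide_eq)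
    qed
    moreover have "t * (a \<bullet> (y - x)) \<le> t * (\<bar>a \<bullet> (y - x)\<bar> + 1)" using t by (intro mult_left_mono) auto
    ultimately have "a \<bullet> ((1 - t) *\<^sub>R x + t *\<^sub>R y) \<le> c"
      by (simp add: inner_add_right inner_diff_right algebra_simps)
    moreover have "(1 - t) *\<^sub>R x + t *\<^sub>R y \<in> q" using cq(1) xq that t by (intro convexD_alt) auto
    ultimately have "\<mu> \<bullet> ((1 - t) *\<^sub>R x + t *\<^sub>R y) \<le> \<mu> \<bullet> x"
      by (intro outer_normal_le[OF mu _ assms(4)]) auto
    hence "t * (\<mu> \<bullet> y) \<le> t * (\<mu> \<bullet> x)" by (simp add: inner_add_right algebra_simps)
    thus ?thesis using t by simp
  qed
  define F where "F = q \<inter> {y. \<mu> \<bullet> y = \<mu> \<bullet> x}"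
  have F': "F' = F \<inter> {z. a \<bullet> z \<le> c}"
    using facet_eq_outer_normal[OF cq(2) assms(3) mu assms(4)] by (auto simp: F_def)
  have face: "F face_of q" unfolding F_def by (rule face_of_Int_supporting_hyperplane_le[OF cq(1) le])
  obtain z where "z \<in> ?q" "\<mu> \<bullet> z < \<mu> \<bullet> x" using outer_normal_strict[OF mu assms(4)] by blast
  hence "z \<in> q" "z \<notin> F" by (simp_all add: F_def)
  hence "F \<noteq> q" by blast
  hence "aff_dim F < aff_dim q" by (rule face_of_aff_dim_lt[OF cq(1) face])
  moreover have "aff_dim F' \<le> aff_dim F" using F' by (intro aff_dim_subset) auto
  moreover have "aff_dim F' = aff_dim q - 1"
    using assms(3) aff_dim_Int_halfspace[OF cq(1) xq assms(5)] by (simp add: facet_of_def)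
  ultimately have "F facet_of q" using face assms(4) F' by (auto simp: facet_of_def)
  thus ?thesis using that F' by blast
qed

text \<open>A facet of the cut polytope without points strictly inside the halfspace lies in
  \<open>D\<close> and equals it by dimension; every other one is the truncation of a facet of
  \<open>q\<close>.\<close>

lemma facets_Int_halfspace:
  fixes q :: "(real ^ 'n::finite) set"
  assumes "polyhedron q" "polyhedron (q \<inter> {z. a \<bullet> z \<le> c})"
    and D: "D = q \<inter> {z. a \<bullet> z = c}" "D facet_of (q \<inter> {z. a \<bullet> z \<le> c})"
  shows "{F. F facet_of (q \<inter> {z. a \<bullet> z \<le> c})} =
      insert D ((\<lambda>F. F \<inter> {z. a \<bullet> z \<le> c}) ` {F. F facet_of q \<and> (\<exists>x\<in>F. a \<bullet> x < c)})"
    and "D \<notin> (\<lambda>F. F \<inter> {z. a \<bullet> z \<le> c}) ` {F. F facet_of q \<and> (\<exists>x\<in>F. a \<bullet> x < c)}"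
    and "inj_on (\<lambda>F. F \<inter> {z. a \<bullet> z \<le> c}) {F. F facet_of q \<and> (\<exists>x\<in>F. a \<bullet> x < c)}"
proof -
  let ?T = "{z. a \<bullet> z \<le> c}"
  have cq: "convex q" using assms(1) by (rule polyhedron_imp_convex)
  have cD: "convex D" by (rule face_of_imp_convex[OF facet_of_imp_face_of[OF D(2)]])
  show "D \<notin> (\<lambda>F. F \<inter> ?T) ` {F. F facet_of q \<and> (\<exists>x\<in>F. a \<bullet> x < c)}"
    using D(1) by force
  show "{F. F facet_of (q \<inter> ?T)} = insert D ((\<lambda>F. F \<inter> ?T) ` {F. F facet_of q \<and> (\<exists>x\<in>F. a \<bullet> x < c)})"
  proof (intro equalityI subsetI)
    fix F' assume "F' \<in> {F. F facet_of (q \<inter> ?T)}"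
    hence F': "F' facet_of (q \<inter> ?T)" by simp
    show "F' \<in> insert D ((\<lambda>F. F \<inter> ?T) ` {F. F facet_of q \<and> (\<exists>x\<in>F. a \<bullet> x < c)})"
    proof (cases "\<exists>x\<in>F'. a \<bullet> x < c")
      case True
      then obtain x where x: "x \<in> F'" "a \<bullet> x < c" by auto
      then obtain F where "F facet_of q" "F' = F \<inter> ?T"
        using facet_of_Int_halfspace_cases[OF assms(1,2) F'] by blast
      thus ?thesis using x by blast
    next
      case False
      have sub: "F' \<subseteq> D"
      proof
        fix x assume "x \<in> F'"
        hence "x \<in> q \<inter> ?T" "\<not> a \<bullet> x < c" using facet_of_imp_subset[OF F'] False by auto
        thus "x \<in> D" by (auto simp: D(1))
      qed
      have "F' face_of D"
        using face_of_subset[OF facet_of_imp_face_of[OF F'] sub facet_of_imp_subset[OF D(2)]] .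
      moreover have "aff_dim F' = aff_dim D" using F' D(2) by (simp add: facet_of_def)
      ultimately have "F' = D" using face_of_aff_dim_lt[OF cD] by fastforce
      thus ?thesis by simp
    qed
  next
    fix F' assume "F' \<in> insert D ((\<lambda>F. F \<inter> ?T) ` {F. F facet_of q \<and> (\<exists>x\<in>F. a \<bullet> x < c)})"
    thus "F' \<in> {F. F facet_of (q \<inter> ?T)}" using D(2) facet_Int_halfspace[OF cq] by blast
  qed
  \<comment> \<open>Two facets with the same truncation meet in a face that has the full dimension
    of \<open>F1\<close>.\<close>
  have sub: "F1 \<subseteq> F2" if F: "F1 facet_of q" "F2 facet_of q" "x \<in> F1" "a \<bullet> x < c" "F1 \<inter> ?T = F2 \<inter> ?T"
    for F1 F2 x
  proof -
    have c1: "convex F1" by (rule face_of_imp_convex[OF facet_of_imp_face_of[OF F(1)]])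
    have "F1 \<inter> F2 face_of q" using F(1,2) by (intro face_of_Int facet_of_imp_face_of)
    hence f: "F1 \<inter> F2 face_of F1" by (rule face_of_subset) (use facet_of_imp_subset[OF F(1)] in auto)
    have "aff_dim F1 = aff_dim (F1 \<inter> ?T)" by (rule aff_dim_Int_halfspace[OF c1 F(3,4), symmetric])
    also have "\<dots> \<le> aff_dim (F1 \<inter> F2)" using F(5) by (intro aff_dim_subset) auto
    finally have "F1 \<inter> F2 = F1" using face_of_aff_dim_lt[OF c1 f] by fastforce
    thus ?thesis by auto
  qed
  show "inj_on (\<lambda>F. F \<inter> ?T) {F. F facet_of q \<and> (\<exists>x\<in>F. a \<bullet> x < c)}"
    by (rule inj_onI) (use sub in blast)
qed

text \<open>The function \<open>f\<close> is abstract so that a filter on direction spaces can be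
  built into it. The common facet occurs in the two boundaries with opposite orientations and
  cancels; any facet of \<open>q\<close> either lies in one piece or is itself split by the
  hyperplane.\<close>

lemma sum_bd_cells_split:
  fixes f :: "'n::{finite,linorder} cell \<Rightarrow> 'a::ab_group_add"
  assumes cells: "(q, \<xi>) \<in> cells k X" "(q', \<xi>) \<in> cells k X" "(q'', \<xi>) \<in> cells k X"
    and q: "q = q' \<union> q''" "(q' \<inter> q'') facet_of q'" "(q' \<inter> q'') facet_of q''"
    and odd: "\<And>F \<eta>. (F, \<eta>) \<in> cells (k - 1) X \<Longrightarrow> f (F, - \<eta>) = - f (F, \<eta>)"
    and add: "\<And>F F' F'' \<eta>. (F, \<eta>) \<in> cells (k - 1) X \<Longrightarrow> (F', \<eta>) \<in> cells (k - 1) X \<Longrightarrow>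
      (F'', \<eta>) \<in> cells (k - 1) X \<Longrightarrow> F = F' \<union> F'' \<Longrightarrow> (F' \<inter> F'') facet_of F' \<Longrightarrow>
      (F' \<inter> F'') facet_of F'' \<Longrightarrow> f (F', \<eta>) + f (F'', \<eta>) = f (F, \<eta>)"
  shows "(\<Sum>p\<in>bd_cells k (q', \<xi>). f p) + (\<Sum>p\<in>bd_cells k (q'', \<xi>). f p) = (\<Sum>p\<in>bd_cells k (q, \<xi>). f p)"
proof -
  define D where "D = q' \<inter> q''"
  have D: "D facet_of q'" "D facet_of q''" using q by (simp_all add: D_def)
  have cx: "convex q" "convex q'" "convex q''" using cellsD(6) cells by blast+
  have ph: "polyhedron q" "polyhedron q'" "polyhedron q''" using cellsD(8) cells by blast+
  have ne: "q' \<noteq> {}" "q'' \<noteq> {}" using cellsD(7) cells by blast+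
  have dq: "directions q' = directions q"
    by (rule directions_eqI) (use cellsD(2)[OF cells(1)] cellsD(2)[OF cells(2)] q(1) ne in auto)
  have dq'': "directions q'' = directions q"
    by (rule directions_eqI) (use cellsD(2)[OF cells(1)] cellsD(2)[OF cells(3)] q(1) ne in auto)
  obtain y where y: "y \<in> D" using facet_dim(1)[OF D(1)] by auto
  obtain \<nu> where nu: "outer_normal q' D \<nu>" using outer_normal_exists[OF ph(2) D(1)] .
  define c where "c = \<nu> \<bullet> y"
  have dq': "directions q' = directions q''" using dq dq'' by simp
  note halves = split_halfspaces[OF cx(2,3) q(1) D_def D dq' ph(3) nu y, folded c_def]
  note nu'' = halves(1)
  define T1 where "T1 = {z. \<nu> \<bullet> z \<le> c}"
  \<comment> \<open>Negating both sides gives the second half an inequality of the same form, so the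
    same facts apply to both pieces.\<close>
  define T2 where "T2 = {z. - \<nu> \<bullet> z \<le> - c}"
  have q': "q' = q \<inter> T1" and q'': "q'' = q \<inter> T2" using halves by (auto simp: T1_def T2_def)
  have D1: "D = q \<inter> {z. \<nu> \<bullet> z = c}" and D2: "D = q \<inter> {z. - \<nu> \<bullet> z = - c}" using halves(4) by auto
  define A where "A = {F. F facet_of q \<and> (\<exists>x\<in>F. \<nu> \<bullet> x < c)}"
  define B where "B = {F. F facet_of q \<and> (\<exists>x\<in>F. - \<nu> \<bullet> x < - c)}"
  note F1 = facets_Int_halfspace[OF ph(1) ph(2)[unfolded q' T1_def] D1 D(1)[unfolded q' T1_def],
      folded T1_def q' A_def]
  note F2 = facets_Int_halfspace[OF ph(1) ph(3)[unfolded q'' T2_def] D2 D(2)[unfolded q'' T2_def],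
      folded T2_def q'' B_def]
  have fin: "finite {F. F facet_of q}" by (rule finite_facets[OF cells(1)])
  have finAB: "finite A" "finite B" unfolding A_def B_def by (rule finite_subset[OF _ fin], auto)+
  let ?o = "facet_or k q \<xi>"
  have or1: "facet_or k q' \<xi> (F \<inter> T1) = ?o F" "(F \<inter> T1) facet_of q'" if "F \<in> A" for F
  proof -
    obtain x where x: "F facet_of q" "x \<in> F" "\<nu> \<bullet> x < c" using \<open>F \<in> A\<close> by (auto simp: A_def)
    show "facet_or k q' \<xi> (F \<inter> T1) = ?o F"
      unfolding q' T1_def
      by (rule facet_or_Int_halfspace[OF cells(1) cells(2)[unfolded q' T1_def] x])
    show "(F \<inter> T1) facet_of q'"
      unfolding q' T1_def by (rule facet_Int_halfspace[OF cx(1) x])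
  qed
  have or2: "facet_or k q'' \<xi> (F \<inter> T2) = ?o F" "(F \<inter> T2) facet_of q''" if "F \<in> B" for F
  proof -
    obtain x where x: "F facet_of q" "x \<in> F" "- \<nu> \<bullet> x < - c" using \<open>F \<in> B\<close> unfolding B_def by blast
    show "facet_or k q'' \<xi> (F \<inter> T2) = ?o F"
      unfolding q'' T2_def
      by (rule facet_or_Int_halfspace[OF cells(1) cells(3)[unfolded q'' T2_def] x])
    show "(F \<inter> T2) facet_of q''"
      unfolding q'' T2_def by (rule facet_Int_halfspace[OF cx(1) x])
  qed
  have sum1: "(\<Sum>p\<in>bd_cells k (q', \<xi>). f p) = f (D, facet_or k q' \<xi> D) + (\<Sum>F\<in>A. f (F \<inter> T1, ?o F))"
    unfolding sum_bd_cells[OF cells(2)] F1(1)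
    using F1(2,3) finAB(1) or1 by (subst sum.insert) (auto simp: sum.reindex)
  have sum2: "(\<Sum>p\<in>bd_cells k (q'', \<xi>). f p) = f (D, facet_or k q'' \<xi> D) + (\<Sum>F\<in>B. f (F \<inter> T2, ?o F))"
    unfolding sum_bd_cells[OF cells(3)] F2(1)
    using F2(2,3) finAB(2) or2 by (subst sum.insert) (auto simp: sum.reindex)
  \<comment> \<open>Along \<open>D\<close> the outer normals are opposite, and with them the induced
    orientations.\<close>
  have "facet_or k q'' \<xi> D = - facet_or k q' \<xi> D"
    using facet_or_props[OF cells(2) D(1) nu]
    by (intro facet_or_eqI_normal[OF cells(3) D(2) nu'']) (simp_all add: orients_minus mvec_of_minus)
  hence cancel: "f (D, facet_or k q' \<xi> D) + f (D, facet_or k q'' \<xi> D) = 0"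
    using odd[OF facet_cell(1)[OF cells(2) D(1)]] by simp
  have rest: "(if F \<in> A then f (F \<inter> T1, ?o F) else 0) + (if F \<in> B then f (F \<inter> T2, ?o F) else 0) = f (F, ?o F)"
    if F: "F facet_of q" for F
  proof -
    have cF: "convex F" by (rule face_of_imp_convex[OF facet_of_imp_face_of[OF F]])
    \<comment> \<open>A facet inside the hyperplane would have outer normal \<open>\<nu>\<close> or
      \<open>- \<nu>\<close>, but \<open>q\<close> has points strictly on both sides.\<close>
    have FAB: "F \<in> A \<or> F \<in> B"
    proof (rule ccontr)
      assume "\<not> (F \<in> A \<or> F \<in> B)"
      hence "\<nu> \<bullet> x = c" if "x \<in> F" for x
        using that F by (auto simp: A_def B_def not_less intro: antisym)
      hence sub: "F \<subseteq> D" using facet_of_imp_subset[OF F] D1 by auto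
      have "aff_dim F = aff_dim D"
        using F D(1) cellsD(2)[OF cells(1)] cellsD(2)[OF cells(2)] by (simp add: facet_of_def)
      hence dF: "directions F = directions D"
        by (rule directions_eqI[OF sub _ facet_dim(1)[OF F]])
      obtain \<mu> where mu: "outer_normal q F \<mu>" using outer_normal_exists[OF ph(1) F] .
      have "\<mu> = \<nu> \<or> \<mu> = - \<nu>"
        using outer_normalD[OF mu] outer_normalD[OF nu] dq dF
          outer_normal_orthogonal[OF mu] outer_normal_orthogonal[OF nu]
        by (intro unit_normal_pm[OF F]) auto
      moreover obtain z where z: "z \<in> q'" "\<nu> \<bullet> z < c" using outer_normal_strict[OF nu y] c_def by blast
      moreover obtain z' where z': "z' \<in> q''" "\<nu> \<bullet> z' > c"
        using outer_normal_strict[OF nu'' y] by (auto simp: c_def)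
      moreover obtain x where x: "x \<in> F" using facet_dim(1)[OF F] by auto
      moreover have "\<nu> \<bullet> x = c" using x sub D1 by auto
      ultimately show False
        using outer_normal_le[OF mu _ x, of z] outer_normal_le[OF mu _ x, of z'] q(1) by auto
    qed
    show ?thesis
    proof (cases "F \<in> A \<and> F \<in> B")
      case True
      then obtain x x' where x: "x \<in> F" "\<nu> \<bullet> x < c" "x' \<in> F" "\<nu> \<bullet> x' > c"
        by (auto simp: A_def B_def)
      have E: "(F \<inter> T1) \<inter> (F \<inter> T2) = F \<inter> {z. \<nu> \<bullet> z = c}" by (auto simp: T1_def T2_def)
      have dE: "aff_dim (F \<inter> {z. \<nu> \<bullet> z = c}) = aff_dim F - 1"
        by (rule aff_dim_convex_Int_hyperplane[OF cF x])
      have d1: "aff_dim (F \<inter> T1) = aff_dim F"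
        unfolding T1_def by (rule aff_dim_Int_halfspace[OF cF x(1,2)])
      have d2: "aff_dim (F \<inter> T2) = aff_dim F"
        unfolding T2_def by (rule aff_dim_Int_halfspace[OF cF x(3)]) (use x(4) in simp)
      \<comment> \<open>The empty set has dimension -1; the two separated points exclude an empty
        cut.\<close>
      have "0 \<le> aff_dim F - 1"
      proof -
        have "x \<in> F" "x' \<in> F" "x \<noteq> x'" using x by auto
        hence "aff_dim F \<ge> aff_dim {x, x'}" by (intro aff_dim_subset) auto
        thus ?thesis using \<open>x \<noteq> x'\<close> by (simp add: aff_dim_2)
      qed
      hence neE: "F \<inter> {z. \<nu> \<bullet> z = c} \<noteq> {}" using dE by auto
      have f1: "(F \<inter> T1) \<inter> (F \<inter> T2) face_of (F \<inter> T1)"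
      proof -
        have "(F \<inter> T1) \<inter> {z. \<nu> \<bullet> z = c} face_of (F \<inter> T1)"
          by (rule face_of_Int_supporting_hyperplane_le)
             (auto simp: T1_def intro: convex_Int cF convex_halfspace_le)
        moreover have "(F \<inter> T1) \<inter> {z. \<nu> \<bullet> z = c} = (F \<inter> T1) \<inter> (F \<inter> T2)" by (auto simp: T1_def T2_def)
        ultimately show ?thesis by simp
      qed
      have f2: "(F \<inter> T1) \<inter> (F \<inter> T2) face_of (F \<inter> T2)"
      proof -
        have "(F \<inter> T2) \<inter> {z. - \<nu> \<bullet> z = - c} face_of (F \<inter> T2)"
          by (rule face_of_Int_supporting_hyperplane_le)
             (auto simp only: T2_def mem_Collect_eq Int_iff intro!: convex_Int cF convex_halfspace_le)
        moreover have "(F \<inter> T2) \<inter> {z. - \<nu> \<bullet> z = - c} = (F \<inter> T1) \<inter> (F \<inter> T2)" by (auto simp: T1_def T2_def)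
        ultimately show ?thesis by simp
      qed
      have "f (F \<inter> T1, ?o F) + f (F \<inter> T2, ?o F) = f (F, ?o F)"
      proof (rule add)
        show "(F, ?o F) \<in> cells (k - 1) X" by (rule facet_cell(1)[OF cells(1) F])
        show "(F \<inter> T1, ?o F) \<in> cells (k - 1) X"
          using facet_cell(1)[OF cells(2) or1(2)] or1(1) True by metis
        show "(F \<inter> T2, ?o F) \<in> cells (k - 1) X"
          using facet_cell(1)[OF cells(3) or2(2)] or2(1) True by metis
        show "F = F \<inter> T1 \<union> F \<inter> T2" by (auto simp: T1_def T2_def)
        show "F \<inter> T1 \<inter> (F \<inter> T2) facet_of F \<inter> T1" "F \<inter> T1 \<inter> (F \<inter> T2) facet_of F \<inter> T2"
          unfolding facet_of_def using f1 f2 dE d1 d2 neE unfolding E by auto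
      qed
      thus ?thesis using True by simp
    next
      case False
      then consider "F \<in> A" "F \<notin> B" | "F \<notin> A" "F \<in> B" using FAB by auto
      thus ?thesis
      proof cases
        case 1
        hence "F \<inter> T1 = F" using F by (auto simp: B_def T1_def)
        thus ?thesis using 1 by simp
      next
        case 2
        hence "F \<inter> T2 = F" using F by (auto simp: A_def T2_def)
        thus ?thesis using 2 by simp
      qed
    qed
  qed
  have "(\<Sum>F\<in>A. f (F \<inter> T1, ?o F)) = (\<Sum>F | F facet_of q. if F \<in> A then f (F \<inter> T1, ?o F) else 0)"
    using fin by (intro sum.mono_neutral_cong_left) (auto simp: A_def)
  moreover have "(\<Sum>F\<in>B. f (F \<inter> T2, ?o F)) = (\<Sum>F | F facet_of q. if F \<in> B then f (F \<inter> T2, ?o F) else 0)"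
    using fin by (intro sum.mono_neutral_cong_left) (auto simp: B_def)
  ultimately have total: "(\<Sum>F\<in>A. f (F \<inter> T1, ?o F)) + (\<Sum>F\<in>B. f (F \<inter> T2, ?o F)) = (\<Sum>F | F facet_of q. f (F, ?o F))"
    by (simp only: sum.distrib[symmetric]) (intro sum.cong refl, use rest in simp)
  have rearrange: "u + a + (v + b) = a + b" if "u + v = 0" for u v a b :: 'a
    using that by (metis (no_types, opaque_lifting) add.assoc add.commute add_0)
  show ?thesis unfolding sum1 sum2 sum_bd_cells[OF cells(1)] rearrange[OF cancel] by (rule total)
qed


subsection \<open>Products of cells\<close>

definition msum :: "'a::ab_group_add set \<Rightarrow> 'a set \<Rightarrow> 'a set" where
  "msum A B = {x + y | x y. x \<in> A \<and> y \<in> B}"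

lemma msumI: "x \<in> A \<Longrightarrow> y \<in> B \<Longrightarrow> x + y \<in> msum A B"
  by (auto simp: msum_def)

lemma msum_commute: "msum A B = msum B A"
  unfolding msum_def by (metis (no_types, opaque_lifting) add.commute)

lemma msum_mono: "A \<subseteq> A' \<Longrightarrow> B \<subseteq> B' \<Longrightarrow> msum A B \<subseteq> msum A' B'"
  by (auto simp: msum_def)

lemma convex_msum:
  assumes "convex A" "convex B"
  shows "convex (msum A B)"
proof -
  have "msum A B = (\<Union>x\<in>A. \<Union>y\<in>B. {x + y})" by (auto simp: msum_def)
  thus ?thesis using convex_sums[OF assms] by simp
qed

text \<open>A segment in \<open>A\<close> is translated by a point of \<open>B\<close> into a
  segment of the sum, where the face property of \<open>F\<close> applies.\<close>

lemma face_of_msum_projection: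
  assumes "convex A" "convex B" "F face_of msum A B"
  shows "{x \<in> A. \<exists>y\<in>B. x + y \<in> F} face_of A"
proof -
  define F1 where "F1 = {x \<in> A. \<exists>y\<in>B. x + y \<in> F}"
  show ?thesis
    unfolding F1_def[symmetric] unfolding face_of_def
  proof (intro conjI ballI impI)
    show "F1 \<subseteq> A" by (auto simp: F1_def)
    show "convex F1"
    proof (rule convexI)
      fix x x' and u v :: real assume uv: "0 \<le> u" "0 \<le> v" "u + v = 1" and "x \<in> F1" "x' \<in> F1"
      then obtain y y' where y: "x \<in> A" "y \<in> B" "x + y \<in> F" "x' \<in> A" "y' \<in> B" "x' + y' \<in> F"
        by (auto simp: F1_def)
      have "u *\<^sub>R (x + y) + v *\<^sub>R (x' + y') \<in> F"
        using face_of_imp_convex[OF assms(3)] y uv by (intro convexD) auto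
      hence "(u *\<^sub>R x + v *\<^sub>R x') + (u *\<^sub>R y + v *\<^sub>R y') \<in> F" by (simp add: algebra_simps)
      moreover have "u *\<^sub>R y + v *\<^sub>R y' \<in> B" "u *\<^sub>R x + v *\<^sub>R x' \<in> A"
        using assms(1,2) y uv by (auto intro: convexD)
      ultimately show "u *\<^sub>R x + v *\<^sub>R x' \<in> F1" by (auto simp: F1_def)
    qed
    fix a b x assume ab: "a \<in> A" "b \<in> A" "x \<in> F1" "x \<in> open_segment a b"
    then obtain y where y: "y \<in> B" "x + y \<in> F" by (auto simp: F1_def)
    obtain t where t: "0 < t" "t < 1" "x = (1 - t) *\<^sub>R a + t *\<^sub>R b" "a \<noteq> b"
      using ab(4) by (auto simp: in_segment)
    have "x + y = (1 - t) *\<^sub>R (a + y) + t *\<^sub>R (b + y)" using t(3) by (simp add: algebra_simps)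
    hence "x + y \<in> open_segment (a + y) (b + y)" unfolding in_segment using t by auto
    hence "a + y \<in> F \<and> b + y \<in> F"
      using face_ofD[OF assms(3), of "x + y" "a + y" "b + y"] y ab msumI by blast
    thus "a \<in> F1" "b \<in> F1" using ab y by (auto simp: F1_def)
  qed
qed

lemma polytope_msum:
  fixes A B :: "'a::euclidean_space set"
  assumes "polytope A" "polytope B"
  shows "polytope (msum A B)"
proof -
  have "polytope ((\<lambda>(x, y). x + y) ` (A \<times> B))"
    by (intro polytope_linear_image polytope_Times assms) (auto intro!: linearI simp: algebra_simps)
  moreover have "(\<lambda>(x, y). x + y) ` (A \<times> B) = msum A B" by (auto simp: msum_def)
  ultimately show ?thesis by simp
qed

lemma directions_msum:
  assumes "A \<noteq> {}" "B \<noteq> {}"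
  shows "directions (msum A B) = msum (directions A) (directions B)"
proof
  have sub: "subspace (msum (directions A) (directions B))"
    unfolding msum_def by (intro subspace_sums subspace_directions)
  show "directions (msum A B) \<subseteq> msum (directions A) (directions B)"
  proof (rule directions_least[OF sub])
    fix u v assume "u \<in> msum A B" "v \<in> msum A B"
    then obtain x y x' y' where *: "u = x + y" "v = x' + y'" "x \<in> A" "y \<in> B" "x' \<in> A" "y' \<in> B"
      by (auto simp: msum_def)
    have "(x - x') + (y - y') \<in> msum (directions A) (directions B)"
      by (intro msumI diff_in_directions *)
    thus "u - v \<in> msum (directions A) (directions B)" using * by (simp add: algebra_simps)
  qed
  obtain a b where ab: "a \<in> A" "b \<in> B" using assms by auto
  have "directions A \<subseteq> directions (msum A B)"
  proof (rule directions_least)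
    fix x y assume "x \<in> A" "y \<in> A"
    hence "(x + b) - (y + b) \<in> directions (msum A B)" using ab by (intro diff_in_directions msumI)
    thus "x - y \<in> directions (msum A B)" by simp
  qed simp
  moreover have "directions B \<subseteq> directions (msum A B)"
  proof (rule directions_least)
    fix x y assume "x \<in> B" "y \<in> B"
    hence "(a + x) - (a + y) \<in> directions (msum A B)" using ab by (intro diff_in_directions msumI)
    thus "x - y \<in> directions (msum A B)" by simp
  qed simp
  ultimately show "msum (directions A) (directions B) \<subseteq> directions (msum A B)"
    by (auto simp: msum_def intro: subspace_add)
qed

text \<open>Stands for the coordinate subspaces that carry the two factors. Orthogonality makes a
  normal of a facet of one factor a normal of the product facet, and it makes norms of orientations
  multiply. The symmetry \<open>swapped\<close> transfers statements from one factor to the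
  other.\<close>

locale orthogonal_pair =
  fixes X Y :: "(real ^ 'n::{finite,linorder}) set"
  assumes subspaces: "subspace X" "subspace Y"
    and orthogonal: "x \<in> X \<Longrightarrow> y \<in> Y \<Longrightarrow> x \<bullet> y = 0"
begin

lemma swapped: "orthogonal_pair Y X"
  by unfold_locales (simp_all add: subspaces, metis orthogonal inner_commute)

lemma directions_subset: "A \<subseteq> X \<Longrightarrow> directions A \<subseteq> X" "B \<subseteq> Y \<Longrightarrow> directions B \<subseteq> Y"
  using subspaces by (meson directions_least subspace_diff subset_iff)+

lemma decomposition_unique:
  assumes "x \<in> X" "x' \<in> X" "y \<in> Y" "y' \<in> Y" "x + y = x' + y'"
  shows "x = x'" "y = y'"
proof -
  have "x - x' = y' - y" using assms(5) by (simp add: algebra_simps)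
  moreover have "x - x' \<in> X" "y' - y \<in> Y" using assms subspaces by (auto intro: subspace_diff)
  ultimately have "(x - x') \<bullet> (x - x') = 0" using orthogonal by metis
  thus "x = x'" by simp
  thus "y = y'" using assms(5) by simp
qed

lemma Int_zero: "x \<in> X \<Longrightarrow> x \<in> Y \<Longrightarrow> x = 0"
  using orthogonal[of x x] by simp

lemma dim_directions_msum:
  assumes "A \<subseteq> X" "B \<subseteq> Y" "A \<noteq> {}" "B \<noteq> {}"
  shows "dim (directions (msum A B)) = dim (directions A) + dim (directions B)"
proof -
  have "directions A \<inter> directions B = {0}"
    using directions_subset(1)[OF assms(1)] directions_subset(2)[OF assms(2)] Int_zero
      subspace_0[OF subspace_directions] by blast
  thus ?thesis
    using dim_sums_Int[OF subspace_directions subspace_directions, of A B] directions_msum[OF assms(3,4)]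
    by (simp add: msum_def)
qed

lemma aff_dim_msum:
  assumes "A \<subseteq> X" "B \<subseteq> Y" "A \<noteq> {}" "B \<noteq> {}"
  shows "aff_dim (msum A B) = aff_dim A + aff_dim B"
proof -
  have "msum A B \<noteq> {}" using assms by (auto simp: msum_def)
  thus ?thesis using dim_directions_msum[OF assms] assms by (simp add: aff_dim_eq_directions)
qed

text \<open>Recovers the directions of the first factor from the product alone; their dimension
  later tells which factor was replaced by a facet.\<close>

lemma directions_msum_Int:
  assumes "A \<subseteq> X" "B \<subseteq> Y" "A \<noteq> {}" "B \<noteq> {}"
  shows "directions (msum A B) \<inter> X = directions A"
proof (intro equalityI subsetI)
  fix u assume u: "u \<in> directions (msum A B) \<inter> X"
  then obtain x y where xy: "u = x + y" "x \<in> directions A" "y \<in> directions B"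
    unfolding directions_msum[OF assms(3,4)] by (auto simp: msum_def)
  have "x = u" by (rule decomposition_unique(1)[of x u y 0])
     (use xy u directions_subset(1)[OF assms(1)] directions_subset(2)[OF assms(2)] subspaces in \<open>auto simp: subspace_0\<close>)
  thus "u \<in> directions A" using xy by simp
next
  fix u assume u: "u \<in> directions A"
  hence "u + 0 \<in> msum (directions A) (directions B)" by (intro msumI subspace_0 subspace_directions)
  thus "u \<in> directions (msum A B) \<inter> X"
    using u directions_subset(1)[OF assms(1)] directions_msum[OF assms(3,4)] by auto
qed

lemma msum_face:
  assumes "A \<subseteq> X" "B \<subseteq> Y" "convex A" "convex B" "F face_of A"
  shows "msum F B face_of msum A B"
  unfolding face_of_def
proof (intro conjI ballI impI)
  have FA: "F \<subseteq> A" by (rule face_of_imp_subset[OF assms(5)])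
  show "msum F B \<subseteq> msum A B" using FA by (intro msum_mono) auto
  show "convex (msum F B)" by (rule convex_msum[OF face_of_imp_convex[OF assms(5)] assms(4)])
  fix u v w assume "u \<in> msum A B" "v \<in> msum A B" "w \<in> msum F B" and w: "w \<in> open_segment u v"
  then obtain x y x' y' z z' where *: "u = x + y" "v = x' + y'" "w = z + z'"
    "x \<in> A" "y \<in> B" "x' \<in> A" "y' \<in> B" "z \<in> F" "z' \<in> B" by (auto simp: msum_def)
  obtain t where t: "0 < t" "t < 1" "w = (1 - t) *\<^sub>R u + t *\<^sub>R v" using w by (auto simp: in_segment)
  have mem: "(1 - t) *\<^sub>R x + t *\<^sub>R x' \<in> X" "(1 - t) *\<^sub>R y + t *\<^sub>R y' \<in> Y"
    using * assms(1,2) subspaces by (auto intro!: subspace_add subspace_scale)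
  have eq: "z + z' = ((1 - t) *\<^sub>R x + t *\<^sub>R x') + ((1 - t) *\<^sub>R y + t *\<^sub>R y')"
    using t(3) * by (simp add: algebra_simps)
  have z: "z = (1 - t) *\<^sub>R x + t *\<^sub>R x'"
    by (rule decomposition_unique(1)[OF _ mem(1) _ mem(2) eq]) (use * FA assms(1,2) in auto)
  have "x \<in> F \<and> x' \<in> F"
  proof (cases "x = x'")
    case True
    hence "z = x" using z by (simp add: algebra_simps)
    thus ?thesis using True * by simp
  next
    case False
    hence "z \<in> open_segment x x'" using z t by (auto simp: in_segment)
    thus ?thesis using face_ofD[OF assms(5), of z x x'] * by blast
  qed
  thus "u \<in> msum F B" "v \<in> msum F B" using * by (auto intro: msumI)
qed

text \<open>The midpoint of \<open>x + y\<close> and \<open>x' + y'\<close> is also the midpoint of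
  \<open>x + y'\<close> and \<open>x' + y\<close>, so a face with the first two points has the other
  two. A set closed under this exchange is the sum of its projections.\<close>

lemma face_of_msum_decompose:
  assumes "A \<subseteq> X" "B \<subseteq> Y" "convex A" "convex B" "F face_of msum A B"
  obtains F1 F2 where "F1 face_of A" "F2 face_of B" "F = msum F1 F2"
proof -
  have exchange: "x + y' \<in> F" if *: "x + y \<in> F" "x' + y' \<in> F" "x \<in> A" "y \<in> B" "x' \<in> A" "y' \<in> B" for x y x' y'
  proof -
    define m where "m = (1 / 2) *\<^sub>R (x + y) + (1 / 2) *\<^sub>R (x' + y')"
    have mF: "m \<in> F" unfolding m_def
      using face_of_imp_convex[OF assms(5)] *(1,2) by (intro convexD) auto
    show ?thesis
    proof (cases "x + y' = x' + y")
      case True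
      have "y' = y"
        by (rule decomposition_unique(2)[OF _ _ _ _ True]) (use * assms in auto)
      thus ?thesis using * by simp
    next
      case False
      have "m = (1 - 1 / 2) *\<^sub>R (x + y') + (1 / 2) *\<^sub>R (x' + y)"
        by (simp add: m_def algebra_simps)
      hence "m \<in> open_segment (x + y') (x' + y)" using False unfolding in_segment
        by (intro conjI exI[of _ "1 / 2"]) auto
      thus ?thesis
        using face_ofD[OF assms(5), of m "x + y'" "x' + y"] mF * msumI by blast
    qed
  qed
  define F1 where "F1 = {x \<in> A. \<exists>y\<in>B. x + y \<in> F}"
  define F2 where "F2 = {y \<in> B. \<exists>x\<in>A. x + y \<in> F}"
  have sub: "F \<subseteq> msum A B" by (rule face_of_imp_subset[OF assms(5)])
  have "F = msum F1 F2"
  proof (intro equalityI subsetI)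
    fix u assume "u \<in> F"
    then obtain x y where "u = x + y" "x \<in> A" "y \<in> B" using sub by (auto simp: msum_def)
    thus "u \<in> msum F1 F2" using \<open>u \<in> F\<close> by (auto simp: F1_def F2_def intro!: msumI)
  next
    fix u assume "u \<in> msum F1 F2"
    then obtain x y' y x' where "u = x + y'" "x \<in> A" "y \<in> B" "x + y \<in> F" "x' \<in> A" "y' \<in> B" "x' + y' \<in> F"
      by (auto simp: msum_def F1_def F2_def)
    thus "u \<in> F" using exchange by blast
  qed
  moreover have "F1 face_of A"
    unfolding F1_def by (rule face_of_msum_projection[OF assms(3-5)])
  moreover have "F2 face_of B"
    using face_of_msum_projection[OF assms(4,3), of F] assms(5)
    unfolding F2_def by (simp add: msum_commute[of B] add.commute[of _ _])
  ultimately show ?thesis by (intro that)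
qed

lemma msum_facet:
  assumes "A \<subseteq> X" "B \<subseteq> Y" "convex A" "convex B" "B \<noteq> {}" "F facet_of A"
  shows "msum F B facet_of msum A B"
proof -
  have F: "F \<noteq> {}" "A \<noteq> {}" "F \<subseteq> X" "aff_dim F = aff_dim A - 1"
    using assms(1,6) facet_dim(1,2)[OF assms(6)] facet_of_imp_subset[OF assms(6)] by (auto simp: facet_of_def)
  have "msum F B \<noteq> {}" using F assms(5) by (auto simp: msum_def)
  thus ?thesis unfolding facet_of_def
    using msum_face[OF assms(1-4) facet_of_imp_face_of[OF assms(6)]] F
      aff_dim_msum[OF assms(1,2) F(2) assms(5)] aff_dim_msum[OF F(3) assms(2) F(1) assms(5)] by simp
qed

text \<open>Dimensions add over the factors, so a face of codimension one loses a dimension in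
  exactly one of them.\<close>

lemma facets_msum:
  assumes "A \<subseteq> X" "B \<subseteq> Y" "convex A" "convex B" "A \<noteq> {}" "B \<noteq> {}"
  shows "{F. F facet_of msum A B} = (\<lambda>F. msum F B) ` {F. F facet_of A} \<union> msum A ` {F. F facet_of B}"
proof (intro equalityI subsetI)
  fix F assume "F \<in> {F. F facet_of msum A B}"
  hence F: "F facet_of msum A B" by simp
  obtain F1 F2 where F12: "F1 face_of A" "F2 face_of B" "F = msum F1 F2"
    using face_of_msum_decompose[OF assms(1-4) facet_of_imp_face_of[OF F]] .
  have ne: "F1 \<noteq> {}" "F2 \<noteq> {}" using facet_dim(1)[OF F] F12(3) by (auto simp: msum_def)
  have sub: "F1 \<subseteq> X" "F2 \<subseteq> Y" using face_of_imp_subset F12 assms(1,2) by blast+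
  have sum: "aff_dim F1 + aff_dim F2 = aff_dim A + aff_dim B - 1"
    using F aff_dim_msum[OF sub ne] aff_dim_msum[OF assms(1,2,5,6)] F12(3) by (simp add: facet_of_def)
  have le: "aff_dim F1 \<le> aff_dim A" "aff_dim F2 \<le> aff_dim B"
    using face_of_imp_subset F12 by (auto intro!: aff_dim_subset)
  consider "F1 = A" | "F2 = B" | "F1 \<noteq> A" "F2 \<noteq> B" by blast
  thus "F \<in> (\<lambda>F. msum F B) ` {F. F facet_of A} \<union> msum A ` {F. F facet_of B}"
  proof cases
    case 1
    hence "F2 facet_of B" using sum F12 ne by (simp add: facet_of_def)
    thus ?thesis using 1 F12(3) by auto
  next
    case 2
    hence "F1 facet_of A" using sum F12 ne by (simp add: facet_of_def)
    thus ?thesis using 2 F12(3) by auto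
  next
    case 3
    hence "aff_dim F1 < aff_dim A" "aff_dim F2 < aff_dim B"
      using face_of_aff_dim_lt[OF assms(3) F12(1)] face_of_aff_dim_lt[OF assms(4) F12(2)] by auto
    thus ?thesis using sum by linarith
  qed
next
  fix F assume "F \<in> (\<lambda>F. msum F B) ` {F. F facet_of A} \<union> msum A ` {F. F facet_of B}"
  thus "F \<in> {F. F facet_of msum A B}"
    using msum_facet[OF assms(1-4,6)] orthogonal_pair.msum_facet[OF swapped assms(2,1,4,3,5)]
    by (auto simp: msum_commute[of A])
qed

lemma inj_msum:
  assumes "A \<subseteq> X" "A' \<subseteq> X" "B \<subseteq> Y" "B \<noteq> {}" "msum A B = msum A' B"
  shows "A \<subseteq> A'"
proof
  fix x assume x: "x \<in> A"
  obtain b where b: "b \<in> B" using assms(4) by auto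
  have "x + b \<in> msum A' B" using x b assms(5) msumI by blast
  then obtain x' b' where *: "x + b = x' + b'" "x' \<in> A'" "b' \<in> B" by (auto simp: msum_def)
  have "x = x'" by (rule decomposition_unique(1)[OF _ _ _ _ *(1)]) (use * x b assms in auto)
  thus "x \<in> A'" using * by simp
qed

lemma norm_wedge_orthonormal:
  assumes "set bs \<subseteq> X" "set vs \<subseteq> Y" "distinct bs" "pairwise orthogonal (set bs)" "\<And>b. b \<in> set bs \<Longrightarrow> norm b = 1"
  shows "norm (wedge_list (bs @ vs)) = norm (wedge_list vs)"
  using assms
proof (induction bs)
  case (Cons b bs)
  have "contract b (wedge_list (bs @ vs)) = 0"
  proof (rule contract_wedge_list)
    fix w assume "w \<in> set (bs @ vs)"
    thus "b \<bullet> w = 0"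
      using Cons.prems orthogonal by (auto simp: pairwise_def orthogonal_def)
  qed
  thus ?case using Cons by (auto simp: norm_wedge_mvec pairwise_insert)
qed simp

text \<open>For norm 1, the first orientation is replaced by a signed orthonormal list. Its vectors
  are orthogonal to one another and to those of the second factor, so wedging with each of them
  preserves the norm.\<close>

lemma orients_msum:
  assumes "A \<subseteq> X" "B \<subseteq> Y" "A \<noteq> {}" "B \<noteq> {}" "dim (directions A) = a" "orients a A \<xi>" "orients b B \<eta>"
  shows "orients (a + b) (msum A B) (wedge \<xi> \<eta>)"
proof -
  obtain c vs where vs: "norm \<eta> = 1" "length vs = b" "set vs \<subseteq> directions B" "\<eta> = c *\<^sub>R wedge_list vs"
    using assms(7) by (auto simp: orients_def)
  obtain bs where bs: "distinct bs" "length bs = a" "set bs \<subseteq> directions A" "pairwise orthogonal (set bs)"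
      "\<And>b. b \<in> set bs \<Longrightarrow> norm b = 1" "\<xi> = wedge_list bs \<or> \<xi> = - wedge_list bs"
    using orients_basis[of A] assms(5,6) by metis
  obtain d :: real where d: "\<bar>d\<bar> = 1" "\<xi> = d *\<^sub>R wedge_list bs"
    using bs(6) that[of 1] that[of "-1"] by auto
  have w: "wedge \<xi> \<eta> = (d * c) *\<^sub>R wedge_list (bs @ vs)" by (simp add: d(2) vs(4) wedge_list_append)
  have "norm (wedge_list (bs @ vs)) = norm (wedge_list vs)"
    using bs vs(3) directions_subset(1)[OF assms(1)] directions_subset(2)[OF assms(2)]
    by (intro norm_wedge_orthonormal) auto
  hence "norm (wedge \<xi> \<eta>) = 1" unfolding w using vs(1)[unfolded vs(4)] d(1) by (simp add: abs_mult)
  moreover have "directions A \<subseteq> directions (msum A B)"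
    using directions_msum_Int[OF assms(1-4)] by blast
  moreover have "directions B \<subseteq> directions (msum A B)"
    using orthogonal_pair.directions_msum_Int[OF swapped assms(2,1,4,3)] by (auto simp: msum_commute[of A])
  ultimately show ?thesis unfolding orients_def using w bs(2,3) vs(2,3)
    by (intro conjI exI[of _ "d * c"] exI[of _ "bs @ vs"]) auto
qed

lemma wedge_cell_eq: "wedge_cell (q1, \<xi>1) (q2, \<xi>2) = (msum q1 q2, wedge \<xi>1 \<xi>2)"
  by (simp add: wedge_cell_def msum_def)

lemma msum_cell:
  assumes "(q1, \<xi>1) \<in> cells k1 X" "(q2, \<xi>2) \<in> cells k2 Y" "X \<subseteq> Z" "Y \<subseteq> Z" "subspace Z"
  shows "(msum q1 q2, wedge \<xi>1 \<xi>2) \<in> cells (k1 + k2) Z"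
proof -
  note 1 = cellsD[OF assms(1)] and 2 = cellsD[OF assms(2)]
  have "msum q1 q2 \<subseteq> Z" using 1 2 assms(3-5) by (auto simp: msum_def intro!: subspace_add)
  thus ?thesis unfolding cells_def
    using polytope_msum[OF 1(1) 2(1)] aff_dim_msum[OF 1(3) 2(3) 1(7) 2(7)] 1(2) 2(2)
      orients_msum[OF 1(3) 2(3) 1(7) 2(7) 1(5) 1(4) 2(4)] by auto
qed

lemma facet_or_msum_left:
  assumes "(q1, \<xi>1) \<in> cells k1 X" "(q2, \<xi>2) \<in> cells k2 Y" "F facet_of q1"
  shows "facet_or (k1 + k2) (msum q1 q2) (wedge \<xi>1 \<xi>2) (msum F q2) = wedge (facet_or k1 q1 \<xi>1 F) \<xi>2"
proof -
  note 1 = cellsD[OF assms(1)] and 2 = cellsD[OF assms(2)]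
  have cell: "(msum q1 q2, wedge \<xi>1 \<xi>2) \<in> cells (k1 + k2) UNIV" by (rule msum_cell[OF assms(1,2)]) auto
  obtain \<nu> where nu: "outer_normal q1 F \<nu>" using outer_normal_exists[OF 1(8) assms(3)] .
  have F: "F \<subseteq> X" "F \<noteq> {}" using facet_of_imp_subset[OF assms(3)] 1(3) facet_dim(1)[OF assms(3)] by auto
  have nuX: "\<nu> \<in> X" using outer_normalD(1)[OF nu] directions_subset(1)[OF 1(3)] by auto
  have k1: "k1 = Suc (dim (directions F))" using facet_dim(3)[OF assms(3)] 1(5) by simp
  have inner: "\<nu> \<bullet> ((x + y) - (x' + y')) = \<nu> \<bullet> (x - x')" if "y \<in> q2" "y' \<in> q2" for x y x' y'
    using orthogonal[OF nuX] that 2(3) by (simp add: inner_add_right inner_diff_right subset_iff)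
  have n: "outer_normal (msum q1 q2) (msum F q2) \<nu>"
    unfolding outer_normal_def
  proof (intro conjI ballI)
    show "norm \<nu> = 1" by (rule outer_normalD(2)[OF nu])
    show "\<nu> \<in> directions (msum q1 q2)"
      using outer_normalD(1)[OF nu] directions_msum_Int[OF 1(3) 2(3) 1(7) 2(7)] by blast
  next
    fix u v assume "u \<in> msum F q2" "v \<in> msum F q2"
    then obtain x y x' y' where "u = x + y" "v = x' + y'" "x \<in> F" "y \<in> q2" "x' \<in> F" "y' \<in> q2"
      by (auto simp: msum_def)
    thus "\<nu> \<bullet> (u - v) = 0" using inner nu by (simp add: outer_normal_def)
  next
    fix u v assume "u \<in> msum q1 q2" "v \<in> msum F q2"
    then obtain x y x' y' where "u = x + y" "v = x' + y'" "x \<in> q1" "y \<in> q2" "x' \<in> F" "y' \<in> q2"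
      by (auto simp: msum_def)
    thus "\<nu> \<bullet> (u - v) \<le> 0" using inner nu by (simp add: outer_normal_def)
  qed
  have "orients ((k1 - 1) + k2) (msum F q2) (wedge (facet_or k1 q1 \<xi>1 F) \<xi>2)"
    using k1 facet_or_props(1)[OF assms(1,3) nu]
    by (intro orients_msum[OF F(1) 2(3) F(2) 2(7) _ _ 2(4)]) auto
  moreover have "k1 - 1 + k2 = k1 + k2 - 1" using k1 by simp
  moreover have "wedge (mvec_of \<nu>) (wedge (facet_or k1 q1 \<xi>1 F) \<xi>2) = wedge \<xi>1 \<xi>2"
    using facet_or_props(2)[OF assms(1,3) nu] by (simp flip: wedge_assoc)
  ultimately show ?thesis
    by (intro facet_or_eqI_normal[OF cell msum_facet[OF 1(3) 2(3) 1(6) 2(6) 2(7) assms(3)] n]) auto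
qed

text \<open>As for the first factor, except that the normal has to be moved past
  \<open>\<xi>1\<close>.\<close>

lemma facet_or_msum_right:
  assumes "(q1, \<xi>1) \<in> cells k1 X" "(q2, \<xi>2) \<in> cells k2 Y" "F facet_of q2"
  shows "facet_or (k1 + k2) (msum q1 q2) (wedge \<xi>1 \<xi>2) (msum q1 F) =
    (- 1) ^ k1 *\<^sub>R wedge \<xi>1 (facet_or k2 q2 \<xi>2 F)"
proof -
  interpret S: orthogonal_pair Y X by (rule swapped)
  note 1 = cellsD[OF assms(1)] and 2 = cellsD[OF assms(2)]
  have cell: "(msum q1 q2, wedge \<xi>1 \<xi>2) \<in> cells (k1 + k2) UNIV" by (rule msum_cell[OF assms(1,2)]) auto
  obtain \<nu> where nu: "outer_normal q2 F \<nu>" using outer_normal_exists[OF 2(8) assms(3)] .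
  have F: "F \<subseteq> Y" "F \<noteq> {}" using facet_of_imp_subset[OF assms(3)] 2(3) facet_dim(1)[OF assms(3)] by auto
  have nuY: "\<nu> \<in> Y" using outer_normalD(1)[OF nu] directions_subset(2)[OF 2(3)] by auto
  have k2: "k2 = Suc (dim (directions F))" using facet_dim(3)[OF assms(3)] 2(5) by simp
  have inner: "\<nu> \<bullet> ((x + y) - (x' + y')) = \<nu> \<bullet> (y - y')" if "x \<in> q1" "x' \<in> q1" for x y x' y'
    using S.orthogonal[OF nuY] that 1(3) by (simp add: inner_add_right inner_diff_right subset_iff)
  have n: "outer_normal (msum q1 q2) (msum q1 F) \<nu>"
    unfolding outer_normal_def
  proof (intro conjI ballI)
    show "norm \<nu> = 1" by (rule outer_normalD(2)[OF nu])
    show "\<nu> \<in> directions (msum q1 q2)"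
      using outer_normalD(1)[OF nu] S.directions_msum_Int[OF 2(3) 1(3) 2(7) 1(7)]
      by (auto simp: msum_commute[of q1])
  next
    fix u v assume "u \<in> msum q1 F" "v \<in> msum q1 F"
    then obtain x y x' y' where "u = x + y" "v = x' + y'" "x \<in> q1" "y \<in> F" "x' \<in> q1" "y' \<in> F"
      by (auto simp: msum_def)
    thus "\<nu> \<bullet> (u - v) = 0" using inner nu by (simp add: outer_normal_def)
  next
    fix u v assume "u \<in> msum q1 q2" "v \<in> msum q1 F"
    then obtain x y x' y' where "u = x + y" "v = x' + y'" "x \<in> q1" "y \<in> q2" "x' \<in> q1" "y' \<in> F"
      by (auto simp: msum_def)
    thus "\<nu> \<bullet> (u - v) \<le> 0" using inner nu by (simp add: outer_normal_def)
  qed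
  let ?\<eta> = "wedge \<xi>1 (facet_or k2 q2 \<xi>2 F)"
  have "orients (k1 + (k2 - 1)) (msum q1 F) ?\<eta>"
    using facet_or_props(1)[OF assms(2,3) nu]
    by (intro orients_msum[OF 1(3) F(1) 1(7) F(2) 1(5) 1(4)]) auto
  moreover have "k1 + (k2 - 1) = k1 + k2 - 1" using k2 by simp
  ultimately have "orients (k1 + k2 - 1) (msum q1 F) ((- 1) ^ k1 *\<^sub>R ?\<eta>)"
    using orients_minus[of "k1 + k2 - 1" "msum q1 F" ?\<eta>] by (cases "even k1") auto
  moreover have "wedge (mvec_of \<nu>) ((- 1) ^ k1 *\<^sub>R ?\<eta>) = wedge \<xi>1 \<xi>2"
    using facet_or_props(2)[OF assms(2,3) nu] wedge_orientations_commute[OF 1(4), of \<nu>]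
    by (simp flip: power_add mult_2)
  moreover have "msum q1 F facet_of msum q1 q2"
    using S.msum_facet[OF 2(3) 1(3) 2(6) 1(6) 1(7) assms(3)] by (simp add: msum_commute[of q1])
  ultimately show ?thesis by (intro facet_or_eqI_normal[OF cell _ n])
qed

text \<open>The Leibniz rule for a product cell. No facet is counted twice, because only those
  coming from the first factor have fewer directions in \<open>X\<close>.\<close>

lemma sum_bd_cells_msum:
  assumes "(q1, \<xi>1) \<in> cells k1 X" "(q2, \<xi>2) \<in> cells k2 Y"
  shows "(\<Sum>p\<in>bd_cells (k1 + k2) (msum q1 q2, wedge \<xi>1 \<xi>2). f p) =
     (\<Sum>p\<in>bd_cells k1 (q1, \<xi>1). f (msum (fst p) q2, wedge (snd p) \<xi>2)) +
     (\<Sum>p\<in>bd_cells k2 (q2, \<xi>2). f (msum q1 (fst p), (- 1) ^ k1 *\<^sub>R wedge \<xi>1 (snd p)))"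
proof -
  interpret S: orthogonal_pair Y X by (rule swapped)
  note 1 = cellsD[OF assms(1)] and 2 = cellsD[OF assms(2)]
  have cell: "(msum q1 q2, wedge \<xi>1 \<xi>2) \<in> cells (k1 + k2) UNIV" by (rule msum_cell[OF assms]) auto
  let ?A = "{F. F facet_of q1}" and ?B = "{F. F facet_of q2}"
  have fin: "finite ?A" "finite ?B" using finite_facets assms by blast+
  have sub1: "F \<subseteq> X" "F \<noteq> {}" if "F facet_of q1" for F
    using facet_of_imp_subset[OF that] 1(3) facet_dim(1)[OF that] by auto
  have sub2: "F \<subseteq> Y" "F \<noteq> {}" if "F facet_of q2" for F
    using facet_of_imp_subset[OF that] 2(3) facet_dim(1)[OF that] by auto
  have inj1: "inj_on (\<lambda>F. msum F q2) ?A"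
    using inj_msum[OF _ _ 2(3,7)] sub1 by (intro inj_onI) (simp add: subset_antisym)
  have inj2: "inj_on (msum q1) ?B"
    using S.inj_msum[OF _ _ 1(3,7)] sub2 by (intro inj_onI) (simp add: subset_antisym msum_commute[of q1])
  have "msum F q2 \<noteq> msum q1 F'" if F: "F facet_of q1" "F' facet_of q2" for F F'
  proof
    assume "msum F q2 = msum q1 F'"
    hence "directions F = directions q1"
      using directions_msum_Int[OF sub1(1)[OF F(1)] 2(3) sub1(2)[OF F(1)] 2(7)]
        directions_msum_Int[OF 1(3) sub2(1)[OF F(2)] 1(7) sub2(2)[OF F(2)]] by simp
    thus False using facet_dim(3)[OF F(1)] by simp
  qed
  hence disj: "(\<lambda>F. msum F q2) ` ?A \<inter> msum q1 ` ?B = {}" by auto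
  show ?thesis
    unfolding sum_bd_cells[OF cell] sum_bd_cells[OF assms(1)] sum_bd_cells[OF assms(2)]
      facets_msum[OF 1(3) 2(3) 1(6) 2(6) 1(7) 2(7)]
    using fin disj by (subst sum.union_disjoint)
      (auto simp: sum.reindex[OF inj1] sum.reindex[OF inj2] facet_or_msum_left[OF assms]
        facet_or_msum_right[OF assms] intro!: arg_cong2[of _ _ _ _ "(+)"] sum.cong)
qed

end

subsection \<open>Ridges of a polytope\<close>

text \<open>In the plane orthogonal to the ridge \<open>G\<close>, with orthonormal basis \<open>\<nu>1, \<mu>1\<close>, the cone of \<open>q\<close> lies on
  the side \<open>\<mu>1 \<le> 0\<close> along \<open>F1\<close>, which forces \<open>b > 0\<close>.\<close>

lemma ridge_normal:
  assumes "convex q" "F1 facet_of q" "G facet_of F1" "outer_normal q F1 \<nu>1" "outer_normal F1 G \<mu>1"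
    and "F facet_of q" "F \<noteq> F1" "G \<subseteq> F" "outer_normal q F \<nu>"
  obtains a b where "b > 0" "a\<^sup>2 + b\<^sup>2 = 1" "\<nu> = a *\<^sub>R \<nu>1 + b *\<^sub>R \<mu>1"
proof -
  note nu = outer_normalD[OF assms(9)] and nu1 = outer_normalD[OF assms(4)] and mu1 = outer_normalD[OF assms(5)]
  define a where "a = \<nu>1 \<bullet> \<nu>"
  define w where "w = \<nu> - a *\<^sub>R \<nu>1"
  have w: "w \<in> directions F1"
    unfolding w_def a_def
    by (rule facet_decompose[OF assms(2) nu1 outer_normal_orthogonal[OF assms(4)] nu(1)])
  define b where "b = \<mu>1 \<bullet> w"
  define r where "r = w - b *\<^sub>R \<mu>1"
  have r: "r \<in> directions G"
    unfolding r_def b_def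
    by (rule facet_decompose[OF assms(3) mu1 outer_normal_orthogonal[OF assms(5)] w])
  have sub: "directions G \<subseteq> directions F" "directions G \<subseteq> directions F1"
    using directions_mono[OF assms(8)] facet_dim(4)[OF assms(3)] by auto
  have rr: "\<nu> \<bullet> r = 0" "\<nu>1 \<bullet> r = 0" "\<mu>1 \<bullet> r = 0"
    using r sub outer_normal_orthogonal[OF assms(9)] outer_normal_orthogonal[OF assms(4)]
      outer_normal_orthogonal[OF assms(5)] by auto
  have r': "r = \<nu> - a *\<^sub>R \<nu>1 - b *\<^sub>R \<mu>1" by (simp add: r_def w_def)
  have "r \<bullet> r = \<nu> \<bullet> r - a * (\<nu>1 \<bullet> r) - b * (\<mu>1 \<bullet> r)"
    by (subst (1) r') (simp add: inner_diff_left)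
  hence "r = 0" using rr by simp
  hence eq: "\<nu> = a *\<^sub>R \<nu>1 + b *\<^sub>R \<mu>1" using r' by (simp add: algebra_simps)
  have orth: "\<nu>1 \<bullet> \<mu>1 = 0" by (rule outer_normal_orthogonal[OF assms(4) mu1(1)])
  hence orth': "\<mu>1 \<bullet> \<nu>1 = 0" by (simp add: inner_commute)
  have n: "\<nu> \<bullet> \<nu> = 1" "\<nu>1 \<bullet> \<nu>1 = 1" "\<mu>1 \<bullet> \<mu>1 = 1" using nu nu1 mu1 by (simp_all add: norm_eq_1)
  have "\<nu> \<bullet> \<nu> = a\<^sup>2 + b\<^sup>2"
    unfolding eq using orth orth' n(2,3)
    by (simp add: inner_add_left inner_add_right power2_eq_square)
  hence ab: "a\<^sup>2 + b\<^sup>2 = 1" using n by simp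
  obtain y where y: "y \<in> G" using facet_dim(1)[OF assms(3)] by auto
  have yF: "y \<in> F" "y \<in> F1" using y assms(8) facet_of_imp_subset[OF assms(3)] by auto
  obtain z where z: "z \<in> F1" "\<mu>1 \<bullet> z < \<mu>1 \<bullet> y" using outer_normal_strict[OF assms(5) y] by blast
  have "\<nu> \<bullet> z \<le> \<nu> \<bullet> y"
    using facet_of_imp_subset[OF assms(2)] z by (intro outer_normal_le[OF assms(9) _ yF(1)]) auto
  moreover have "\<nu>1 \<bullet> z = \<nu>1 \<bullet> y" by (rule outer_normal_eq[OF assms(4) z(1) yF(2)])
  ultimately have "b * (\<mu>1 \<bullet> z) \<le> b * (\<mu>1 \<bullet> y)" unfolding eq by (simp add: inner_add_left)
  hence "b \<ge> 0" using z(2) by (smt (verit) mult_less_cancel_left_neg)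
  moreover have "b \<noteq> 0"
  proof
    assume b: "b = 0"
    hence "a = 1 \<or> a = - 1" using ab by (simp add: power2_eq_1_iff)
    hence "\<nu> = \<nu>1 \<or> \<nu> = - \<nu>1" using eq b by auto
    thus False
    proof
      assume "\<nu> = \<nu>1"
      thus False
        using facet_eq_outer_normal[OF assms(1,6,9) yF(1)] facet_eq_outer_normal[OF assms(1,2,4) yF(2)] assms(7)
        by simp
    next
      assume m: "\<nu> = - \<nu>1"
      obtain z where "z \<in> q" "\<nu>1 \<bullet> z < \<nu>1 \<bullet> y" using outer_normal_strict[OF assms(4) yF(2)] by blast
      thus False using outer_normal_le[OF assms(9) _ yF(1), of z] m by simp
    qed
  qed
  ultimately have "b > 0" by simp
  thus ?thesis using that ab eq by blast
qed

text \<open>By \<open>ridge_normal\<close>, the normals in question lie on an open half circle in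
  the plane of \<open>\<nu>1\<close> and \<open>\<mu>1\<close>, where the quotient
  \<open>a / b\<close> is a coordinate. Equal quotients give equal normals, hence equal
  facets.\<close>

lemma ridge_facet_unique:
  assumes "convex q" "F1 facet_of q" "G facet_of F1" "outer_normal q F1 \<nu>1" "outer_normal F1 G \<mu>1"
    and F: "F facet_of q" "F \<noteq> F1" "G \<subseteq> F" "outer_normal q F \<nu>"
    and F': "F' facet_of q" "F' \<noteq> F1" "G \<subseteq> F'" "outer_normal q F' \<nu>'"
  shows "F' = F"
proof -
  obtain y where y: "y \<in> G" using facet_dim(1)[OF assms(3)] by auto
  have y1: "y \<in> F1" using y facet_of_imp_subset[OF assms(3)] by auto
  \<comment> \<open>The normal with the larger quotient is a positive combination of the other one
    and of \<open>\<nu>1\<close>. Equality in its inequality forces equality in both others, so its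
    facet is contained in \<open>F1\<close>.\<close>
  have less: False
    if "F facet_of q" "F' facet_of q" "F' \<noteq> F1" "y \<in> F" "y \<in> F'" "outer_normal q F \<nu>" "outer_normal q F' \<nu>'"
      "b > 0" "\<nu> = a *\<^sub>R \<nu>1 + b *\<^sub>R \<mu>1" "b' > 0" "\<nu>' = a' *\<^sub>R \<nu>1 + b' *\<^sub>R \<mu>1" "a / b < a' / b'"
    for F F' \<nu> \<nu>' a b a' b'
  proof -
    define s where "s = a' / b' - a / b"
    have s: "s > 0" using that by (simp add: s_def)
    have nu': "\<nu>' = b' *\<^sub>R ((1 / b) *\<^sub>R \<nu> + s *\<^sub>R \<nu>1)"
      using that(8,10) by (simp add: that(9,11) s_def algebra_simps)
    have "F' \<subseteq> F1"
    proof
      fix x assume x: "x \<in> F'"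
      have xq: "x \<in> q" using x facet_of_imp_subset[OF that(2)] by auto
      have 1: "\<nu> \<bullet> x - \<nu> \<bullet> y \<le> 0" using outer_normal_le[OF that(6) xq that(4)] by simp
      have 2: "\<nu>1 \<bullet> x - \<nu>1 \<bullet> y \<le> 0" using outer_normal_le[OF assms(4) xq y1] by simp
      have "\<nu>' \<bullet> x = \<nu>' \<bullet> y" by (rule outer_normal_eq[OF that(7) x that(5)])
      hence "b' * ((1 / b) * (\<nu> \<bullet> x - \<nu> \<bullet> y) + s * (\<nu>1 \<bullet> x - \<nu>1 \<bullet> y)) = 0"
        unfolding nu' by (simp add: inner_add_left algebra_simps)
      hence "(1 / b) * (\<nu> \<bullet> x - \<nu> \<bullet> y) + s * (\<nu>1 \<bullet> x - \<nu>1 \<bullet> y) = 0"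
        using that(10) by simp
      moreover have "(1 / b) * (\<nu> \<bullet> x - \<nu> \<bullet> y) \<le> 0" using 1 that(8) by (intro mult_nonneg_nonpos) auto
      moreover have "s * (\<nu>1 \<bullet> x - \<nu>1 \<bullet> y) \<le> 0" using 2 s by (intro mult_nonneg_nonpos) auto
      ultimately have "s * (\<nu>1 \<bullet> x - \<nu>1 \<bullet> y) = 0" by linarith
      hence "\<nu>1 \<bullet> x = \<nu>1 \<bullet> y" using s by simp
      thus "x \<in> F1" using facet_eq_outer_normal[OF assms(1,2,4) y1] xq by auto
    qed
    moreover have "F' face_of F1"
      using face_of_subset[OF facet_of_imp_face_of[OF that(2)] calculation facet_of_imp_subset[OF assms(2)]] .
    moreover have "aff_dim F' = aff_dim F1" using assms(2) that(2) by (simp add: facet_of_def)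
    ultimately show False
      using face_of_aff_dim_lt[of F1 F'] face_of_imp_convex[OF facet_of_imp_face_of[OF assms(2)]] that(3) by simp
  qed
  obtain a b where ab: "b > 0" "a\<^sup>2 + b\<^sup>2 = 1" "\<nu> = a *\<^sub>R \<nu>1 + b *\<^sub>R \<mu>1"
    using ridge_normal[OF assms(1-5) F] .
  obtain a' b' where ab': "b' > 0" "a'\<^sup>2 + b'\<^sup>2 = 1" "\<nu>' = a' *\<^sub>R \<nu>1 + b' *\<^sub>R \<mu>1"
    using ridge_normal[OF assms(1-5) F'] .
  have yF: "y \<in> F" "y \<in> F'" using y F F' by auto
  define t where "t = a / b"
  have "a / b = a' / b'"
    using less[OF F(1) F'(1,2) yF F(4) F'(4) ab(1,3) ab'(1,3)]
      less[OF F'(1) F(1,2) yF(2,1) F'(4) F(4) ab'(1,3) ab(1,3)] by argo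
  hence t': "t = a' / b'" by (simp add: t_def)
  have t: "a = t * b" using ab(1) by (simp add: t_def)
  moreover have "a' = t * b'" using ab'(1) by (simp add: t')
  ultimately have t: "a = t * b" "a' = t * b'" .
  have "(t\<^sup>2 + 1) * b\<^sup>2 = (t\<^sup>2 + 1) * b'\<^sup>2"
    using ab(2) ab'(2) unfolding t by (simp add: power_mult_distrib algebra_simps)
  moreover have "t\<^sup>2 + 1 > 0" by (rule add_nonneg_pos) auto
  ultimately have "b\<^sup>2 = b'\<^sup>2" by simp
  hence "b = b'" using ab(1) ab'(1) by (simp add: power2_eq_iff)
  hence "\<nu>' = \<nu>" using ab(3) ab'(3) t by simp
  thus ?thesis
    using facet_eq_outer_normal[OF assms(1) F(1,4) yF(1)] facet_eq_outer_normal[OF assms(1) F'(1,4) yF(2)] by simp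
qed

text \<open>A second facet exists because a proper face of a polyhedron is the intersection of the
  facets containing it, and \<open>G\<close> is smaller than \<open>F1\<close>. The outer normal of
  \<open>G\<close> in the second facet is found in the plane of \<open>\<nu>1\<close> and
  \<open>\<mu>1\<close>.\<close>

lemma ridge_facets:
  assumes cell: "(q, \<xi>) \<in> cells k X" and F1: "F1 facet_of q" and G: "G facet_of F1"
  obtains F2 where "F2 \<noteq> F1" "{F. F facet_of q \<and> G facet_of F} = {F1, F2}"
    "facet_or (k - 1) F2 (facet_or k q \<xi> F2) G = - facet_or (k - 1) F1 (facet_or k q \<xi> F1) G"
proof -
  note q = cellsD[OF cell]
  have G1: "G \<subseteq> F1" by (rule facet_of_imp_subset[OF G])
  have Gq: "G face_of q" by (rule face_of_trans[OF facet_of_imp_face_of[OF G] facet_of_imp_face_of[OF F1]])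
  have dimG: "aff_dim G = aff_dim q - 2" using F1 G by (simp add: facet_of_def)
  have facetG: "G facet_of F" if "F facet_of q" "G \<subseteq> F" for F
    using that face_of_subset[OF Gq that(2) facet_of_imp_subset[OF that(1)]] dimG facet_dim(1)[OF G]
    by (simp add: facet_of_def)
  have "G \<noteq> F1" using G by auto
  moreover have "G = \<Inter>{F. F facet_of q \<and> G \<subseteq> F}"
    using dimG facet_dim(1)[OF G] by (intro face_of_polyhedron[OF q(8) Gq]) auto
  ultimately obtain F2 where F2: "F2 facet_of q" "G \<subseteq> F2" "F2 \<noteq> F1"
    using F1 G1 by (metis (mono_tags, lifting) Inter_greatest mem_Collect_eq order_antisym order_refl)
  obtain \<nu>1 where nu1: "outer_normal q F1 \<nu>1" using outer_normal_exists[OF q(8) F1] .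
  obtain \<nu>2 where nu2: "outer_normal q F2 \<nu>2" using outer_normal_exists[OF q(8) F2(1)] .
  have cell1: "(F1, facet_or k q \<xi> F1) \<in> cells (k - 1) X" by (rule facet_cell(1)[OF cell F1])
  obtain \<mu>1 where mu1: "outer_normal F1 G \<mu>1" using outer_normal_exists[OF cellsD(8)[OF cell1] G] .
  have set: "{F. F facet_of q \<and> G facet_of F} = {F1, F2}"
  proof (intro equalityI subsetI)
    fix F assume "F \<in> {F. F facet_of q \<and> G facet_of F}"
    hence F: "F facet_of q" "G \<subseteq> F" using facet_of_imp_subset by auto
    obtain \<nu> where nu: "outer_normal q F \<nu>" using outer_normal_exists[OF q(8) F(1)] .
    show "F \<in> {F1, F2}"
      using ridge_facet_unique[OF q(6) F1 G nu1 mu1 F2(1,3,2) nu2 F(1) _ F(2) nu] by blast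
  next
    fix F assume "F \<in> {F1, F2}"
    thus "F \<in> {F. F facet_of q \<and> G facet_of F}" using F1 F2 G facetG by auto
  qed
  obtain a b where ab: "b > 0" "a\<^sup>2 + b\<^sup>2 = 1" "\<nu>2 = a *\<^sub>R \<nu>1 + b *\<^sub>R \<mu>1"
    using ridge_normal[OF q(6) F1 G nu1 mu1 F2(1,3,2) nu2] .
  have G2: "G facet_of F2" by (rule facetG[OF F2(1,2)])
  \<comment> \<open>The unit vector orthogonal to \<open>\<nu>2\<close> in that plane, with the sign
    for which it points out of \<open>F2\<close>. The pair \<open>\<nu>2\<close>,
    \<open>\<mu>2\<close> is then oriented oppositely to \<open>\<nu>1\<close>,
    \<open>\<mu>1\<close>, which produces the minus sign.\<close>
  define \<mu>2 where "\<mu>2 = b *\<^sub>R \<nu>1 - a *\<^sub>R \<mu>1"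
  have orth: "\<nu>1 \<bullet> \<mu>1 = 0" by (rule outer_normal_orthogonal[OF nu1 outer_normalD(1)[OF mu1]])
  hence orth': "\<mu>1 \<bullet> \<nu>1 = 0" by (simp add: inner_commute)
  have n: "\<nu>1 \<bullet> \<nu>1 = 1" "\<mu>1 \<bullet> \<mu>1 = 1" using outer_normalD(2)[OF nu1] outer_normalD(2)[OF mu1]
    by (simp_all add: norm_eq_1)
  have mu2_dir: "\<mu>2 \<in> directions q"
    unfolding \<mu>2_def
    by (intro subspace_diff[OF subspace_directions] subspace_scale[OF subspace_directions]
      outer_normalD(1)[OF nu1] subsetD[OF facet_dim(4)[OF F1] outer_normalD(1)[OF mu1]])
  have "\<mu>2 \<bullet> \<mu>2 = 1"
    unfolding \<mu>2_def using orth orth' n ab(2)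
    by (simp add: inner_diff_left inner_diff_right power2_eq_square)
  hence mu2_norm: "norm \<mu>2 = 1" by (simp add: norm_eq_1)
  have perp: "\<nu>2 \<bullet> \<mu>2 = 0"
    unfolding \<mu>2_def ab(3) using orth orth' n
    by (simp add: inner_diff_right inner_add_left)
  have "\<mu>2 - (\<nu>2 \<bullet> \<mu>2) *\<^sub>R \<nu>2 \<in> directions F2"
    by (rule facet_decompose[OF F2(1) outer_normalD[OF nu2] outer_normal_orthogonal[OF nu2] mu2_dir])
  hence mu2_F2: "\<mu>2 \<in> directions F2" unfolding perp by simp
  have mu2: "outer_normal F2 G \<mu>2"
    unfolding outer_normal_def
  proof (intro conjI ballI)
    fix x y assume xy: "x \<in> G" "y \<in> G"
    have "\<nu>1 \<bullet> x = \<nu>1 \<bullet> y" by (rule outer_normal_eq[OF nu1]) (use xy G1 in auto)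
    moreover have "\<mu>1 \<bullet> x = \<mu>1 \<bullet> y" by (rule outer_normal_eq[OF mu1 xy])
    ultimately show "\<mu>2 \<bullet> (x - y) = 0" by (simp add: \<mu>2_def inner_diff_left inner_diff_right)
  next
    fix x y assume xy: "x \<in> F2" "y \<in> G"
    define u where "u = \<nu>1 \<bullet> (x - y)"
    define v where "v = \<mu>1 \<bullet> (x - y)"
    have "\<nu>1 \<bullet> x \<le> \<nu>1 \<bullet> y" using outer_normal_le[OF nu1, of x y] xy G1 facet_of_imp_subset[OF F2(1)] by auto
    hence u: "u \<le> 0" by (simp add: u_def inner_diff_right)
    have "\<nu>2 \<bullet> x = \<nu>2 \<bullet> y" by (rule outer_normal_eq[OF nu2 xy(1)]) (use xy F2(2) in auto)
    hence "\<nu>2 \<bullet> (x - y) = 0" by (simp add: inner_diff_right)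
    hence uv: "a * u + b * v = 0" by (simp add: ab(3) inner_add_left u_def v_def)
    \<comment> \<open>Multiplication by the positive number \<open>b\<close> allows \<open>v\<close>
      to be eliminated with \<open>uv\<close>.\<close>
    have "b * (b * u - a * v) = b\<^sup>2 * u - a * (b * v)" by (simp add: power2_eq_square algebra_simps)
    also have "b * v = - (a * u)" using uv by simp
    also have "b\<^sup>2 * u - a * - (a * u) = (a\<^sup>2 + b\<^sup>2) * u" by (simp add: power2_eq_square algebra_simps)
    finally have "b * (b * u - a * v) = u" using ab(2) by simp
    hence "b * u - a * v \<le> 0" using u ab(1) by (metis mult_pos_pos not_le)
    thus "\<mu>2 \<bullet> (x - y) \<le> 0" by (simp add: \<mu>2_def inner_diff_left u_def v_def)
  qed (use mu2_norm mu2_F2 in auto)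
  define \<eta> where "\<eta> = facet_or (k - 1) F1 (facet_or k q \<xi> F1) G"
  have eta: "orients (k - 1 - 1) G \<eta>" "wedge (mvec_of \<mu>1) \<eta> = facet_or k q \<xi> F1"
    using facet_or_props[OF cell1 G mu1] by (simp_all add: \<eta>_def)
  hence xi: "wedge (mvec_of \<nu>1) (wedge (mvec_of \<mu>1) \<eta>) = \<xi>"
    using facet_or_props(2)[OF cell F1 nu1] by simp
  have k: "k - 1 = Suc (k - 1 - 1)" using facet_dim(3)[OF G] cellsD(5)[OF cell1] by simp
  have "orients (Suc (k - 1 - 1)) F2 (wedge (mvec_of \<mu>2) (- \<eta>))"
    by (rule orients_wedge_normal[OF orients_minus[OF eta(1)] facet_dim(4)[OF G2] mu2_F2 mu2_norm
          outer_normal_orthogonal[OF mu2]])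
  hence o2: "orients (k - 1) F2 (wedge (mvec_of \<mu>2) (- \<eta>))" using k by simp
  have "wedge (mvec_of \<nu>2) (wedge (mvec_of \<mu>2) \<eta>) =
      (a * b) *\<^sub>R wedge (mvec_of \<nu>1) (wedge (mvec_of \<nu>1) \<eta>)
      - (a * a) *\<^sub>R wedge (mvec_of \<nu>1) (wedge (mvec_of \<mu>1) \<eta>)
      + ((b * b) *\<^sub>R wedge (mvec_of \<mu>1) (wedge (mvec_of \<nu>1) \<eta>)
      - (a * b) *\<^sub>R wedge (mvec_of \<mu>1) (wedge (mvec_of \<mu>1) \<eta>))"
  proof -
    have diff: "wedge (\<alpha> - \<beta>) \<gamma> = wedge \<alpha> \<gamma> - wedge \<beta> \<gamma>" "wedge \<gamma> (\<alpha> - \<beta>) = wedge \<gamma> \<alpha> - wedge \<gamma> \<beta>"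
      for \<alpha> \<beta> \<gamma> :: "'a mvec"
      using wedge_add_left[of \<alpha> "- \<beta>" \<gamma>] wedge_add_right[of \<gamma> \<alpha> "- \<beta>"] by simp_all
    show ?thesis
      by (simp add: ab(3) \<mu>2_def mvec_of_add mvec_of_diff mvec_of_scaleR wedge_add_left diff
          scaleR_diff_right mult.commute[of b a])
  qed
  also have "\<dots> = - ((a * a + b * b) *\<^sub>R \<xi>)"
    unfolding wedge_mvec_anticommute[of \<mu>1 \<nu>1] xi by (simp add: scaleR_add_left)
  finally have "wedge (mvec_of \<nu>2) (wedge (mvec_of \<mu>2) (- \<eta>)) = \<xi>"
    using ab(2) by (simp add: power2_eq_square)
  hence f2: "facet_or k q \<xi> F2 = wedge (mvec_of \<mu>2) (- \<eta>)"
    by (rule facet_or_eqI_normal[OF cell F2(1) nu2 o2])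
  have cell2: "(F2, wedge (mvec_of \<mu>2) (- \<eta>)) \<in> cells (k - 1) X"
    using facet_cell(1)[OF cell F2(1)] f2 by simp
  have "facet_or (k - 1) F2 (facet_or k q \<xi> F2) G = - \<eta>"
    unfolding f2 by (rule facet_or_eqI_normal[OF cell2 G2 mu2 orients_minus[OF eta(1)]]) simp
  thus ?thesis using that F2(3) set \<eta>_def by blast
qed

text \<open>The double sum is reordered by ridges, each of which receives opposite orientations from
  its two facets. The abstract odd \<open>f\<close> allows the other factor of a product to be kept
  fixed.\<close>

lemma sum_bd_cells_bd_cells:
  fixes f :: "'n::{finite,linorder} cell \<Rightarrow> 'a::ab_group_add"
  assumes cell: "p \<in> cells k X"
    and odd: "\<And>F \<eta>. (F, \<eta>) \<in> cells (k - 1 - 1) X \<Longrightarrow> f (F, - \<eta>) = - f (F, \<eta>)"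
  shows "(\<Sum>p'\<in>bd_cells k p. \<Sum>p''\<in>bd_cells (k - 1) p'. f p'') = 0"
proof -
  obtain q \<xi> where p: "p = (q, \<xi>)" by (cases p)
  have cell: "(q, \<xi>) \<in> cells k X" using cell p by simp
  let ?o = "\<lambda>F G. facet_or (k - 1) F (facet_or k q \<xi> F) G"
  let ?R = "{G. \<exists>F. F facet_of q \<and> G facet_of F}"
  have fin: "finite {F. F facet_of q}" by (rule finite_facets[OF cell])
  have fin': "finite {G. G facet_of F}" if "F facet_of q" for F
    using finite_facets[OF facet_cell(1)[OF cell that]] .
  have "?R = (\<Union>F\<in>{F. F facet_of q}. {G. G facet_of F})" by auto
  hence finR: "finite ?R" using fin fin' by auto
  have "(\<Sum>p'\<in>bd_cells k p. \<Sum>p''\<in>bd_cells (k - 1) p'. f p'') =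
    (\<Sum>F | F facet_of q. \<Sum>G | G facet_of F. f (G, ?o F G))"
    unfolding p sum_bd_cells[OF cell]
    by (rule sum.cong[OF refl], rule sum_bd_cells[OF facet_cell(1)[OF cell]]) simp
  also have "\<dots> = (\<Sum>F | F facet_of q. \<Sum>G | G \<in> ?R \<and> G facet_of F. f (G, ?o F G))"
    by (intro sum.cong refl) auto
  also have "\<dots> = (\<Sum>G\<in>?R. \<Sum>F | F \<in> {F. F facet_of q} \<and> G facet_of F. f (G, ?o F G))"
    by (rule sum.swap_restrict[OF fin finR])
  also have "\<dots> = 0"
  proof (rule sum.neutral, rule ballI)
    fix G assume "G \<in> ?R"
    then obtain F1 where F1: "F1 facet_of q" "G facet_of F1" by auto
    obtain F2 where F2: "F2 \<noteq> F1" "{F. F facet_of q \<and> G facet_of F} = {F1, F2}" "?o F2 G = - ?o F1 G"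
      using ridge_facets[OF cell F1] .
    have "(G, ?o F1 G) \<in> cells (k - 1 - 1) X"
      by (rule facet_cell(1)[OF facet_cell(1)[OF cell F1(1)] F1(2)])
    hence "f (G, ?o F2 G) = - f (G, ?o F1 G)" unfolding F2(3) by (rule odd)
    thus "(\<Sum>F | F \<in> {F. F facet_of q} \<and> G facet_of F. f (G, ?o F G)) = 0"
      using F2(1,2) by simp
  qed
  finally show ?thesis .
qed


subsection \<open>Additive extension to formal sums\<close>

text \<open>The extension of a family of maps on coefficients to formal sums; it is a group
  homomorphism when every member is additive.\<close>

definition lin :: "('k \<Rightarrow> 'b::ab_group_add \<Rightarrow> 'c::ab_group_add) \<Rightarrow> ('k \<Rightarrow>\<^sub>0 'b) \<Rightarrow> 'c" where
  "lin h S = (\<Sum>k\<in>Poly_Mapping.keys S. h k (Poly_Mapping.lookup S k))"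

definition additive_family :: "('k \<Rightarrow> 'b::ab_group_add \<Rightarrow> 'c::ab_group_add) \<Rightarrow> bool" where
  "additive_family h \<longleftrightarrow> (\<forall>k a b. h k (a + b) = h k a + h k b)"

lemma additive_family_add: "additive_family h \<Longrightarrow> h k (a + b) = h k a + h k b"
  by (simp add: additive_family_def)

lemma additive_family_zero: "additive_family h \<Longrightarrow> h k 0 = 0"
  using additive_family_add[of h k 0 0] by simp

lemma lin_superset:
  assumes "additive_family h" "finite A" "Poly_Mapping.keys S \<subseteq> A"
  shows "lin h S = (\<Sum>k\<in>A. h k (Poly_Mapping.lookup S k))"
  unfolding lin_def
  using assms additive_family_zero[OF assms(1)]
  by (intro sum.mono_neutral_left) (auto simp: in_keys_iff)

lemma lin_add:
  assumes "additive_family h"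
  shows "lin h (S + T) = lin h S + lin h T"
proof -
  let ?A = "Poly_Mapping.keys S \<union> Poly_Mapping.keys T"
  have "lin h (S + T) = (\<Sum>k\<in>?A. h k (Poly_Mapping.lookup (S + T) k))"
    by (rule lin_superset[OF assms]) (simp_all add: Poly_Mapping.keys_add)
  also have "\<dots> = (\<Sum>k\<in>?A. h k (Poly_Mapping.lookup S k)) + (\<Sum>k\<in>?A. h k (Poly_Mapping.lookup T k))"
    by (simp add: lookup_add additive_family_add[OF assms] sum.distrib)
  also have "\<dots> = lin h S + lin h T"
    using lin_superset[OF assms, of ?A S] lin_superset[OF assms, of ?A T] by simp
  finally show ?thesis .
qed

lemma lin_zero [simp]: "lin h 0 = 0"
  by (simp add: lin_def)

lemma lin_minus: "additive_family h \<Longrightarrow> lin h (- S) = - lin h S"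
  using lin_add[of h S "- S"] by (simp add: minus_unique)

lemma lin_diff: "additive_family h \<Longrightarrow> lin h (S - T) = lin h S - lin h T"
  using lin_add[of h S "- T"] lin_minus[of h T] by simp

lemma lin_sum: "additive_family h \<Longrightarrow> lin h (sum S A) = (\<Sum>a\<in>A. lin h (S a))"
  by (induction A rule: infinite_finite_induct) (simp_all add: lin_add)

lemma lin_single: "additive_family h \<Longrightarrow> lin h (Poly_Mapping.single k g) = h k g"
  by (simp add: lin_def additive_family_zero)

lemma lin_lin: "additive_family h \<Longrightarrow> lin h (lin f T) = lin (\<lambda>k g. lin h (f k g)) T"
  by (simp add: lin_def[of f] lin_def[of "\<lambda>k g. lin h (f k g)"] lin_sum)

lemma lin_cong:
  "(\<And>k g. k \<in> Poly_Mapping.keys T \<Longrightarrow> f k g = h k g) \<Longrightarrow> lin f T = lin h T"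
  by (simp add: lin_def)

lemma keys_lin:
  "Poly_Mapping.keys (lin f T) \<subseteq> (\<Union>k\<in>Poly_Mapping.keys T. Poly_Mapping.keys (f k (Poly_Mapping.lookup T k)))"
proof
  fix x assume "x \<in> Poly_Mapping.keys (lin f T)"
  hence "(\<Sum>k\<in>Poly_Mapping.keys T. Poly_Mapping.lookup (f k (Poly_Mapping.lookup T k)) x) \<noteq> 0"
    by (simp add: in_keys_iff lin_def lookup_sum)
  then obtain k where "k \<in> Poly_Mapping.keys T" "Poly_Mapping.lookup (f k (Poly_Mapping.lookup T k)) x \<noteq> 0"
    by (meson sum.not_neutral_contains_not_neutral)
  thus "x \<in> (\<Union>k\<in>Poly_Mapping.keys T. Poly_Mapping.keys (f k (Poly_Mapping.lookup T k)))"
    by (auto simp: in_keys_iff)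
qed

lemma keys_sum_singles:
  "Poly_Mapping.keys (\<Sum>a\<in>A. Poly_Mapping.single (\<phi> a) g) \<subseteq> \<phi> ` A"
proof
  fix x assume "x \<in> Poly_Mapping.keys (\<Sum>a\<in>A. Poly_Mapping.single (\<phi> a) g)"
  hence "(\<Sum>a\<in>A. Poly_Mapping.lookup (Poly_Mapping.single (\<phi> a) g) x) \<noteq> 0"
    by (simp add: in_keys_iff lookup_sum)
  then obtain a where "a \<in> A" "Poly_Mapping.lookup (Poly_Mapping.single (\<phi> a) g) x \<noteq> 0"
    by (meson sum.not_neutral_contains_not_neutral)
  thus "x \<in> \<phi> ` A" by (auto simp: lookup_single when_def split: if_splits)
qed

lemma keys_minus_subset: "Poly_Mapping.keys (S - T) \<subseteq> Poly_Mapping.keys S \<union> Poly_Mapping.keys (T :: 'k \<Rightarrow>\<^sub>0 'b::ab_group_add)"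
  by (auto simp: in_keys_iff lookup_minus)

text \<open>The one-element index type \<open>unit\<close> lets the notion for families express
  additivity of a single map.\<close>

lemma additive_family_sum:
  assumes "\<And>k j. additive_family (\<lambda>_ :: unit. f k j)"
  shows "additive_family (\<lambda>k g. \<Sum>j\<in>J k. f k j g)"
  using assms by (auto simp: additive_family_def sum.distrib)

lemma additive_single: "additive_family (\<lambda>_ :: unit. Poly_Mapping.single k)"
  by (simp add: additive_family_def single_add)


subsection \<open>Elementary chains\<close>

lemma chain_of_add: "chain_of (S + T) = chain_of S + chain_of T"
  by (simp add: plus_pchain.abs_eq)

lemma chain_of_diff: "chain_of (S - T) = chain_of S - chain_of T"
  by (simp add: minus_pchain.abs_eq)

lemma chain_of_minus: "chain_of (- S) = - chain_of S"
  by (simp add: uminus_pchain.abs_eq)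

lemma chain_of_zero: "chain_of 0 = 0"
  by (simp add: zero_pchain.abs_eq)

lemma chain_of_sum: "chain_of (sum S A) = (\<Sum>a\<in>A. chain_of (S a))"
  by (induction A rule: infinite_finite_induct) (simp_all add: chain_of_add chain_of_zero)

lemma chain_of_eq_iff: "chain_of S = chain_of T \<longleftrightarrow> S - T \<in> null_sums"
  by (simp add: pchain.abs_eq_iff sum_rel_def)

lemma chain_of_eq_zero: "S \<in> null_sums \<Longrightarrow> chain_of S = 0"
  unfolding chain_of_zero[symmetric] chain_of_eq_iff by simp

lemma cell_chain_add: "cell_chain (g + g') p = cell_chain g p + cell_chain g' p"
  by (simp add: cell_chain_def single_add chain_of_add)

lemma additive_cell_chain: "additive_family (\<lambda>_ :: unit. \<lambda>g. cell_chain g p)"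
  by (simp add: additive_family_def cell_chain_add)

lemma cell_chain_flip:
  assumes "(q, \<xi>) \<in> cells k UNIV"
  shows "cell_chain g (q, - \<xi>) = - cell_chain g (q, \<xi>)"
proof -
  have "cell_chain g (q, \<xi>) + cell_chain g (q, - \<xi>) = 0"
    using chain_of_eq_zero[OF null_sums.flip[OF assms, of g]] by (simp add: cell_chain_def chain_of_add)
  thus ?thesis by (simp add: eq_neg_iff_add_eq_0 add.commute)
qed

lemma cell_chain_split:
  assumes "(q, \<xi>) \<in> cells k UNIV" "(q', \<xi>) \<in> cells k UNIV" "(q'', \<xi>) \<in> cells k UNIV"
     "q = q' \<union> q''" "(q' \<inter> q'') facet_of q'" "(q' \<inter> q'') facet_of q''"
  shows "cell_chain g (q', \<xi>) + cell_chain g (q'', \<xi>) = cell_chain g (q, \<xi>)"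
  using chain_of_eq_zero[OF null_sums.split[OF assms, of g]]
  by (simp add: cell_chain_def chain_of_add chain_of_diff)

lemma cells_mono: "X \<subseteq> Y \<Longrightarrow> cells k X \<subseteq> cells k Y"
  by (auto simp: cells_def)


subsection \<open>The boundary operators on tensor chains\<close>

text \<open>The filter looks only at direction spaces, which flips and splittings of facets
  preserve. The dimension is read off from the cell, because a formal sum may contain cells of any
  dimension.\<close>

definition facet_part ::
  "((real, 'n) vec set \<Rightarrow> bool) \<Rightarrow> 'n::{finite,linorder} cell \<Rightarrow> 'g \<Rightarrow> ('n, 'g::ab_group_add) pchain" where
  "facet_part \<tau> p g = (\<Sum>p'\<in>bd_cells (nat (aff_dim (fst p))) p.
     if \<tau> (directions (fst p')) then cell_chain g p' else 0)"

lemma additive_facet_part: "additive_family (facet_part \<tau>)"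
  by (auto simp: additive_family_def facet_part_def cell_chain_add sum.distrib[symmetric] intro!: sum.cong)

lemma facet_part_cell:
  assumes "(q, \<xi>) \<in> cells k X"
  shows "facet_part \<tau> (q, \<xi>) g = (\<Sum>p'\<in>bd_cells k (q, \<xi>).
     if \<tau> (directions (fst p')) then cell_chain g p' else 0)"
  using cellsD(2)[OF assms] by (simp add: facet_part_def)

lemma facet_part_flip:
  assumes "(q, \<xi>) \<in> cells k UNIV"
  shows "facet_part \<tau> (q, \<xi>) g + facet_part \<tau> (q, - \<xi>) g = 0"
proof -
  have "cell_chain g (F, facet_or k q (- \<xi>) F) = - cell_chain g (F, facet_or k q \<xi> F)" if "F facet_of q" for F
    using cell_chain_flip[OF facet_cell(1)[OF assms that]] facet_or_minus[OF assms that] by simp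
  thus ?thesis
    unfolding facet_part_cell[OF assms] facet_part_cell[OF cells_minus[OF assms]]
      sum_bd_cells[OF assms] sum_bd_cells[OF cells_minus[OF assms]]
    by (auto simp: sum.distrib[symmetric] intro!: sum.neutral)
qed

text \<open>The pieces of a split facet have full dimension in it, so the filter treats all three
  cells alike.\<close>

lemma facet_part_split:
  assumes "(q, \<xi>) \<in> cells k UNIV" "(q', \<xi>) \<in> cells k UNIV" "(q'', \<xi>) \<in> cells k UNIV"
     "q = q' \<union> q''" "(q' \<inter> q'') facet_of q'" "(q' \<inter> q'') facet_of q''"
  shows "facet_part \<tau> (q', \<xi>) g + facet_part \<tau> (q'', \<xi>) g = facet_part \<tau> (q, \<xi>) g"
  unfolding facet_part_cell[OF assms(1)] facet_part_cell[OF assms(2)] facet_part_cell[OF assms(3)]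
proof (rule sum_bd_cells_split[OF assms])
  fix F F' F'' :: "(real, 'a) vec set" and \<eta>
  assume F: "(F, \<eta>) \<in> cells (k - 1) UNIV"
  show "(if \<tau> (directions (fst (F, - \<eta>))) then cell_chain g (F, - \<eta>) else 0) =
    - (if \<tau> (directions (fst (F, \<eta>))) then cell_chain g (F, \<eta>) else 0)"
    using cell_chain_flip[OF F, of g] by simp
  assume F': "(F', \<eta>) \<in> cells (k - 1) UNIV" and F'': "(F'', \<eta>) \<in> cells (k - 1) UNIV"
    and un: "F = F' \<union> F''" and facets: "(F' \<inter> F'') facet_of F'" "(F' \<inter> F'') facet_of F''"
  have "directions F' = directions F"
    by (rule directions_eqI) (use cellsD(2)[OF F] cellsD(2)[OF F'] cellsD(7)[OF F'] un in auto)
  moreover have "directions F'' = directions F"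
    by (rule directions_eqI) (use cellsD(2)[OF F] cellsD(2)[OF F''] cellsD(7)[OF F''] un in auto)
  ultimately show "(if \<tau> (directions (fst (F', \<eta>))) then cell_chain g (F', \<eta>) else 0) +
    (if \<tau> (directions (fst (F'', \<eta>))) then cell_chain g (F'', \<eta>) else 0) =
    (if \<tau> (directions (fst (F, \<eta>))) then cell_chain g (F, \<eta>) else 0)"
    using cell_chain_split[OF F F' F'' un facets, of g] by simp
qed

text \<open>Hence every filtered boundary descends to chains, whichever cells the relations pass
  through.\<close>

lemma facet_part_null_sums: "S \<in> null_sums \<Longrightarrow> lin (facet_part \<tau>) S = 0"
proof (induction rule: null_sums.induct)
  case (flip q \<xi> k g)
  thus ?case by (simp add: lin_add lin_single additive_facet_part facet_part_flip)
next
  case (split q \<xi> k q' q'' g)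
  thus ?case
    using facet_part_split[OF split(1-3), of \<tau> g]
    by (simp add: lin_add lin_diff lin_single additive_facet_part)
qed (simp_all add: lin_diff additive_facet_part)

lemma subspace_coord_space: "subspace (coord_space \<gamma>)"
  by (simp add: coord_space_def)

lemma coord_space_mono: "\<gamma> \<subseteq> \<delta> \<Longrightarrow> coord_space \<gamma> \<subseteq> coord_space \<delta>"
  unfolding coord_space_def by (intro span_mono image_mono)

lemma coord_space_nth:
  assumes "x \<in> coord_space \<gamma>" "i \<notin> \<gamma>"
  shows "x $ i = 0"
proof -
  have "coord_space \<gamma> \<subseteq> {x. x $ i = 0}"
    unfolding coord_space_def using assms(2)
    by (intro span_minimal) (auto simp: axis_def subspace_def)
  thus ?thesis using assms(1) by auto
qed

lemma orthogonal_pair_coord_space: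
  assumes "\<gamma> \<inter> \<delta> = {}"
  shows "orthogonal_pair (coord_space \<gamma>) (coord_space \<delta>)"
proof (unfold_locales)
  fix x y :: "(real, 'a) vec" assume "x \<in> coord_space \<gamma>" "y \<in> coord_space \<delta>"
  hence "x $ i * y $ i = 0" for i
    using assms coord_space_nth[of x \<gamma> i] coord_space_nth[of y \<delta> i] by (cases "i \<in> \<gamma>") auto
  thus "x \<bullet> y = 0" unfolding inner_vec_def inner_real_def by (intro sum.neutral) blast
qed (simp_all add: subspace_coord_space)

section \<open>Partial boundaries, from formal sums to chains\<close>

context
  fixes \<alpha> \<beta> :: "'n::{finite,linorder} set"
begin

abbreviation "XA \<equiv> coord_space (\<beta> \<inter> \<alpha>)"
abbreviation "XB \<equiv> coord_space (\<beta> - \<alpha>)"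

interpretation orthogonal_pair XA XB
  by (rule orthogonal_pair_coord_space) auto

text \<open>Stays among formal sums of cells, before the quotient, where differences of
  representations can be tested for membership in \<open>null_sums\<close>.\<close>

definition tensor_formal :: "('n cell \<times> 'n cell \<Rightarrow>\<^sub>0 'g::ab_group_add) \<Rightarrow> ('n cell \<Rightarrow>\<^sub>0 'g)" where
  "tensor_formal = lin (\<lambda>p g. Poly_Mapping.single (wedge_cell (fst p) (snd p)) g)"

definition bd1_formal :: "nat \<Rightarrow> ('n cell \<times> 'n cell \<Rightarrow>\<^sub>0 'g::ab_group_add) \<Rightarrow> ('n cell \<times> 'n cell \<Rightarrow>\<^sub>0 'g)" where
  "bd1_formal k1 = lin (\<lambda>p g. \<Sum>p'\<in>bd_cells k1 (fst p). Poly_Mapping.single (p', snd p) g)"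

text \<open>Without the sign of the second partial boundary; \<open>sgn_pow\<close> supplies it
  afterwards.\<close>

definition bd2_formal :: "nat \<Rightarrow> ('n cell \<times> 'n cell \<Rightarrow>\<^sub>0 'g::ab_group_add) \<Rightarrow> ('n cell \<times> 'n cell \<Rightarrow>\<^sub>0 'g)" where
  "bd2_formal k2 = lin (\<lambda>p g. \<Sum>p'\<in>bd_cells k2 (snd p). Poly_Mapping.single (fst p, p') g)"

text \<open>The action of \<open>(-1)^k\<close> on an abelian group, where there is no
  multiplication by reals.\<close>

definition sgn_pow :: "nat \<Rightarrow> 'a::ab_group_add \<Rightarrow> 'a" where
  "sgn_pow k x = (if even k then x else - x)"

lemma sgn_pow_add: "sgn_pow k (x + y) = sgn_pow k x + sgn_pow k y"
  by (simp add: sgn_pow_def)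

lemma tensor_chain_of_lin: "tensor_chain_of = lin (\<lambda>p g. cell_chain g (wedge_cell (fst p) (snd p)))"
  by (rule ext) (simp add: tensor_chain_of_def lin_def split_def)

lemma bd1_sum_lin: "bd1_sum k1 =
    lin (\<lambda>p g. \<Sum>p'\<in>bd_cells k1 (fst p). cell_chain g (wedge_cell p' (snd p)))"
  by (rule ext) (simp add: bd1_sum_def lin_def split_def)

lemma bd2_sum_lin: "bd2_sum k1 k2 T =
    sgn_pow k1 (lin (\<lambda>p g. \<Sum>p'\<in>bd_cells k2 (snd p). cell_chain g (wedge_cell (fst p) p')) T)"
  by (simp add: bd2_sum_def lin_def split_def sgn_pow_def Let_def)

lemmas additive_families =
  additive_family_sum[OF additive_single] additive_family_sum[OF additive_cell_chain]

lemma additive_wedge_chain: "additive_family (\<lambda>p g. cell_chain g (\<phi> p))"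
  by (simp add: additive_family_def cell_chain_add)

lemma chain_of_tensor_formal: "chain_of (tensor_formal T) = tensor_chain_of T"
  by (simp add: tensor_formal_def tensor_chain_of_lin lin_def chain_of_sum cell_chain_def)

lemma bd1_sum_eq: "bd1_sum k1 T = tensor_chain_of (bd1_formal k1 T)"
  by (simp add: bd1_sum_lin tensor_chain_of_lin bd1_formal_def lin_lin additive_wedge_chain lin_sum lin_single)

lemma bd2_sum_eq: "bd2_sum k1 k2 T = sgn_pow k1 (tensor_chain_of (bd2_formal k2 T))"
  by (simp add: bd2_sum_lin tensor_chain_of_lin bd2_formal_def lin_lin additive_wedge_chain lin_sum lin_single)

lemma tensor_chain_of_add: "tensor_chain_of (S + T) = tensor_chain_of S + tensor_chain_of T"
  and tensor_chain_of_diff: "tensor_chain_of (S - T) = tensor_chain_of S - tensor_chain_of T"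
  and tensor_chain_of_minus: "tensor_chain_of (- S) = - tensor_chain_of S"
  and tensor_chain_of_zero: "tensor_chain_of 0 = 0"
  by (simp_all add: tensor_chain_of_lin lin_add lin_diff lin_minus additive_wedge_chain)

lemma tensor_sumsD:
  assumes "T \<in> tensor_sums \<alpha> \<beta> k1 k2" "p \<in> Poly_Mapping.keys T"
  shows "fst p \<in> cells k1 XA" "snd p \<in> cells k2 XB"
  using assms by (auto simp: tensor_sums_def)

lemma tensor_sums_zero: "0 \<in> tensor_sums \<alpha> \<beta> k1 k2"
  and tensor_sums_add: "S \<in> tensor_sums \<alpha> \<beta> k1 k2 \<Longrightarrow> T \<in> tensor_sums \<alpha> \<beta> k1 k2 \<Longrightarrow> S + T \<in> tensor_sums \<alpha> \<beta> k1 k2"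
  and tensor_sums_diff: "S \<in> tensor_sums \<alpha> \<beta> k1 k2 \<Longrightarrow> T \<in> tensor_sums \<alpha> \<beta> k1 k2 \<Longrightarrow> S - T \<in> tensor_sums \<alpha> \<beta> k1 k2"
  using Poly_Mapping.keys_add[of S T] keys_minus_subset[of S T] by (auto simp: tensor_sums_def)

lemma tensor_chainsE:
  assumes "P \<in> tensor_chains \<alpha> \<beta> k1 k2"
  obtains T where "T \<in> tensor_sums \<alpha> \<beta> k1 k2" "P = tensor_chain_of T"
  using assms by (auto simp: tensor_chains_def)

lemma tensor_chain_of_in: "T \<in> tensor_sums \<alpha> \<beta> k1 k2 \<Longrightarrow> tensor_chain_of T \<in> tensor_chains \<alpha> \<beta> k1 k2"
  by (simp add: tensor_chains_def)

lemma tensor_chains_zero: "0 \<in> tensor_chains \<alpha> \<beta> k1 k2"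
  using tensor_chain_of_in[OF tensor_sums_zero] by (simp only: tensor_chain_of_zero)

lemma tensor_chains_add:
  assumes "P \<in> tensor_chains \<alpha> \<beta> k1 k2" "Q \<in> tensor_chains \<alpha> \<beta> k1 k2"
  shows "P + Q \<in> tensor_chains \<alpha> \<beta> k1 k2"
proof -
  obtain S where S: "S \<in> tensor_sums \<alpha> \<beta> k1 k2" "P = tensor_chain_of S" by (rule tensor_chainsE[OF assms(1)])
  obtain T where T: "T \<in> tensor_sums \<alpha> \<beta> k1 k2" "Q = tensor_chain_of T" by (rule tensor_chainsE[OF assms(2)])
  show ?thesis unfolding S T tensor_chain_of_add[symmetric]
    by (intro tensor_chain_of_in tensor_sums_add S T)
qed

lemma tensor_chains_diff:
  assumes "P \<in> tensor_chains \<alpha> \<beta> k1 k2" "Q \<in> tensor_chains \<alpha> \<beta> k1 k2"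
  shows "P - Q \<in> tensor_chains \<alpha> \<beta> k1 k2"
proof -
  obtain S where S: "S \<in> tensor_sums \<alpha> \<beta> k1 k2" "P = tensor_chain_of S" by (rule tensor_chainsE[OF assms(1)])
  obtain T where T: "T \<in> tensor_sums \<alpha> \<beta> k1 k2" "Q = tensor_chain_of T" by (rule tensor_chainsE[OF assms(2)])
  show ?thesis unfolding S T tensor_chain_of_diff[symmetric]
    by (intro tensor_chain_of_in tensor_sums_diff S T)
qed

lemma tensor_chains_minus: "P \<in> tensor_chains \<alpha> \<beta> k1 k2 \<Longrightarrow> - P \<in> tensor_chains \<alpha> \<beta> k1 k2"
  using tensor_chains_diff[OF tensor_chains_zero, of P k1 k2] by simp

lemma tensor_chains_sgn_pow: "P \<in> tensor_chains \<alpha> \<beta> k1 k2 \<Longrightarrow> sgn_pow k P \<in> tensor_chains \<alpha> \<beta> k1 k2"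
  by (simp add: sgn_pow_def tensor_chains_minus)

lemma wedge_cell_in_cells:
  assumes "p1 \<in> cells k1 XA" "p2 \<in> cells k2 XB"
  shows "wedge_cell p1 p2 \<in> cells (k1 + k2) (coord_space \<beta>)"
  using assms msum_cell[of _ _ k1 _ _ k2 "coord_space \<beta>"] subspace_coord_space[of \<beta>]
    coord_space_mono[of "\<beta> \<inter> \<alpha>" \<beta>] coord_space_mono[of "\<beta> - \<alpha>" \<beta>]
  by (cases p1; cases p2) (auto simp: wedge_cell_eq)

lemma wedge_cell_UNIV:
  "p1 \<in> cells k1 XA \<Longrightarrow> p2 \<in> cells k2 XB \<Longrightarrow> wedge_cell p1 p2 \<in> cells (k1 + k2) UNIV"
  using wedge_cell_in_cells cells_mono[of "coord_space \<beta>" UNIV] by blast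

lemma tensor_chains_subset: "tensor_chains \<alpha> \<beta> k1 k2 \<subseteq> poly_chains (k1 + k2) (coord_space \<beta>)"
proof
  fix P :: "('n, 'g::ab_group_add) pchain" assume "P \<in> tensor_chains \<alpha> \<beta> k1 k2"
  then obtain T where T: "T \<in> tensor_sums \<alpha> \<beta> k1 k2" "P = tensor_chain_of T" by (auto simp: tensor_chains_def)
  have "Poly_Mapping.keys (tensor_formal T) \<subseteq> cells (k1 + k2) (coord_space \<beta>)"
  proof
    fix x assume "x \<in> Poly_Mapping.keys (tensor_formal T)"
    hence "x \<in> (\<Union>p\<in>Poly_Mapping.keys T.
        Poly_Mapping.keys (Poly_Mapping.single (wedge_cell (fst p) (snd p)) (Poly_Mapping.lookup T p)))"
      unfolding tensor_formal_def by (rule subsetD[OF keys_lin])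
    then obtain p where "p \<in> Poly_Mapping.keys T" "x = wedge_cell (fst p) (snd p)"
      by (auto split: if_splits)
    thus "x \<in> cells (k1 + k2) (coord_space \<beta>)"
      using wedge_cell_in_cells[OF tensor_sumsD[OF T(1)]] by auto
  qed
  thus "P \<in> poly_chains (k1 + k2) (coord_space \<beta>)"
    unfolding T(2) poly_chains_def chain_of_tensor_formal[symmetric] by blast
qed

lemma wedge_cell_flip_left:
  assumes "(q1, \<xi>1) \<in> cells k1 XA" "p2 \<in> cells k2 XB"
  shows "cell_chain g (wedge_cell (q1, - \<xi>1) p2) = - cell_chain g (wedge_cell (q1, \<xi>1) p2)"
  using cell_chain_flip[of _ _ "k1 + k2"] wedge_cell_UNIV[OF assms] by (cases p2) (simp add: wedge_cell_eq)

lemma wedge_cell_flip_right: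
  assumes "p1 \<in> cells k1 XA" "(q2, \<xi>2) \<in> cells k2 XB"
  shows "cell_chain g (wedge_cell p1 (q2, - \<xi>2)) = - cell_chain g (wedge_cell p1 (q2, \<xi>2))"
  using cell_chain_flip[of _ _ "k1 + k2"] wedge_cell_UNIV[OF assms] by (cases p1) (simp add: wedge_cell_eq)

text \<open>The dimension of the directions inside \<open>XA\<close> is \<open>k1\<close> for a
  facet coming from the second factor and one less for a facet coming from the first. With
  \<open>Suc\<close>, the first type is empty for \<open>k1 = 0\<close>; truncated subtraction would
  confuse it with the second.\<close>

lemma facet_part_wedge_cell:
  assumes "p1 \<in> cells k1 XA" "p2 \<in> cells k2 XB"
  shows "facet_part (\<lambda>V. Suc (dim (V \<inter> XA)) = k1) (wedge_cell p1 p2) g =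
      (\<Sum>p'\<in>bd_cells k1 p1. cell_chain g (wedge_cell p' p2))"
    and "facet_part (\<lambda>V. dim (V \<inter> XA) = k1) (wedge_cell p1 p2) g =
      sgn_pow k1 (\<Sum>p'\<in>bd_cells k2 p2. cell_chain g (wedge_cell p1 p'))"
proof -
  obtain q1 \<xi>1 q2 \<xi>2 where p: "p1 = (q1, \<xi>1)" "p2 = (q2, \<xi>2)" by (cases p1; cases p2)
  have c1: "(q1, \<xi>1) \<in> cells k1 XA" and c2: "(q2, \<xi>2) \<in> cells k2 XB" using assms p by auto
  note 1 = cellsD[OF c1] and 2 = cellsD[OF c2]
  have w: "(msum q1 q2, wedge \<xi>1 \<xi>2) \<in> cells (k1 + k2) UNIV" using wedge_cell_UNIV[OF assms] by (simp add: p wedge_cell_eq)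
  have left: "Suc (dim (directions (msum (fst p') q2) \<inter> XA)) = k1"
    "dim (directions (msum (fst p') q2) \<inter> XA) \<noteq> k1" if "p' \<in> bd_cells k1 (q1, \<xi>1)" for p'
  proof -
    have F: "fst p' facet_of q1" using that by (auto simp: bd_cells_def)
    have "directions (msum (fst p') q2) \<inter> XA = directions (fst p')"
      by (rule directions_msum_Int) (use facet_of_imp_subset[OF F] facet_dim(1)[OF F] 1 2 in auto)
    thus "Suc (dim (directions (msum (fst p') q2) \<inter> XA)) = k1" "dim (directions (msum (fst p') q2) \<inter> XA) \<noteq> k1"
      using facet_dim(3)[OF F] 1(5) by auto
  qed
  have right: "dim (directions (msum q1 (fst p')) \<inter> XA) = k1" if "p' \<in> bd_cells k2 (q2, \<xi>2)" for p'
  proof -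
    have F: "fst p' facet_of q2" using that by (auto simp: bd_cells_def)
    have "directions (msum q1 (fst p')) \<inter> XA = directions q1"
      by (rule directions_msum_Int) (use facet_of_imp_subset[OF F] facet_dim(1)[OF F] 1 2 in auto)
    thus ?thesis using 1(5) by auto
  qed
  \<comment> \<open>The geometric sign on the multivector becomes a sign of the chain through the
    flip relation.\<close>
  have sgn: "cell_chain g (msum q1 (fst p'), (- 1) ^ k1 *\<^sub>R wedge \<xi>1 (snd p')) =
      sgn_pow k1 (cell_chain g (wedge_cell (q1, \<xi>1) p'))" if "p' \<in> bd_cells k2 (q2, \<xi>2)" for p'
  proof -
    have "p' \<in> cells (k2 - 1) XB" using bd_cells_subset[OF c2] that by auto
    hence "wedge_cell (q1, \<xi>1) p' \<in> cells (k1 + (k2 - 1)) UNIV" by (rule wedge_cell_UNIV[OF c1])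
    thus ?thesis using cell_chain_flip by (cases p') (auto simp: sgn_pow_def wedge_cell_eq)
  qed
  show "facet_part (\<lambda>V. Suc (dim (V \<inter> XA)) = k1) (wedge_cell p1 p2) g =
      (\<Sum>p'\<in>bd_cells k1 p1. cell_chain g (wedge_cell p' p2))"
    unfolding p wedge_cell_eq facet_part_cell[OF w] sum_bd_cells_msum[OF c1 c2]
    using left right by (simp add: wedge_cell_def msum_def cong: sum.cong)
  show "facet_part (\<lambda>V. dim (V \<inter> XA) = k1) (wedge_cell p1 p2) g =
      sgn_pow k1 (\<Sum>p'\<in>bd_cells k2 p2. cell_chain g (wedge_cell p1 p'))"
    unfolding p wedge_cell_eq facet_part_cell[OF w] sum_bd_cells_msum[OF c1 c2]
    using left right sgn by (simp add: sgn_pow_def sum_negf cong: sum.cong)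
qed

lemma bd1_sum_facet_part:
  assumes "T \<in> tensor_sums \<alpha> \<beta> k1 k2"
  shows "bd1_sum k1 T = lin (facet_part (\<lambda>V. Suc (dim (V \<inter> XA)) = k1)) (tensor_formal T)"
  unfolding bd1_sum_lin tensor_formal_def lin_lin[OF additive_facet_part] lin_single[OF additive_facet_part]
  by (rule lin_cong, rule facet_part_wedge_cell(1)[symmetric]; rule tensor_sumsD[OF assms])

lemma bd2_sum_facet_part:
  assumes "T \<in> tensor_sums \<alpha> \<beta> k1 k2"
  shows "bd2_sum k1 k2 T = lin (facet_part (\<lambda>V. dim (V \<inter> XA) = k1)) (tensor_formal T)"
proof -
  have "bd2_sum k1 k2 T = lin (\<lambda>p g. sgn_pow k1 (\<Sum>p'\<in>bd_cells k2 (snd p). cell_chain g (wedge_cell (fst p) p'))) T"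
    by (simp add: bd2_sum_lin lin_def sgn_pow_def sum_negf)
  also have "\<dots> = lin (facet_part (\<lambda>V. dim (V \<inter> XA) = k1)) (tensor_formal T)"
    unfolding tensor_formal_def lin_lin[OF additive_facet_part] lin_single[OF additive_facet_part]
    by (rule lin_cong, rule facet_part_wedge_cell(2)[symmetric]; rule tensor_sumsD[OF assms])
  finally show ?thesis .
qed

lemma facet_part_well_defined:
  assumes "tensor_chain_of T = tensor_chain_of T'"
  shows "lin (facet_part \<tau>) (tensor_formal T) = lin (facet_part \<tau>) (tensor_formal T')"
proof -
  have "tensor_formal T - tensor_formal T' \<in> null_sums"
    using assms by (simp flip: chain_of_tensor_formal chain_of_eq_iff)
  from facet_part_null_sums[OF this, of \<tau>] show ?thesis by (simp add: lin_diff additive_facet_part)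
qed

text \<open>The formal images of two representations differ by an element of
  \<open>null_sums\<close>, on which filtered boundaries vanish; this makes the value described by
  \<open>THE\<close> unique.\<close>

lemma bd1_tensor_chain_of:
  assumes "T \<in> tensor_sums \<alpha> \<beta> k1 k2"
  shows "bd1 \<alpha> \<beta> k1 k2 (tensor_chain_of T) = tensor_chain_of (bd1_formal k1 T)"
  unfolding bd1_def bd1_sum_eq[symmetric]
proof (rule the_equality)
  fix Q assume "\<exists>T'\<in>tensor_sums \<alpha> \<beta> k1 k2. tensor_chain_of T' = tensor_chain_of T \<and> bd1_sum k1 T' = Q"
  then obtain T' where T': "T' \<in> tensor_sums \<alpha> \<beta> k1 k2" "tensor_chain_of T' = tensor_chain_of T" "bd1_sum k1 T' = Q"
    by blast
  show "Q = bd1_sum k1 T"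
    unfolding T'(3)[symmetric] bd1_sum_facet_part[OF T'(1)] bd1_sum_facet_part[OF assms]
    by (rule facet_part_well_defined[OF T'(2)])
qed (use assms in auto)

lemma bd2_tensor_chain_of:
  assumes "T \<in> tensor_sums \<alpha> \<beta> k1 k2"
  shows "bd2 \<alpha> \<beta> k1 k2 (tensor_chain_of T) = sgn_pow k1 (tensor_chain_of (bd2_formal k2 T))"
  unfolding bd2_def bd2_sum_eq[symmetric]
proof (rule the_equality)
  fix Q assume "\<exists>T'\<in>tensor_sums \<alpha> \<beta> k1 k2. tensor_chain_of T' = tensor_chain_of T \<and> bd2_sum k1 k2 T' = Q"
  then obtain T' where T': "T' \<in> tensor_sums \<alpha> \<beta> k1 k2" "tensor_chain_of T' = tensor_chain_of T" "bd2_sum k1 k2 T' = Q"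
    by blast
  show "Q = bd2_sum k1 k2 T"
    unfolding T'(3)[symmetric] bd2_sum_facet_part[OF T'(1)] bd2_sum_facet_part[OF assms]
    by (rule facet_part_well_defined[OF T'(2)])
qed (use assms in auto)

lemma bd1_formal_tensor_sums:
  assumes "T \<in> tensor_sums \<alpha> \<beta> k1 k2"
  shows "bd1_formal k1 T \<in> tensor_sums \<alpha> \<beta> (k1 - 1) k2"
proof -
  have "x \<in> cells (k1 - 1) XA \<times> cells k2 XB" if x: "x \<in> Poly_Mapping.keys (bd1_formal k1 T)" for x
  proof -
    have "x \<in> (\<Union>p\<in>Poly_Mapping.keys T.
        Poly_Mapping.keys (\<Sum>p'\<in>bd_cells k1 (fst p). Poly_Mapping.single (p', snd p) (Poly_Mapping.lookup T p)))"
      using x unfolding bd1_formal_def by (rule subsetD[OF keys_lin])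
    then obtain p where p: "p \<in> Poly_Mapping.keys T"
      "x \<in> Poly_Mapping.keys (\<Sum>p'\<in>bd_cells k1 (fst p). Poly_Mapping.single (p', snd p) (Poly_Mapping.lookup T p))"
      by blast
    from p(2) have "x \<in> (\<lambda>p'. (p', snd p)) ` bd_cells k1 (fst p)"
      by (rule subsetD[OF keys_sum_singles])
    thus ?thesis using bd_cells_subset[OF tensor_sumsD(1)[OF assms p(1)]] tensor_sumsD(2)[OF assms p(1)] by auto
  qed
  thus ?thesis by (auto simp: tensor_sums_def)
qed

lemma bd2_formal_tensor_sums:
  assumes "T \<in> tensor_sums \<alpha> \<beta> k1 k2"
  shows "bd2_formal k2 T \<in> tensor_sums \<alpha> \<beta> k1 (k2 - 1)"
proof -
  have "x \<in> cells k1 XA \<times> cells (k2 - 1) XB" if x: "x \<in> Poly_Mapping.keys (bd2_formal k2 T)" for x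
  proof -
    have "x \<in> (\<Union>p\<in>Poly_Mapping.keys T.
        Poly_Mapping.keys (\<Sum>p'\<in>bd_cells k2 (snd p). Poly_Mapping.single (fst p, p') (Poly_Mapping.lookup T p)))"
      using x unfolding bd2_formal_def by (rule subsetD[OF keys_lin])
    then obtain p where p: "p \<in> Poly_Mapping.keys T"
      "x \<in> Poly_Mapping.keys (\<Sum>p'\<in>bd_cells k2 (snd p). Poly_Mapping.single (fst p, p') (Poly_Mapping.lookup T p))"
      by blast
    from p(2) have "x \<in> (\<lambda>p'. (fst p, p')) ` bd_cells k2 (snd p)"
      by (rule subsetD[OF keys_sum_singles])
    thus ?thesis using bd_cells_subset[OF tensor_sumsD(2)[OF assms p(1)]] tensor_sumsD(1)[OF assms p(1)] by auto
  qed
  thus ?thesis by (auto simp: tensor_sums_def)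
qed

section \<open>Partial boundaries as operators on tensor chains\<close>

lemma bd1_tensor_chains:
  assumes "P \<in> tensor_chains \<alpha> \<beta> k1 k2"
  shows "bd1 \<alpha> \<beta> k1 k2 P \<in> tensor_chains \<alpha> \<beta> (k1 - 1) k2"
proof -
  obtain T where T: "T \<in> tensor_sums \<alpha> \<beta> k1 k2" "P = tensor_chain_of T" by (rule tensor_chainsE[OF assms])
  show ?thesis unfolding T(2) bd1_tensor_chain_of[OF T(1)]
    by (rule tensor_chain_of_in[OF bd1_formal_tensor_sums[OF T(1)]])
qed

lemma bd2_tensor_chains:
  assumes "P \<in> tensor_chains \<alpha> \<beta> k1 k2"
  shows "bd2 \<alpha> \<beta> k1 k2 P \<in> tensor_chains \<alpha> \<beta> k1 (k2 - 1)"
proof -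
  obtain T where T: "T \<in> tensor_sums \<alpha> \<beta> k1 k2" "P = tensor_chain_of T" by (rule tensor_chainsE[OF assms])
  show ?thesis unfolding T(2) bd2_tensor_chain_of[OF T(1)]
    by (rule tensor_chains_sgn_pow[OF tensor_chain_of_in[OF bd2_formal_tensor_sums[OF T(1)]]])
qed

lemma bd1_add:
  assumes "P \<in> tensor_chains \<alpha> \<beta> k1 k2" "Q \<in> tensor_chains \<alpha> \<beta> k1 k2"
  shows "bd1 \<alpha> \<beta> k1 k2 (P + Q) = bd1 \<alpha> \<beta> k1 k2 P + bd1 \<alpha> \<beta> k1 k2 Q"
proof -
  obtain S where S: "S \<in> tensor_sums \<alpha> \<beta> k1 k2" "P = tensor_chain_of S" by (rule tensor_chainsE[OF assms(1)])
  obtain T where T: "T \<in> tensor_sums \<alpha> \<beta> k1 k2" "Q = tensor_chain_of T" by (rule tensor_chainsE[OF assms(2)])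
  have "bd1 \<alpha> \<beta> k1 k2 (P + Q) = bd1 \<alpha> \<beta> k1 k2 (tensor_chain_of (S + T))"
    by (simp only: S(2) T(2) tensor_chain_of_add)
  also have "\<dots> = (tensor_chain_of (bd1_formal k1 (S + T)))"
    by (rule bd1_tensor_chain_of[OF tensor_sums_add[OF S(1) T(1)]])
  also have "bd1_formal k1 (S + T) = bd1_formal k1 S + bd1_formal k1 T"
    unfolding bd1_formal_def by (rule lin_add[OF additive_families(1)])
  also have "(tensor_chain_of (bd1_formal k1 S + bd1_formal k1 T)) =
      bd1 \<alpha> \<beta> k1 k2 P + bd1 \<alpha> \<beta> k1 k2 Q"
    by (simp only: S(2) T(2) bd1_tensor_chain_of[OF S(1)] bd1_tensor_chain_of[OF T(1)] tensor_chain_of_add)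
  finally show ?thesis .
qed

lemma bd2_add:
  assumes "P \<in> tensor_chains \<alpha> \<beta> k1 k2" "Q \<in> tensor_chains \<alpha> \<beta> k1 k2"
  shows "bd2 \<alpha> \<beta> k1 k2 (P + Q) = bd2 \<alpha> \<beta> k1 k2 P + bd2 \<alpha> \<beta> k1 k2 Q"
proof -
  obtain S where S: "S \<in> tensor_sums \<alpha> \<beta> k1 k2" "P = tensor_chain_of S" by (rule tensor_chainsE[OF assms(1)])
  obtain T where T: "T \<in> tensor_sums \<alpha> \<beta> k1 k2" "Q = tensor_chain_of T" by (rule tensor_chainsE[OF assms(2)])
  have "bd2 \<alpha> \<beta> k1 k2 (P + Q) = bd2 \<alpha> \<beta> k1 k2 (tensor_chain_of (S + T))"
    by (simp only: S(2) T(2) tensor_chain_of_add)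
  also have "\<dots> = sgn_pow k1 (tensor_chain_of (bd2_formal k2 (S + T)))"
    by (rule bd2_tensor_chain_of[OF tensor_sums_add[OF S(1) T(1)]])
  also have "bd2_formal k2 (S + T) = bd2_formal k2 S + bd2_formal k2 T"
    unfolding bd2_formal_def by (rule lin_add[OF additive_families(1)])
  also have "sgn_pow k1 (tensor_chain_of (bd2_formal k2 S + bd2_formal k2 T)) =
      bd2 \<alpha> \<beta> k1 k2 P + bd2 \<alpha> \<beta> k1 k2 Q"
    by (simp only: S(2) T(2) bd2_tensor_chain_of[OF S(1)] bd2_tensor_chain_of[OF T(1)] sgn_pow_add tensor_chain_of_add)
  finally show ?thesis .
qed

text \<open>In each product the second factor stays fixed, and flipping the first factor flips the
  product, so the cancellation over ridges of the first factor applies.\<close>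

lemma bd1_bd1:
  assumes "P \<in> tensor_chains \<alpha> \<beta> k1 k2"
  shows "bd1 \<alpha> \<beta> (k1 - 1) k2 (bd1 \<alpha> \<beta> k1 k2 P) = 0"
proof -
  obtain T where T: "T \<in> tensor_sums \<alpha> \<beta> k1 k2" "P = tensor_chain_of T" by (rule tensor_chainsE[OF assms])
  have "bd1 \<alpha> \<beta> (k1 - 1) k2 (bd1 \<alpha> \<beta> k1 k2 P) = bd1_sum (k1 - 1) (bd1_formal k1 T)"
    by (simp only: T(2) bd1_tensor_chain_of[OF T(1)] bd1_tensor_chain_of[OF bd1_formal_tensor_sums[OF T(1)]] bd1_sum_eq)
  also have "\<dots> = lin (\<lambda>p g. \<Sum>p'\<in>bd_cells k1 (fst p). \<Sum>p''\<in>bd_cells (k1 - 1) p'. cell_chain g (wedge_cell p'' (snd p))) T"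
    by (simp add: bd1_sum_lin bd1_formal_def lin_lin lin_sum lin_single additive_families)
  also have "\<dots> = lin (\<lambda>p g. 0) T"
  proof (rule lin_cong)
    fix p g assume p: "p \<in> Poly_Mapping.keys T"
    show "(\<Sum>p'\<in>bd_cells k1 (fst p). \<Sum>p''\<in>bd_cells (k1 - 1) p'. cell_chain g (wedge_cell p'' (snd p))) = 0"
      by (rule sum_bd_cells_bd_cells[OF tensor_sumsD(1)[OF T(1) p]])
         (rule wedge_cell_flip_left[OF _ tensor_sumsD(2)[OF T(1) p]])
  qed
  finally show ?thesis by (simp add: lin_def)
qed

lemma bd2_bd2:
  assumes "P \<in> tensor_chains \<alpha> \<beta> k1 k2"
  shows "bd2 \<alpha> \<beta> k1 (k2 - 1) (bd2 \<alpha> \<beta> k1 k2 P) = 0"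
proof -
  obtain T where T: "T \<in> tensor_sums \<alpha> \<beta> k1 k2" "P = tensor_chain_of T" by (rule tensor_chainsE[OF assms])
  \<comment> \<open>The sign is absorbed into the formal sum, since the next boundary is computed
    from a formal sum of products.\<close>
  define T' where "T' = sgn_pow k1 (bd2_formal k2 T)"
  have T': "T' \<in> tensor_sums \<alpha> \<beta> k1 (k2 - 1)"
    using bd2_formal_tensor_sums[OF T(1)] tensor_sums_diff[OF tensor_sums_zero, of "bd2_formal k2 T"]
    by (auto simp: T'_def sgn_pow_def)
  have "bd2 \<alpha> \<beta> k1 k2 P = tensor_chain_of T'"
    by (simp add: T'_def sgn_pow_def T(2) bd2_tensor_chain_of[OF T(1)] tensor_chain_of_minus)
  hence "bd2 \<alpha> \<beta> k1 (k2 - 1) (bd2 \<alpha> \<beta> k1 k2 P) = bd2_sum k1 (k2 - 1) T'"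
    by (simp only: bd2_tensor_chain_of[OF T'] bd2_sum_eq)
  also have "\<dots> = lin (\<lambda>p g. \<Sum>p'\<in>bd_cells k2 (snd p). \<Sum>p''\<in>bd_cells (k2 - 1) p'. cell_chain g (wedge_cell (fst p) p'')) T"
    by (simp add: bd2_sum_lin T'_def bd2_formal_def lin_lin lin_sum lin_single lin_minus additive_families sgn_pow_def)
  also have "\<dots> = lin (\<lambda>p g. 0) T"
  proof (rule lin_cong)
    fix p g assume p: "p \<in> Poly_Mapping.keys T"
    show "(\<Sum>p'\<in>bd_cells k2 (snd p). \<Sum>p''\<in>bd_cells (k2 - 1) p'. cell_chain g (wedge_cell (fst p) p'')) = 0"
      by (rule sum_bd_cells_bd_cells[OF tensor_sumsD(2)[OF T(1) p]])
         (rule wedge_cell_flip_right[OF tensor_sumsD(1)[OF T(1) p]])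
  qed
  finally show ?thesis by (simp add: lin_def)
qed

text \<open>Up to sign the operators commute, by exchanging the sums over facets of the two factors.
  The sign of the second boundary is taken in degree \<open>k1\<close> on the left and in degree
  \<open>Suc k1\<close> on the right; this gives the minus.\<close>

lemma bd1_bd2:
  assumes "P \<in> tensor_chains \<alpha> \<beta> (Suc k1) k2"
  shows "bd2 \<alpha> \<beta> k1 k2 (bd1 \<alpha> \<beta> (Suc k1) k2 P) = - bd1 \<alpha> \<beta> (Suc k1) (k2 - 1) (bd2 \<alpha> \<beta> (Suc k1) k2 P)"
proof -
  obtain T where T: "T \<in> tensor_sums \<alpha> \<beta> (Suc k1) k2" "P = tensor_chain_of T" by (rule tensor_chainsE[OF assms])
  define T' where "T' = sgn_pow (Suc k1) (bd2_formal k2 T)"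
  have T': "T' \<in> tensor_sums \<alpha> \<beta> (Suc k1) (k2 - 1)"
    using bd2_formal_tensor_sums[OF T(1)] tensor_sums_diff[OF tensor_sums_zero, of "bd2_formal k2 T"]
    by (auto simp: T'_def sgn_pow_def)
  have "bd2 \<alpha> \<beta> (Suc k1) k2 P = tensor_chain_of T'"
    by (simp add: T'_def sgn_pow_def T(2) bd2_tensor_chain_of[OF T(1)] tensor_chain_of_minus)
  hence "bd1 \<alpha> \<beta> (Suc k1) (k2 - 1) (bd2 \<alpha> \<beta> (Suc k1) k2 P) = bd1_sum (Suc k1) T'"
    by (simp only: bd1_tensor_chain_of[OF T'] bd1_sum_eq)
  also have "\<dots> = sgn_pow (Suc k1) (bd1_sum (Suc k1) (bd2_formal k2 T))"
    by (simp add: T'_def sgn_pow_def bd1_sum_lin lin_minus[OF additive_families(2)])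
  finally have 1: "bd1 \<alpha> \<beta> (Suc k1) (k2 - 1) (bd2 \<alpha> \<beta> (Suc k1) k2 P) =
    sgn_pow (Suc k1) (bd1_sum (Suc k1) (bd2_formal k2 T))" .
  have B1: "bd1_formal (Suc k1) T \<in> tensor_sums \<alpha> \<beta> k1 k2" using bd1_formal_tensor_sums[OF T(1)] by simp
  have 2: "bd2 \<alpha> \<beta> k1 k2 (bd1 \<alpha> \<beta> (Suc k1) k2 P) = bd2_sum k1 k2 (bd1_formal (Suc k1) T)"
    by (simp only: T(2) bd1_tensor_chain_of[OF T(1)] bd2_tensor_chain_of[OF B1] bd2_sum_eq)
  have "lin (\<lambda>p g. \<Sum>p'\<in>bd_cells k2 (snd p). cell_chain g (wedge_cell (fst p) p')) (bd1_formal (Suc k1) T) =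
      lin (\<lambda>p g. \<Sum>p'\<in>bd_cells (Suc k1) (fst p). \<Sum>p''\<in>bd_cells k2 (snd p). cell_chain g (wedge_cell p' p'')) T"
    by (simp add: bd1_formal_def lin_lin lin_sum lin_single additive_families)
  also have "\<dots> = lin (\<lambda>p g. \<Sum>p''\<in>bd_cells k2 (snd p). \<Sum>p'\<in>bd_cells (Suc k1) (fst p). cell_chain g (wedge_cell p' p'')) T"
    by (rule lin_cong) (rule sum.swap)
  also have "\<dots> = bd1_sum (Suc k1) (bd2_formal k2 T)"
    by (simp add: bd1_sum_lin bd2_formal_def lin_lin lin_sum lin_single additive_families)
  finally show ?thesis unfolding 1 2 bd2_sum_lin by (simp add: sgn_pow_def)
qed

end


subsection \<open>Mass and flat norm of polyhedral tensor chains\<close>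

context complete_normed_group
begin

text \<open>Symmetry of the metric, applied to \<open>g\<close> and 0.\<close>

lemma gn_minus: "gn (- g) = gn g"
  using Metric_space.commute[OF metric, of g 0] by simp

lemma gn_zero: "gn 0 = 0"
  by (simp add: zero_iff)

definition weight :: "nat \<Rightarrow> ('n::{finite,linorder} cell \<Rightarrow>\<^sub>0 'g) \<Rightarrow> real" where
  "weight k S = (\<Sum>p\<in>Poly_Mapping.keys S.
      gn (Poly_Mapping.lookup S p) * enn2real (hausdorff_measure k (fst p)))"

lemma weight_superset:
  assumes "finite A" "Poly_Mapping.keys S \<subseteq> A"
  shows "weight k S = (\<Sum>p\<in>A. gn (Poly_Mapping.lookup S p) * enn2real (hausdorff_measure k (fst p)))"
  unfolding weight_def using assms
  by (intro sum.mono_neutral_left) (auto simp: in_keys_iff gn_zero)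

lemma weight_nonneg: "weight k S \<ge> 0"
  unfolding weight_def by (intro sum_nonneg mult_nonneg_nonneg nonneg) simp

lemma weight_add:
  fixes S T :: "'n::{finite,linorder} cell \<Rightarrow>\<^sub>0 'g"
  shows "weight k (S + T) \<le> weight k S + weight k T"
proof -
  let ?A = "Poly_Mapping.keys S \<union> Poly_Mapping.keys T"
  let ?h = "\<lambda>p :: 'n cell. enn2real (hausdorff_measure k (fst p))"
  have "weight k (S + T) = (\<Sum>p\<in>?A. gn (Poly_Mapping.lookup S p + Poly_Mapping.lookup T p) * ?h p)"
    using weight_superset[of ?A "S + T" k] Poly_Mapping.keys_add[of S T] by (simp add: lookup_add)
  also have "\<dots> \<le> (\<Sum>p\<in>?A. gn (Poly_Mapping.lookup S p) * ?h p + gn (Poly_Mapping.lookup T p) * ?h p)"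
    by (intro sum_mono) (simp add: triangle mult_right_mono flip: distrib_right)
  also have "\<dots> = weight k S + weight k T"
    using weight_superset[of ?A S k] weight_superset[of ?A T k] by (simp add: sum.distrib)
  finally show ?thesis .
qed

lemma keys_uminus_ab: "Poly_Mapping.keys (- S) = Poly_Mapping.keys (S :: 'k \<Rightarrow>\<^sub>0 'b::ab_group_add)"
  by (auto simp: in_keys_iff)

lemma weight_minus: "weight k (- S) = weight k S"
  by (simp add: weight_def keys_uminus_ab gn_minus)

lemma mass_eq: "mass gn k X P = Inf {weight k S |S. Poly_Mapping.keys S \<subseteq> cells k X \<and> chain_of S = P}"
  by (simp add: mass_def weight_def)

lemma mass_le:
  assumes "Poly_Mapping.keys S \<subseteq> cells k X"
  shows "mass gn k X (chain_of S) \<le> weight k S"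
  unfolding mass_eq using assms weight_nonneg
  by (intro cInf_lower bdd_belowI[of _ 0]) auto

text \<open>Membership in \<open>poly_chains\<close> provides a representation, so the real infimum
  is over a nonempty set and can be approached.\<close>

lemma mass_less:
  assumes "P \<in> poly_chains k X" "mass gn k X P < c"
  obtains S where "Poly_Mapping.keys S \<subseteq> cells k X" "chain_of S = P" "weight k S < c"
proof -
  have "{weight k S |S. Poly_Mapping.keys S \<subseteq> cells k X \<and> chain_of S = P} \<noteq> {}"
    using assms(1) by (auto simp: poly_chains_def)
  from cInf_lessD[OF this assms(2)[unfolded mass_eq]] show ?thesis using that by auto
qed

lemma mass_nonneg: "P \<in> poly_chains k X \<Longrightarrow> mass gn k X P \<ge> 0"
  unfolding mass_eq using weight_nonneg by (intro cInf_greatest) (auto simp: poly_chains_def)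

lemma mass_add:
  assumes "P \<in> poly_chains k X" "Q \<in> poly_chains k X"
  shows "mass gn k X (P + Q) \<le> mass gn k X P + mass gn k X Q"
proof (rule field_le_epsilon)
  fix e :: real assume "e > 0"
  obtain S where S: "Poly_Mapping.keys S \<subseteq> cells k X" "chain_of S = P" "weight k S < mass gn k X P + e / 2"
    by (rule mass_less[OF assms(1), of "mass gn k X P + e / 2"]) (use \<open>e > 0\<close> in auto)
  obtain T where T: "Poly_Mapping.keys T \<subseteq> cells k X" "chain_of T = Q" "weight k T < mass gn k X Q + e / 2"
    by (rule mass_less[OF assms(2), of "mass gn k X Q + e / 2"]) (use \<open>e > 0\<close> in auto)
  have "Poly_Mapping.keys (S + T) \<subseteq> cells k X" using S(1) T(1) Poly_Mapping.keys_add[of S T] by blast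
  from mass_le[OF this] show "mass gn k X (P + Q) \<le> mass gn k X P + mass gn k X Q + e"
    using weight_add[of k S T] S(2,3) T(2,3) by (simp add: chain_of_add)
qed

lemma mass_minus_le:
  assumes "P \<in> poly_chains k X"
  shows "mass gn k X (- P) \<le> mass gn k X P"
proof (rule field_le_epsilon)
  fix e :: real assume "e > 0"
  obtain S where S: "Poly_Mapping.keys S \<subseteq> cells k X" "chain_of S = P" "weight k S < mass gn k X P + e"
    by (rule mass_less[OF assms(1), of "mass gn k X P + e"]) (use \<open>e > 0\<close> in auto)
  have "Poly_Mapping.keys (- S) \<subseteq> cells k X" using S(1) by (simp only: keys_uminus_ab)
  from mass_le[OF this] show "mass gn k X (- P) \<le> mass gn k X P + e"
    using weight_minus[of k S] S(2,3) by (simp add: chain_of_minus)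
qed

lemma mass_zero:
  fixes X :: "(real, 'n::{finite,linorder}) vec set"
  shows "mass gn k X (0 :: ('n, 'g) pchain) = 0"
proof (rule antisym)
  show "mass gn k X (0 :: ('n, 'g) pchain) \<le> 0"
    using mass_le[of "0 :: 'n cell \<Rightarrow>\<^sub>0 'g" k X] by (simp add: weight_def chain_of_zero)
  have "(0 :: ('n, 'g) pchain) \<in> poly_chains k X"
    using chain_of_zero by (force simp: poly_chains_def)
  thus "0 \<le> mass gn k X (0 :: ('n, 'g) pchain)" by (rule mass_nonneg)
qed

context
  fixes \<alpha> \<beta> :: "'n::{finite,linorder} set"
begin

definition tmass :: "nat \<Rightarrow> nat \<Rightarrow> ('n, 'g) pchain \<Rightarrow> real" where
  "tmass k1 k2 = mass gn (k1 + k2) (coord_space \<beta>)"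

abbreviation "Ch \<equiv> tensor_chains \<alpha> \<beta> :: nat \<Rightarrow> nat \<Rightarrow> ('n, 'g) pchain set"
abbreviation "FN \<equiv> poly_flat_norm gn \<alpha> \<beta>"
abbreviation "D1 \<equiv> bd1 \<alpha> \<beta> :: nat \<Rightarrow> nat \<Rightarrow> ('n, 'g) pchain \<Rightarrow> ('n, 'g) pchain"
abbreviation "D2 \<equiv> bd2 \<alpha> \<beta> :: nat \<Rightarrow> nat \<Rightarrow> ('n, 'g) pchain \<Rightarrow> ('n, 'g) pchain"

lemma tmass_nonneg: "P \<in> Ch k1 k2 \<Longrightarrow> tmass k1 k2 P \<ge> 0"
  unfolding tmass_def using tensor_chains_subset by (blast intro: mass_nonneg)

lemma tmass_add: "P \<in> Ch k1 k2 \<Longrightarrow> Q \<in> Ch k1 k2 \<Longrightarrow> tmass k1 k2 (P + Q) \<le> tmass k1 k2 P + tmass k1 k2 Q"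
  unfolding tmass_def using tensor_chains_subset by (blast intro: mass_add)

lemma tmass_minus_le: "P \<in> Ch k1 k2 \<Longrightarrow> tmass k1 k2 (- P) \<le> tmass k1 k2 P"
  unfolding tmass_def using tensor_chains_subset by (blast intro: mass_minus_le)

lemma tmass_zero: "tmass k1 k2 0 = 0"
  by (simp add: tmass_def mass_zero)

lemma tensor_chains_sum: "(\<And>i. i \<in> I \<Longrightarrow> P i \<in> Ch k1 k2) \<Longrightarrow> sum P I \<in> Ch k1 k2"
  by (induction I rule: infinite_finite_induct) (auto simp: tensor_chains_zero tensor_chains_add)

lemma tmass_sum: "(\<And>i. i \<in> I \<Longrightarrow> P i \<in> Ch k1 k2) \<Longrightarrow> tmass k1 k2 (sum P I) \<le> (\<Sum>i\<in>I. tmass k1 k2 (P i))"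
proof (induction I rule: infinite_finite_induct)
  case (insert i I)
  have "tmass k1 k2 (P i + sum P I) \<le> tmass k1 k2 (P i) + tmass k1 k2 (sum P I)"
    using insert by (intro tmass_add tensor_chains_sum) auto
  thus ?case using insert by fastforce
qed (simp_all add: tmass_zero)

lemma bd1_in: "P \<in> Ch (Suc k1) k2 \<Longrightarrow> D1 (Suc k1) k2 P \<in> Ch k1 k2"
  using bd1_tensor_chains[of P \<alpha> \<beta> "Suc k1" k2] by simp

lemma bd2_in: "P \<in> Ch k1 (Suc k2) \<Longrightarrow> D2 k1 (Suc k2) P \<in> Ch k1 k2"
  using bd2_tensor_chains[of P \<alpha> \<beta> k1 "Suc k2"] by simp

lemma bd1_zero: "D1 k1 k2 0 = 0"
  using bd1_add[OF tensor_chains_zero tensor_chains_zero, of \<alpha> \<beta> k1 k2] by simp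

lemma bd2_zero: "D2 k1 k2 0 = 0"
  using bd2_add[OF tensor_chains_zero tensor_chains_zero, of \<alpha> \<beta> k1 k2] by simp

lemma bd1_minus: "P \<in> Ch k1 k2 \<Longrightarrow> D1 k1 k2 (- P) = - D1 k1 k2 P"
  using bd1_add[OF _ tensor_chains_minus, of P \<alpha> \<beta> k1 k2 P] by (simp add: bd1_zero minus_unique)

lemma bd2_minus: "P \<in> Ch k1 k2 \<Longrightarrow> D2 k1 k2 (- P) = - D2 k1 k2 P"
  using bd2_add[OF _ tensor_chains_minus, of P \<alpha> \<beta> k1 k2 P] by (simp add: bd2_zero minus_unique)

lemma bd1_diff: "P \<in> Ch k1 k2 \<Longrightarrow> Q \<in> Ch k1 k2 \<Longrightarrow> D1 k1 k2 (P - Q) = D1 k1 k2 P - D1 k1 k2 Q"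
  using bd1_add[OF _ tensor_chains_minus, of P \<alpha> \<beta> k1 k2 Q] by (simp add: bd1_minus)

lemma bd2_diff: "P \<in> Ch k1 k2 \<Longrightarrow> Q \<in> Ch k1 k2 \<Longrightarrow> D2 k1 k2 (P - Q) = D2 k1 k2 P - D2 k1 k2 Q"
  using bd2_add[OF _ tensor_chains_minus, of P \<alpha> \<beta> k1 k2 Q] by (simp add: bd2_minus)

text \<open>With \<open>Suc\<close> for the raised degrees, all four terms land in degrees
  \<open>k1\<close> and \<open>k2\<close> without subtraction.\<close>

definition assemble where
  "assemble k1 k2 Q00 Q10 Q01 Q11 =
     Q00 + D1 (Suc k1) k2 Q10 + D2 k1 (Suc k2) Q01 + D1 (Suc k1) k2 (D2 (Suc k1) (Suc k2) Q11)"

lemma assemble_in: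
  "Q00 \<in> Ch k1 k2 \<Longrightarrow> Q10 \<in> Ch (Suc k1) k2 \<Longrightarrow> Q01 \<in> Ch k1 (Suc k2) \<Longrightarrow> Q11 \<in> Ch (Suc k1) (Suc k2) \<Longrightarrow>
    assemble k1 k2 Q00 Q10 Q01 Q11 \<in> Ch k1 k2"
  unfolding assemble_def by (intro tensor_chains_add bd1_in bd2_in)

lemma assemble_add:
  assumes "Q00 \<in> Ch k1 k2" "Q10 \<in> Ch (Suc k1) k2" "Q01 \<in> Ch k1 (Suc k2)" "Q11 \<in> Ch (Suc k1) (Suc k2)"
    and "R00 \<in> Ch k1 k2" "R10 \<in> Ch (Suc k1) k2" "R01 \<in> Ch k1 (Suc k2)" "R11 \<in> Ch (Suc k1) (Suc k2)"
  shows "assemble k1 k2 (Q00 + R00) (Q10 + R10) (Q01 + R01) (Q11 + R11) =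
    assemble k1 k2 Q00 Q10 Q01 Q11 + assemble k1 k2 R00 R10 R01 R11"
  unfolding assemble_def bd1_add[OF assms(2,6)] bd2_add[OF assms(3,7)] bd2_add[OF assms(4,8)]
    bd1_add[OF bd2_in[OF assms(4)] bd2_in[OF assms(8)]]
  by (simp add: algebra_simps)

lemma assemble_minus:
  assumes "Q00 \<in> Ch k1 k2" "Q10 \<in> Ch (Suc k1) k2" "Q01 \<in> Ch k1 (Suc k2)" "Q11 \<in> Ch (Suc k1) (Suc k2)"
  shows "assemble k1 k2 (- Q00) (- Q10) (- Q01) (- Q11) = - assemble k1 k2 Q00 Q10 Q01 Q11"
  unfolding assemble_def bd1_minus[OF assms(2)] bd2_minus[OF assms(3)] bd2_minus[OF assms(4)]
    bd1_minus[OF bd2_in[OF assms(4)]]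
  by simp

section \<open>The flat norm as a seminorm on polyhedral tensor chains\<close>

lemma poly_flat_norm_eq:
  "FN k1 k2 P = Inf {tmass k1 k2 Q00 + tmass (Suc k1) k2 Q10 + tmass k1 (Suc k2) Q01 + tmass (Suc k1) (Suc k2) Q11
     | Q00 Q10 Q01 Q11. Q00 \<in> Ch k1 k2 \<and> Q10 \<in> Ch (Suc k1) k2 \<and> Q01 \<in> Ch k1 (Suc k2) \<and>
       Q11 \<in> Ch (Suc k1) (Suc k2) \<and> P = assemble k1 k2 Q00 Q10 Q01 Q11}" (is "_ = Inf ?R")
proof -
  let ?L = "{(\<Sum>i1\<in>{0, 1}. \<Sum>i2\<in>{0, 1}. mass gn ((k1 + i1) + (k2 + i2)) (coord_space \<beta>) (Q i1 i2)) | Q.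
     (\<forall>i1\<in>{0, 1}. \<forall>i2\<in>{0, 1}. Q i1 i2 \<in> Ch (k1 + i1) (k2 + i2)) \<and>
     P = Q 0 0 + bd1 \<alpha> \<beta> (k1 + 1) k2 (Q 1 0) + bd2 \<alpha> \<beta> k1 (k2 + 1) (Q 0 1)
       + bd1 \<alpha> \<beta> (k1 + 1) k2 (bd2 \<alpha> \<beta> (k1 + 1) (k2 + 1) (Q 1 1))}"
  have "?L = ?R"
  proof (intro equalityI subsetI)
    fix x assume "x \<in> ?L"
    then obtain Q where "x = (\<Sum>i1\<in>{0, 1}. \<Sum>i2\<in>{0, 1}. mass gn ((k1 + i1) + (k2 + i2)) (coord_space \<beta>) (Q i1 i2))"
      "\<forall>i1\<in>{0, 1}. \<forall>i2\<in>{0, 1}. Q i1 i2 \<in> Ch (k1 + i1) (k2 + i2)"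
      "P = Q 0 0 + bd1 \<alpha> \<beta> (k1 + 1) k2 (Q 1 0) + bd2 \<alpha> \<beta> k1 (k2 + 1) (Q 0 1)
       + bd1 \<alpha> \<beta> (k1 + 1) k2 (bd2 \<alpha> \<beta> (k1 + 1) (k2 + 1) (Q 1 1))" by blast
    thus "x \<in> ?R"
      by (intro CollectI exI[of _ "Q 0 0"] exI[of _ "Q 1 0"] exI[of _ "Q 0 1"] exI[of _ "Q 1 1"])
         (simp add: tmass_def assemble_def)
  next
    fix x assume "x \<in> ?R"
    then obtain Q00 Q10 Q01 Q11 where
      "x = tmass k1 k2 Q00 + tmass (Suc k1) k2 Q10 + tmass k1 (Suc k2) Q01 + tmass (Suc k1) (Suc k2) Q11"
      "Q00 \<in> Ch k1 k2" "Q10 \<in> Ch (Suc k1) k2" "Q01 \<in> Ch k1 (Suc k2)" "Q11 \<in> Ch (Suc k1) (Suc k2)"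
      "P = assemble k1 k2 Q00 Q10 Q01 Q11" by blast
    thus "x \<in> ?L"
      by (intro CollectI exI[of _ "\<lambda>i1 i2. if i1 = 0 then if i2 = 0 then Q00 else Q01
            else if i2 = 0 then Q10 else Q11"])
         (simp add: tmass_def assemble_def)
  qed
  thus ?thesis unfolding poly_flat_norm_def by simp
qed

abbreviation "total_mass k1 k2 Q00 Q10 Q01 Q11 \<equiv>
  tmass k1 k2 Q00 + tmass (Suc k1) k2 Q10 + tmass k1 (Suc k2) Q01 + tmass (Suc k1) (Suc k2) Q11"

lemma flat_norm_le:
  assumes "Q00 \<in> Ch k1 k2" "Q10 \<in> Ch (Suc k1) k2" "Q01 \<in> Ch k1 (Suc k2)" "Q11 \<in> Ch (Suc k1) (Suc k2)"
  shows "FN k1 k2 (assemble k1 k2 Q00 Q10 Q01 Q11) \<le>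
    total_mass k1 k2 Q00 Q10 Q01 Q11"
  unfolding poly_flat_norm_eq
proof (rule cInf_lower)
  show "bdd_below {total_mass k1 k2 Q00' Q10' Q01' Q11'
     | Q00' Q10' Q01' Q11'. Q00' \<in> Ch k1 k2 \<and> Q10' \<in> Ch (Suc k1) k2 \<and> Q01' \<in> Ch k1 (Suc k2) \<and>
       Q11' \<in> Ch (Suc k1) (Suc k2) \<and> assemble k1 k2 Q00 Q10 Q01 Q11 = assemble k1 k2 Q00' Q10' Q01' Q11'}"
    by (rule bdd_belowI[of _ 0]) (auto intro!: add_nonneg_nonneg tmass_nonneg)
qed (use assms in blast)

lemma flat_norm_less:
  assumes "P \<in> Ch k1 k2" "FN k1 k2 P < c"
  obtains Q00 Q10 Q01 Q11 where "Q00 \<in> Ch k1 k2" "Q10 \<in> Ch (Suc k1) k2" "Q01 \<in> Ch k1 (Suc k2)"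
    "Q11 \<in> Ch (Suc k1) (Suc k2)" "P = assemble k1 k2 Q00 Q10 Q01 Q11"
    "total_mass k1 k2 Q00 Q10 Q01 Q11 < c"
proof -
  \<comment> \<open>The trivial decomposition shows that the infimum is over a nonempty set.\<close>
  have "P = assemble k1 k2 P 0 0 0" by (simp add: assemble_def bd1_zero bd2_zero)
  hence "{total_mass k1 k2 Q00 Q10 Q01 Q11
     | Q00 Q10 Q01 Q11. Q00 \<in> Ch k1 k2 \<and> Q10 \<in> Ch (Suc k1) k2 \<and> Q01 \<in> Ch k1 (Suc k2) \<and>
       Q11 \<in> Ch (Suc k1) (Suc k2) \<and> P = assemble k1 k2 Q00 Q10 Q01 Q11} \<noteq> {}"
    using assms(1) tensor_chains_zero by blast
  from cInf_lessD[OF this assms(2)[unfolded poly_flat_norm_eq]] show ?thesis using that by blast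
qed

lemma flat_norm_le_mass: "P \<in> Ch k1 k2 \<Longrightarrow> FN k1 k2 P \<le> tmass k1 k2 P"
  using flat_norm_le[OF _ tensor_chains_zero tensor_chains_zero tensor_chains_zero, of P k1 k2]
  by (simp add: assemble_def bd1_zero bd2_zero tmass_zero)

lemma flat_norm_nonneg:
  assumes "P \<in> Ch k1 k2"
  shows "FN k1 k2 P \<ge> 0"
proof (rule ccontr)
  assume "\<not> FN k1 k2 P \<ge> 0"
  hence "FN k1 k2 P < 0" by simp
  then obtain Q00 Q10 Q01 Q11 where "Q00 \<in> Ch k1 k2" "Q10 \<in> Ch (Suc k1) k2" "Q01 \<in> Ch k1 (Suc k2)"
    "Q11 \<in> Ch (Suc k1) (Suc k2)"
    "total_mass k1 k2 Q00 Q10 Q01 Q11 < 0"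
    by (rule flat_norm_less[OF assms])
  thus False
    using tmass_nonneg[of Q00 k1 k2] tmass_nonneg[of Q10 "Suc k1" k2] tmass_nonneg[of Q01 k1 "Suc k2"]
      tmass_nonneg[of Q11 "Suc k1" "Suc k2"] by linarith
qed

lemma flat_norm_zero: "FN k1 k2 (0 :: ('n, 'g) pchain) = 0"
  using flat_norm_nonneg[OF tensor_chains_zero] flat_norm_le_mass[OF tensor_chains_zero] tmass_zero
  by (metis order_antisym)

lemma flat_norm_add:
  assumes "P \<in> Ch k1 k2" "Q \<in> Ch k1 k2"
  shows "FN k1 k2 (P + Q) \<le> FN k1 k2 P + FN k1 k2 Q"
proof (rule field_le_epsilon)
  fix e :: real assume "e > 0"
  obtain Q00 Q10 Q01 Q11 where Q: "Q00 \<in> Ch k1 k2" "Q10 \<in> Ch (Suc k1) k2" "Q01 \<in> Ch k1 (Suc k2)"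
    "Q11 \<in> Ch (Suc k1) (Suc k2)" "P = assemble k1 k2 Q00 Q10 Q01 Q11"
    "total_mass k1 k2 Q00 Q10 Q01 Q11 < FN k1 k2 P + e / 2"
    by (rule flat_norm_less[OF assms(1), of "FN k1 k2 P + e / 2"]) (use \<open>e > 0\<close> in auto)
  obtain R00 R10 R01 R11 where R: "R00 \<in> Ch k1 k2" "R10 \<in> Ch (Suc k1) k2" "R01 \<in> Ch k1 (Suc k2)"
    "R11 \<in> Ch (Suc k1) (Suc k2)" "Q = assemble k1 k2 R00 R10 R01 R11"
    "total_mass k1 k2 R00 R10 R01 R11 < FN k1 k2 Q + e / 2"
    by (rule flat_norm_less[OF assms(2), of "FN k1 k2 Q + e / 2"]) (use \<open>e > 0\<close> in auto)
  have "P + Q = assemble k1 k2 (Q00 + R00) (Q10 + R10) (Q01 + R01) (Q11 + R11)"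
    unfolding Q(5) R(5) by (rule assemble_add[OF Q(1-4) R(1-4), symmetric])
  moreover note flat_norm_le[OF tensor_chains_add[OF Q(1) R(1)] tensor_chains_add[OF Q(2) R(2)]
      tensor_chains_add[OF Q(3) R(3)] tensor_chains_add[OF Q(4) R(4)]]
  ultimately show "FN k1 k2 (P + Q) \<le> FN k1 k2 P + FN k1 k2 Q + e"
    using tmass_add[OF Q(1) R(1)] tmass_add[OF Q(2) R(2)] tmass_add[OF Q(3) R(3)] tmass_add[OF Q(4) R(4)] Q(6) R(6)
    by simp
qed

lemma flat_norm_minus_le:
  assumes "P \<in> Ch k1 k2"
  shows "FN k1 k2 (- P) \<le> FN k1 k2 P"
proof (rule field_le_epsilon)
  fix e :: real assume "e > 0"
  obtain Q00 Q10 Q01 Q11 where Q: "Q00 \<in> Ch k1 k2" "Q10 \<in> Ch (Suc k1) k2" "Q01 \<in> Ch k1 (Suc k2)"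
    "Q11 \<in> Ch (Suc k1) (Suc k2)" "P = assemble k1 k2 Q00 Q10 Q01 Q11"
    "total_mass k1 k2 Q00 Q10 Q01 Q11 < FN k1 k2 P + e"
    by (rule flat_norm_less[OF assms, of "FN k1 k2 P + e"]) (use \<open>e > 0\<close> in auto)
  have "- P = assemble k1 k2 (- Q00) (- Q10) (- Q01) (- Q11)"
    unfolding Q(5) by (rule assemble_minus[OF Q(1-4), symmetric])
  moreover note flat_norm_le[OF tensor_chains_minus[OF Q(1)] tensor_chains_minus[OF Q(2)]
      tensor_chains_minus[OF Q(3)] tensor_chains_minus[OF Q(4)]]
  ultimately show "FN k1 k2 (- P) \<le> FN k1 k2 P + e"
    using tmass_minus_le[OF Q(1)] tmass_minus_le[OF Q(2)] tmass_minus_le[OF Q(3)] tmass_minus_le[OF Q(4)] Q(6)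
    by simp
qed

lemma flat_norm_minus: "P \<in> Ch k1 k2 \<Longrightarrow> FN k1 k2 (- P) = FN k1 k2 P"
  using flat_norm_minus_le[of P k1 k2] flat_norm_minus_le[OF tensor_chains_minus, of P k1 k2] by simp

lemma flat_norm_diff_commute:
  assumes "P \<in> Ch k1 k2" "Q \<in> Ch k1 k2"
  shows "FN k1 k2 (P - Q) = FN k1 k2 (Q - P)"
  using flat_norm_minus[OF tensor_chains_diff[OF assms]] by simp

lemma flat_norm_diff_triangle:
  assumes "P \<in> Ch k1 k2" "Q \<in> Ch k1 k2" "R \<in> Ch k1 k2"
  shows "FN k1 k2 (P - R) \<le> FN k1 k2 (P - Q) + FN k1 k2 (Q - R)"
  using flat_norm_add[OF tensor_chains_diff[OF assms(1,2)] tensor_chains_diff[OF assms(2,3)]] by simp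

lemma flat_norm_le_diff:
  assumes "P \<in> Ch k1 k2" "Q \<in> Ch k1 k2"
  shows "FN k1 k2 P \<le> FN k1 k2 (P - Q) + FN k1 k2 Q"
  using flat_norm_add[OF tensor_chains_diff[OF assms] assms(2)] by simp

lemma flat_norm_abs_diff:
  assumes "P \<in> Ch k1 k2" "Q \<in> Ch k1 k2"
  shows "\<bar>FN k1 k2 P - FN k1 k2 Q\<bar> \<le> FN k1 k2 (P - Q)"
  using flat_norm_le_diff[OF assms] flat_norm_le_diff[OF assms(2,1)] flat_norm_diff_commute[OF assms] by simp

text \<open>The identities for iterated boundaries turn a decomposition of \<open>P\<close> into one of its partial
  boundaries with the same chains, up to sign, in shifted positions.\<close>

lemma flat_norm_bd1:
  assumes "P \<in> Ch (Suc k1) k2"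
  shows "FN k1 k2 (D1 (Suc k1) k2 P) \<le> FN (Suc k1) k2 P"
proof (rule field_le_epsilon)
  fix e :: real assume "e > 0"
  obtain Q00 Q10 Q01 Q11 where Q: "Q00 \<in> Ch (Suc k1) k2" "Q10 \<in> Ch (Suc (Suc k1)) k2" "Q01 \<in> Ch (Suc k1) (Suc k2)"
    "Q11 \<in> Ch (Suc (Suc k1)) (Suc k2)" "P = assemble (Suc k1) k2 Q00 Q10 Q01 Q11"
    "tmass (Suc k1) k2 Q00 + tmass (Suc (Suc k1)) k2 Q10 + tmass (Suc k1) (Suc k2) Q01
      + tmass (Suc (Suc k1)) (Suc k2) Q11 < FN (Suc k1) k2 P + e"
    by (rule flat_norm_less[OF assms, of "FN (Suc k1) k2 P + e"]) (use \<open>e > 0\<close> in auto)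
  have 1: "D1 (Suc k1) k2 (D1 (Suc (Suc k1)) k2 R) = 0" if "R \<in> Ch (Suc (Suc k1)) k2" for R
    using bd1_bd1[OF that] by simp
  have "D1 (Suc k1) k2 P = D1 (Suc k1) k2 Q00 + D1 (Suc k1) k2 (D1 (Suc (Suc k1)) k2 Q10)
     + D1 (Suc k1) k2 (D2 (Suc k1) (Suc k2) Q01)
     + D1 (Suc k1) k2 (D1 (Suc (Suc k1)) k2 (D2 (Suc (Suc k1)) (Suc k2) Q11))"
    unfolding Q(5) assemble_def
    using Q(1-4) by (simp add: bd1_add bd1_in bd2_in tensor_chains_add)
  \<comment> \<open>Terms with two first boundaries vanish; \<open>Q00\<close> and
    \<open>Q01\<close> move to the slots to which a first boundary is applied.\<close>
  also have "\<dots> = assemble k1 k2 0 Q00 0 Q01"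
    using Q(1-4) by (simp add: 1 bd2_in assemble_def bd2_zero)
  finally have eq: "D1 (Suc k1) k2 P = assemble k1 k2 0 Q00 0 Q01" .
  show "FN k1 k2 (D1 (Suc k1) k2 P) \<le> FN (Suc k1) k2 P + e"
    unfolding eq
    using flat_norm_le[OF tensor_chains_zero Q(1) tensor_chains_zero Q(3)] Q(6)
      tmass_nonneg[OF Q(2)] tmass_nonneg[OF Q(4)] by (simp add: tmass_zero)
qed

lemma flat_norm_bd2:
  assumes "P \<in> Ch k1 (Suc k2)"
  shows "FN k1 k2 (D2 k1 (Suc k2) P) \<le> FN k1 (Suc k2) P"
proof (rule field_le_epsilon)
  fix e :: real assume "e > 0"
  obtain Q00 Q10 Q01 Q11 where Q: "Q00 \<in> Ch k1 (Suc k2)" "Q10 \<in> Ch (Suc k1) (Suc k2)" "Q01 \<in> Ch k1 (Suc (Suc k2))"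
    "Q11 \<in> Ch (Suc k1) (Suc (Suc k2))" "P = assemble k1 (Suc k2) Q00 Q10 Q01 Q11"
    "tmass k1 (Suc k2) Q00 + tmass (Suc k1) (Suc k2) Q10 + tmass k1 (Suc (Suc k2)) Q01
      + tmass (Suc k1) (Suc (Suc k2)) Q11 < FN k1 (Suc k2) P + e"
    by (rule flat_norm_less[OF assms, of "FN k1 (Suc k2) P + e"]) (use \<open>e > 0\<close> in auto)
  have 1: "D2 k (Suc k2) (D2 k (Suc (Suc k2)) R) = 0" if "R \<in> Ch k (Suc (Suc k2))" for R k
    using bd2_bd2[OF that] by simp
  have 2: "D2 k1 (Suc k2) (D1 (Suc k1) (Suc k2) R) = - D1 (Suc k1) k2 (D2 (Suc k1) (Suc k2) R)"
    if "R \<in> Ch (Suc k1) (Suc k2)" for R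
    using bd1_bd2[OF that] by simp
  have "D2 k1 (Suc k2) P = D2 k1 (Suc k2) Q00 + D2 k1 (Suc k2) (D1 (Suc k1) (Suc k2) Q10)
     + D2 k1 (Suc k2) (D2 k1 (Suc (Suc k2)) Q01)
     + D2 k1 (Suc k2) (D1 (Suc k1) (Suc k2) (D2 (Suc k1) (Suc (Suc k2)) Q11))"
    unfolding Q(5) assemble_def
    using Q(1-4) by (simp add: bd2_add bd1_in bd2_in tensor_chains_add)
  \<comment> \<open>Exchanging the boundaries in the term with \<open>Q10\<close> costs a sign; in
    the term with \<open>Q11\<close> the exchange brings two second boundaries together, which kills
    it.\<close>
  also have "\<dots> = assemble k1 k2 0 0 Q00 (- Q10)"
    using Q(1-4) by (simp add: 1 2 bd2_in assemble_def bd1_zero bd2_minus bd1_minus)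
  finally have eq: "D2 k1 (Suc k2) P = assemble k1 k2 0 0 Q00 (- Q10)" .
  show "FN k1 k2 (D2 k1 (Suc k2) P) \<le> FN k1 (Suc k2) P + e"
    unfolding eq
    using flat_norm_le[OF tensor_chains_zero tensor_chains_zero Q(1) tensor_chains_minus[OF Q(2)]] Q(6)
      tmass_minus_le[OF Q(2)] tmass_nonneg[OF Q(3)] tmass_nonneg[OF Q(4)] by (simp add: tmass_zero)
qed

lemma flat_norm_assemble:
  assumes "Q00 \<in> Ch k1 k2" "Q10 \<in> Ch (Suc k1) k2" "Q01 \<in> Ch k1 (Suc k2)" "Q11 \<in> Ch (Suc k1) (Suc k2)"
  shows "FN k1 k2 (assemble k1 k2 Q00 Q10 Q01 Q11) \<le>
    FN k1 k2 Q00 + FN (Suc k1) k2 Q10 + FN k1 (Suc k2) Q01 + FN (Suc k1) (Suc k2) Q11"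
proof -
  have mem: "D1 (Suc k1) k2 Q10 \<in> Ch k1 k2" "D2 k1 (Suc k2) Q01 \<in> Ch k1 k2"
    "D2 (Suc k1) (Suc k2) Q11 \<in> Ch (Suc k1) k2" "D1 (Suc k1) k2 (D2 (Suc k1) (Suc k2) Q11) \<in> Ch k1 k2"
    using assms by (simp_all add: bd1_in bd2_in)
  have "FN k1 k2 (D1 (Suc k1) k2 (D2 (Suc k1) (Suc k2) Q11)) \<le> FN (Suc k1) (Suc k2) Q11"
    using flat_norm_bd1[OF mem(3)] flat_norm_bd2[OF assms(4)] by simp
  thus ?thesis unfolding assemble_def
    using flat_norm_add[OF tensor_chains_add[OF tensor_chains_add[OF assms(1) mem(1)] mem(2)] mem(4)]
      flat_norm_add[OF tensor_chains_add[OF assms(1) mem(1)] mem(2)] flat_norm_add[OF assms(1) mem(1)]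
      flat_norm_bd1[OF assms(2)] flat_norm_bd2[OF assms(3)] by simp
qed


subsection \<open>Flat tensor chains\<close>

abbreviation "CS \<equiv> cauchy_seqs gn \<alpha> \<beta>"
abbreviation "cls \<equiv> fclass gn \<alpha> \<beta>"
abbreviation "FC \<equiv> flat_chains gn \<alpha> \<beta>"
abbreviation "SR \<equiv> seq_rel gn \<alpha> \<beta>"
abbreviation "Fnorm \<equiv> flat_norm gn \<alpha> \<beta>"
abbreviation "Fmass \<equiv> flat_mass gn \<alpha> \<beta>"

lemma cauchy_seqs_chain: "s \<in> CS k1 k2 \<Longrightarrow> s j \<in> Ch k1 k2"
  by (simp add: cauchy_seqs_def)

lemma cauchy_seqsD:
  assumes "s \<in> CS k1 k2" "e > 0"
  obtains N where "\<And>i j. i \<ge> N \<Longrightarrow> j \<ge> N \<Longrightarrow> FN k1 k2 (s i - s j) < e"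
  using assms unfolding cauchy_seqs_def by blast

lemma cauchy_seqsI:
  assumes "\<And>j. s j \<in> Ch k1 k2" "\<And>e. e > 0 \<Longrightarrow> \<exists>N. \<forall>i\<ge>N. \<forall>j\<ge>N. FN k1 k2 (s i - s j) < e"
  shows "s \<in> CS k1 k2"
  using assms by (simp add: cauchy_seqs_def)

lemma seq_rel_iff:
  "(s, t) \<in> SR k1 k2 \<longleftrightarrow> s \<in> CS k1 k2 \<and> t \<in> CS k1 k2 \<and> (\<lambda>j. FN k1 k2 (s j - t j)) \<longlonglongrightarrow> 0"
  by (simp add: seq_rel_def)

lemma equiv_seq_rel: "equiv (CS k1 k2) (SR k1 k2)"
proof (rule equivI)
  show "SR k1 k2 \<subseteq> CS k1 k2 \<times> CS k1 k2" by (auto simp: seq_rel_iff)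
  show "refl_on (CS k1 k2) (SR k1 k2)"
    by (rule refl_onI) (simp add: seq_rel_iff flat_norm_zero)
  show "sym (SR k1 k2)"
  proof (rule symI)
    fix s t assume st: "(s, t) \<in> SR k1 k2"
    hence "(\<lambda>j. FN k1 k2 (t j - s j)) = (\<lambda>j. FN k1 k2 (s j - t j))"
      by (intro ext flat_norm_diff_commute) (auto simp: seq_rel_iff intro: cauchy_seqs_chain)
    thus "(t, s) \<in> SR k1 k2" using st by (simp add: seq_rel_iff)
  qed
  show "trans (SR k1 k2)"
  proof (rule transI)
    fix s t u assume st: "(s, t) \<in> SR k1 k2" and tu: "(t, u) \<in> SR k1 k2"
    have c: "s j \<in> Ch k1 k2" "t j \<in> Ch k1 k2" "u j \<in> Ch k1 k2" for j
      using st tu by (auto simp: seq_rel_iff intro: cauchy_seqs_chain)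
    have "(\<lambda>j. FN k1 k2 (s j - t j) + FN k1 k2 (t j - u j)) \<longlonglongrightarrow> 0 + 0"
      using st tu by (intro tendsto_add) (simp_all add: seq_rel_iff)
    hence lim: "(\<lambda>j. FN k1 k2 (s j - t j) + FN k1 k2 (t j - u j)) \<longlonglongrightarrow> 0" by simp
    have "(\<lambda>j. FN k1 k2 (s j - u j)) \<longlonglongrightarrow> 0"
      by (rule tendsto_sandwich[OF _ _ tendsto_const lim])
         (intro always_eventually allI flat_norm_nonneg tensor_chains_diff c flat_norm_diff_triangle)+
    thus "(s, u) \<in> SR k1 k2" using st tu by (simp add: seq_rel_iff)
  qed
qed

section \<open>Operations on classes of Cauchy sequences\<close>

lemma fclass_iff: "t \<in> cls k1 k2 s \<longleftrightarrow> (s, t) \<in> SR k1 k2"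
  by (simp add: fclass_def)

lemma fclass_self: "s \<in> CS k1 k2 \<Longrightarrow> s \<in> cls k1 k2 s"
  unfolding fclass_def by (rule equiv_class_self[OF equiv_seq_rel])

lemma fclass_eqI: "(s, t) \<in> SR k1 k2 \<Longrightarrow> cls k1 k2 s = cls k1 k2 t"
  unfolding fclass_def by (rule equiv_class_eq[OF equiv_seq_rel])

lemma fclass_in: "s \<in> CS k1 k2 \<Longrightarrow> cls k1 k2 s \<in> FC k1 k2"
  unfolding fclass_def flat_chains_def by (rule quotientI)

lemma flat_chainsE:
  assumes "A \<in> FC k1 k2"
  obtains s where "s \<in> CS k1 k2" "A = cls k1 k2 s"
  using assms unfolding fclass_def flat_chains_def by (rule quotientE)

text \<open>Made for the boundaries: applied termwise, a map that does not increase distances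
  preserves Cauchy sequences and, by the next lemma, their equivalence.\<close>

lemma lipschitz_cauchy_seqs:
  assumes "s \<in> CS k1 k2" "\<And>j. f (s j) \<in> Ch l1 l2"
    and "\<And>P Q. P \<in> Ch k1 k2 \<Longrightarrow> Q \<in> Ch k1 k2 \<Longrightarrow> FN l1 l2 (f P - f Q) \<le> FN k1 k2 (P - Q)"
  shows "(\<lambda>j. f (s j)) \<in> CS l1 l2"
proof (rule cauchy_seqsI)
  fix e :: real assume "e > 0"
  then obtain N where "\<And>i j. i \<ge> N \<Longrightarrow> j \<ge> N \<Longrightarrow> FN k1 k2 (s i - s j) < e"
    using cauchy_seqsD[OF assms(1)] by blast
  thus "\<exists>N. \<forall>i\<ge>N. \<forall>j\<ge>N. FN l1 l2 (f (s i) - f (s j)) < e"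
    using assms(3)[OF cauchy_seqs_chain[OF assms(1)] cauchy_seqs_chain[OF assms(1)]] by (meson le_less_trans)
qed (rule assms(2))

lemma lipschitz_seq_rel:
  assumes "(s, t) \<in> SR k1 k2" "\<And>P. P \<in> Ch k1 k2 \<Longrightarrow> f P \<in> Ch l1 l2"
    and "\<And>P Q. P \<in> Ch k1 k2 \<Longrightarrow> Q \<in> Ch k1 k2 \<Longrightarrow> FN l1 l2 (f P - f Q) \<le> FN k1 k2 (P - Q)"
  shows "(\<lambda>j. f (s j), \<lambda>j. f (t j)) \<in> SR l1 l2"
proof -
  have s: "s \<in> CS k1 k2" and t: "t \<in> CS k1 k2" and lim: "(\<lambda>j. FN k1 k2 (s j - t j)) \<longlonglongrightarrow> 0"
    using assms(1) by (simp_all add: seq_rel_iff)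
  note c = cauchy_seqs_chain[OF s] cauchy_seqs_chain[OF t]
  have "(\<lambda>j. FN l1 l2 (f (s j) - f (t j))) \<longlonglongrightarrow> 0"
    by (rule tendsto_sandwich[OF _ _ tendsto_const lim])
       (intro always_eventually allI flat_norm_nonneg tensor_chains_diff assms(2,3) c)+
  moreover have "(\<lambda>j. f (s j)) \<in> CS l1 l2" by (rule lipschitz_cauchy_seqs[OF s assms(2)[OF c(1)] assms(3)])
  moreover have "(\<lambda>j. f (t j)) \<in> CS l1 l2" by (rule lipschitz_cauchy_seqs[OF t assms(2)[OF c(2)] assms(3)])
  ultimately show ?thesis unfolding seq_rel_iff by blast
qed

text \<open>Operations on classes are defined as unions over representatives; the union collapses to
  one class as soon as the result does not depend on the representative.\<close>

lemma UN_fclass: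
  assumes "s \<in> CS k1 k2" "\<And>t. (s, t) \<in> SR k1 k2 \<Longrightarrow> f t = f s"
  shows "(\<Union>t\<in>cls k1 k2 s. f t) = f s"
  by (rule UN_constant_eq[OF fclass_self[OF assms(1)]], rule ballI, rule assms(2)) (simp add: fclass_iff)

lemma bd1_lipschitz:
  "P \<in> Ch (Suc k1) k2 \<Longrightarrow> Q \<in> Ch (Suc k1) k2 \<Longrightarrow> FN k1 k2 (D1 (Suc k1) k2 P - D1 (Suc k1) k2 Q) \<le> FN (Suc k1) k2 (P - Q)"
  using flat_norm_bd1[OF tensor_chains_diff, of P k1 k2 Q] by (simp add: bd1_diff)

lemma bd2_lipschitz:
  "P \<in> Ch k1 (Suc k2) \<Longrightarrow> Q \<in> Ch k1 (Suc k2) \<Longrightarrow> FN k1 k2 (D2 k1 (Suc k2) P - D2 k1 (Suc k2) Q) \<le> FN k1 (Suc k2) (P - Q)"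
  using flat_norm_bd2[OF tensor_chains_diff, of P k1 k2 Q] by (simp add: bd2_diff)

lemma cauchy_seqs_bd1: "s \<in> CS (Suc k1) k2 \<Longrightarrow> (\<lambda>j. D1 (Suc k1) k2 (s j)) \<in> CS k1 k2"
  by (rule lipschitz_cauchy_seqs[OF _ bd1_in[OF cauchy_seqs_chain] bd1_lipschitz])

lemma cauchy_seqs_bd2: "s \<in> CS k1 (Suc k2) \<Longrightarrow> (\<lambda>j. D2 k1 (Suc k2) (s j)) \<in> CS k1 k2"
  by (rule lipschitz_cauchy_seqs[OF _ bd2_in[OF cauchy_seqs_chain] bd2_lipschitz])

lemma fbd1_fclass:
  assumes "s \<in> CS (Suc k1) k2"
  shows "fbd1 gn \<alpha> \<beta> (Suc k1) k2 (cls (Suc k1) k2 s) = cls k1 k2 (\<lambda>j. D1 (Suc k1) k2 (s j))"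
  unfolding fbd1_def diff_Suc_1
  by (rule UN_fclass[OF assms], rule fclass_eqI[symmetric], rule lipschitz_seq_rel[OF _ bd1_in bd1_lipschitz])

lemma fbd2_fclass:
  assumes "s \<in> CS k1 (Suc k2)"
  shows "fbd2 gn \<alpha> \<beta> k1 (Suc k2) (cls k1 (Suc k2) s) = cls k1 k2 (\<lambda>j. D2 k1 (Suc k2) (s j))"
  unfolding fbd2_def diff_Suc_1
  by (rule UN_fclass[OF assms], rule fclass_eqI[symmetric], rule lipschitz_seq_rel[OF _ bd2_in bd2_lipschitz])

lemma flat_norm_add_diff:
  assumes "P \<in> Ch k1 k2" "Q \<in> Ch k1 k2" "P' \<in> Ch k1 k2" "Q' \<in> Ch k1 k2"
  shows "FN k1 k2 ((P + Q) - (P' + Q')) \<le> FN k1 k2 (P - P') + FN k1 k2 (Q - Q')"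
    and "FN k1 k2 ((P - Q) - (P' - Q')) \<le> FN k1 k2 (P - P') + FN k1 k2 (Q - Q')"
proof -
  have eq: "(P + Q) - (P' + Q') = (P - P') + (Q - Q')" "(P - Q) - (P' - Q') = (P - P') + (Q' - Q)"
    by (simp_all add: algebra_simps)
  show "FN k1 k2 ((P + Q) - (P' + Q')) \<le> FN k1 k2 (P - P') + FN k1 k2 (Q - Q')"
    unfolding eq(1) by (intro flat_norm_add tensor_chains_diff assms)
  show "FN k1 k2 ((P - Q) - (P' - Q')) \<le> FN k1 k2 (P - P') + FN k1 k2 (Q - Q')"
    unfolding eq(2) flat_norm_diff_commute[OF assms(2,4)] by (intro flat_norm_add tensor_chains_diff assms)
qed

text \<open>The map \<open>h\<close> stands for addition and for subtraction, which satisfy the same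
  distance bound.\<close>

lemma binary_cauchy_seqs:
  assumes s: "s \<in> CS k1 k2" and t: "t \<in> CS k1 k2"
    and closed: "\<And>P Q. P \<in> Ch k1 k2 \<Longrightarrow> Q \<in> Ch k1 k2 \<Longrightarrow> h P Q \<in> Ch k1 k2"
    and lip: "\<And>P Q P' Q'. P \<in> Ch k1 k2 \<Longrightarrow> Q \<in> Ch k1 k2 \<Longrightarrow> P' \<in> Ch k1 k2 \<Longrightarrow> Q' \<in> Ch k1 k2 \<Longrightarrow>
      FN k1 k2 (h P Q - h P' Q') \<le> FN k1 k2 (P - P') + FN k1 k2 (Q - Q')"
  shows "(\<lambda>j. h (s j) (t j)) \<in> CS k1 k2"
proof (rule cauchy_seqsI)
  note c = cauchy_seqs_chain[OF s] cauchy_seqs_chain[OF t]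
  show "h (s j) (t j) \<in> Ch k1 k2" for j by (rule closed[OF c])
  fix e :: real assume e: "e > 0"
  obtain M where M: "\<And>i j. i \<ge> M \<Longrightarrow> j \<ge> M \<Longrightarrow> FN k1 k2 (s i - s j) < e / 2"
    using cauchy_seqsD[OF s, of "e / 2"] e by auto
  obtain N where N: "\<And>i j. i \<ge> N \<Longrightarrow> j \<ge> N \<Longrightarrow> FN k1 k2 (t i - t j) < e / 2"
    using cauchy_seqsD[OF t, of "e / 2"] e by auto
  show "\<exists>N. \<forall>i\<ge>N. \<forall>j\<ge>N. FN k1 k2 (h (s i) (t i) - h (s j) (t j)) < e"
  proof (intro exI[of _ "max M N"] allI impI)
    fix i j assume "max M N \<le> i" "max M N \<le> j"
    thus "FN k1 k2 (h (s i) (t i) - h (s j) (t j)) < e"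
      using M[of i j] N[of i j] lip[OF c(1)[of i] c(2)[of i] c(1)[of j] c(2)[of j]] by simp
  qed
qed

lemma UN_fclass_binary:
  assumes s: "s \<in> CS k1 k2" and t: "t \<in> CS k1 k2"
    and closed: "\<And>P Q. P \<in> Ch k1 k2 \<Longrightarrow> Q \<in> Ch k1 k2 \<Longrightarrow> h P Q \<in> Ch k1 k2"
    and lip: "\<And>P Q P' Q'. P \<in> Ch k1 k2 \<Longrightarrow> Q \<in> Ch k1 k2 \<Longrightarrow> P' \<in> Ch k1 k2 \<Longrightarrow> Q' \<in> Ch k1 k2 \<Longrightarrow>
      FN k1 k2 (h P Q - h P' Q') \<le> FN k1 k2 (P - P') + FN k1 k2 (Q - Q')"
  shows "(\<Union>a\<in>cls k1 k2 s. \<Union>b\<in>cls k1 k2 t. cls k1 k2 (\<lambda>j. h (a j) (b j))) = cls k1 k2 (\<lambda>j. h (s j) (t j))"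
proof -
  have eq: "cls k1 k2 (\<lambda>j. h (a j) (b j)) = cls k1 k2 (\<lambda>j. h (s j) (t j))"
    if a: "(s, a) \<in> SR k1 k2" and b: "(t, b) \<in> SR k1 k2" for a b
  proof (rule fclass_eqI[symmetric])
    have ab: "a \<in> CS k1 k2" "b \<in> CS k1 k2" using a b by (simp_all add: seq_rel_iff)
    note c = s[THEN cauchy_seqs_chain] t[THEN cauchy_seqs_chain] ab[THEN cauchy_seqs_chain]
    have "(\<lambda>j. FN k1 k2 (s j - a j) + FN k1 k2 (t j - b j)) \<longlonglongrightarrow> 0 + 0"
      using a b by (intro tendsto_add) (simp_all add: seq_rel_iff)
    hence lim: "(\<lambda>j. FN k1 k2 (s j - a j) + FN k1 k2 (t j - b j)) \<longlonglongrightarrow> 0" by simp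
    have "(\<lambda>j. FN k1 k2 (h (s j) (t j) - h (a j) (b j))) \<longlonglongrightarrow> 0"
      by (rule tendsto_sandwich[OF _ _ tendsto_const lim])
         (intro always_eventually allI flat_norm_nonneg closed lip tensor_chains_diff c)+
    thus "(\<lambda>j. h (s j) (t j), \<lambda>j. h (a j) (b j)) \<in> SR k1 k2"
      using binary_cauchy_seqs[OF s t closed lip] binary_cauchy_seqs[OF ab closed lip]
      unfolding seq_rel_iff by blast
  qed
  have "(\<Union>b\<in>cls k1 k2 t. cls k1 k2 (\<lambda>j. h (a j) (b j))) = cls k1 k2 (\<lambda>j. h (s j) (t j))"
    if a: "(s, a) \<in> SR k1 k2" for a
    by (rule UN_constant_eq[OF fclass_self[OF t]], rule ballI, rule eq[OF a]) (simp add: fclass_iff)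
  thus ?thesis
    by (intro UN_constant_eq[OF fclass_self[OF s]] ballI) (simp add: fclass_iff)
qed

lemma cauchy_seqs_add: "s \<in> CS k1 k2 \<Longrightarrow> t \<in> CS k1 k2 \<Longrightarrow> (\<lambda>j. s j + t j) \<in> CS k1 k2"
  by (rule binary_cauchy_seqs[OF _ _ tensor_chains_add flat_norm_add_diff(1)])

lemma cauchy_seqs_diff: "s \<in> CS k1 k2 \<Longrightarrow> t \<in> CS k1 k2 \<Longrightarrow> (\<lambda>j. s j - t j) \<in> CS k1 k2"
  by (rule binary_cauchy_seqs[OF _ _ tensor_chains_diff flat_norm_add_diff(2)])

lemma fadd_fclass:
  "s \<in> CS k1 k2 \<Longrightarrow> t \<in> CS k1 k2 \<Longrightarrow>
    fadd gn \<alpha> \<beta> k1 k2 (cls k1 k2 s) (cls k1 k2 t) = cls k1 k2 (\<lambda>j. s j + t j)"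
  unfolding fadd_def by (rule UN_fclass_binary[OF _ _ tensor_chains_add flat_norm_add_diff(1)])

lemma fdiff_fclass:
  "s \<in> CS k1 k2 \<Longrightarrow> t \<in> CS k1 k2 \<Longrightarrow>
    fdiff gn \<alpha> \<beta> k1 k2 (cls k1 k2 s) (cls k1 k2 t) = cls k1 k2 (\<lambda>j. s j - t j)"
  unfolding fdiff_def by (rule UN_fclass_binary[OF _ _ tensor_chains_diff flat_norm_add_diff(2)])

text \<open>The flat norm is 1-Lipschitz, so it converges along a Cauchy sequence and has the same
  limit along equivalent ones; this settles the \<open>THE\<close> in
  \<open>flat_norm\<close>.\<close>

lemma flat_norm_tendsto:
  assumes "s \<in> CS k1 k2"
  shows "(\<lambda>j. FN k1 k2 (s j)) \<longlonglongrightarrow> Fnorm k1 k2 (cls k1 k2 s)"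
proof -
  note c = cauchy_seqs_chain[OF assms]
  have "Cauchy (\<lambda>j. FN k1 k2 (s j))"
  proof (rule CauchyI)
    fix e :: real assume "e > 0"
    obtain N where N: "\<And>i j. i \<ge> N \<Longrightarrow> j \<ge> N \<Longrightarrow> FN k1 k2 (s i - s j) < e"
      using cauchy_seqsD[OF assms \<open>e > 0\<close>] by blast
    show "\<exists>M. \<forall>m\<ge>M. \<forall>n\<ge>M. norm (FN k1 k2 (s m) - FN k1 k2 (s n)) < e"
      unfolding real_norm_def
      by (intro exI[of _ N] allI impI le_less_trans[OF flat_norm_abs_diff[OF c c]] N)
  qed
  then obtain l where l: "(\<lambda>j. FN k1 k2 (s j)) \<longlonglongrightarrow> l"
    using Cauchy_convergent convergent_def by blast
  have "Fnorm k1 k2 (cls k1 k2 s) = l"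
    unfolding flat_norm_def
  proof (rule the_equality)
    show "\<exists>a\<in>cls k1 k2 s. (\<lambda>j. FN k1 k2 (a j)) \<longlonglongrightarrow> l" using l fclass_self[OF assms] by blast
    fix l' assume "\<exists>a\<in>cls k1 k2 s. (\<lambda>j. FN k1 k2 (a j)) \<longlonglongrightarrow> l'"
    then obtain a where a: "a \<in> CS k1 k2" "(\<lambda>j. FN k1 k2 (s j - a j)) \<longlonglongrightarrow> 0"
      "(\<lambda>j. FN k1 k2 (a j)) \<longlonglongrightarrow> l'"
      unfolding fclass_iff Bex_def seq_rel_iff by blast
    have "(\<lambda>j. \<bar>FN k1 k2 (s j) - FN k1 k2 (a j)\<bar>) \<longlonglongrightarrow> 0"
      by (rule tendsto_sandwich[OF _ _ tendsto_const a(2)])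
         (intro always_eventually allI abs_ge_zero flat_norm_abs_diff[OF c cauchy_seqs_chain[OF a(1)]])+
    moreover have "(\<lambda>j. \<bar>FN k1 k2 (s j) - FN k1 k2 (a j)\<bar>) \<longlonglongrightarrow> \<bar>l - l'\<bar>"
      by (intro tendsto_rabs tendsto_diff l a(3))
    ultimately have "\<bar>l - l'\<bar> = 0" using LIMSEQ_unique by blast
    thus "l' = l" by simp
  qed
  thus ?thesis using l by simp
qed

lemma flat_norm_fclass_nonneg:
  assumes "s \<in> CS k1 k2"
  shows "Fnorm k1 k2 (cls k1 k2 s) \<ge> 0"
  by (rule tendsto_lowerbound[OF flat_norm_tendsto[OF assms]])
     (intro always_eventually allI flat_norm_nonneg cauchy_seqs_chain[OF assms], simp)

lemma const_cauchy_seqs: "P \<in> Ch k1 k2 \<Longrightarrow> (\<lambda>j. P) \<in> CS k1 k2"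
  by (rule cauchy_seqsI) (simp_all add: flat_norm_zero)

lemma flat_dist_tendsto:
  assumes "P \<in> Ch k1 k2" "s \<in> CS k1 k2"
  shows "(\<lambda>j. FN k1 k2 (P - s j)) \<longlonglongrightarrow>
    Fnorm k1 k2 (fdiff gn \<alpha> \<beta> k1 k2 (flat_of gn \<alpha> \<beta> k1 k2 P) (cls k1 k2 s))"
  unfolding flat_of_def fdiff_fclass[OF const_cauchy_seqs[OF assms(1)] assms(2)]
  by (rule flat_norm_tendsto[OF cauchy_seqs_diff[OF const_cauchy_seqs[OF assms(1)] assms(2)]])

text \<open>The representing sequence itself competes in the infimum that defines
  \<open>flat_mass\<close>.\<close>

lemma flat_mass_le:
  assumes "s \<in> CS k1 k2" "\<And>j. tmass k1 k2 (s j) \<le> c"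
  shows "Fmass k1 k2 (cls k1 k2 s) \<le> ennreal c"
proof -
  note cs = cauchy_seqs_chain[OF assms(1)]
  let ?d = "\<lambda>j. Fnorm k1 k2 (fdiff gn \<alpha> \<beta> k1 k2 (flat_of gn \<alpha> \<beta> k1 k2 (s j)) (cls k1 k2 s))"
  have "?d \<longlonglongrightarrow> 0"
  proof (rule LIMSEQ_I)
    fix e :: real assume e: "e > 0"
    \<comment> \<open>Half of \<open>e\<close>, because the limit turns the strict bound into a weak
      one.\<close>
    obtain N where N: "\<And>i j. i \<ge> N \<Longrightarrow> j \<ge> N \<Longrightarrow> FN k1 k2 (s i - s j) < e / 2"
      using cauchy_seqsD[OF assms(1), of "e / 2"] e by auto
    have "norm (?d j - 0) < e" if "j \<ge> N" for j
    proof -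
      note lim = flat_dist_tendsto[OF cs[of j] assms(1)]
      have "?d j \<le> e / 2"
        by (rule tendsto_upperbound[OF lim])
           (use N[OF that] in \<open>auto simp: eventually_sequentially intro!: exI[of _ N] less_imp_le\<close>)
      moreover have "?d j \<ge> 0"
        by (rule tendsto_lowerbound[OF lim])
           (intro always_eventually allI flat_norm_nonneg tensor_chains_diff cs, simp)
      ultimately show ?thesis using e by simp
    qed
    thus "\<exists>N. \<forall>j\<ge>N. norm (?d j - 0) < e" by blast
  qed
  hence "Fmass k1 k2 (cls k1 k2 s) \<le> liminf (\<lambda>j. ennreal (mass gn (k1 + k2) (coord_space \<beta>) (s j)))"
    unfolding flat_mass_def using cs by (intro Inf_lower) blast
  also have "\<dots> \<le> limsup (\<lambda>j. ennreal (mass gn (k1 + k2) (coord_space \<beta>) (s j)))"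
    by (rule Liminf_le_Limsup) simp
  also have "\<dots> \<le> ennreal c"
    using assms(2) by (intro Limsup_bounded always_eventually allI ennreal_leI) (simp add: tmass_def)
  finally show ?thesis .
qed

text \<open>A lower limit below \<open>c\<close> provides masses below \<open>c\<close> at
  infinitely many indices, while the distances are small at all large ones; some index satisfies
  both.\<close>

lemma flat_mass_less:
  assumes "s \<in> CS k1 k2" "Fmass k1 k2 (cls k1 k2 s) < ennreal c" "e > 0"
  obtains P where "P \<in> Ch k1 k2" "tmass k1 k2 P < c" "\<forall>\<^sub>F j in sequentially. FN k1 k2 (s j - P) < e"
proof -
  obtain P where P: "\<And>j. P j \<in> Ch k1 k2"
    "liminf (\<lambda>j. ennreal (mass gn (k1 + k2) (coord_space \<beta>) (P j))) < ennreal c"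
    "(\<lambda>j. Fnorm k1 k2 (fdiff gn \<alpha> \<beta> k1 k2 (flat_of gn \<alpha> \<beta> k1 k2 (P j)) (cls k1 k2 s))) \<longlonglongrightarrow> 0"
    using assms(2) unfolding flat_mass_def Inf_less_iff by blast
  have ev: "\<forall>\<^sub>F j in sequentially.
    Fnorm k1 k2 (fdiff gn \<alpha> \<beta> k1 k2 (flat_of gn \<alpha> \<beta> k1 k2 (P j)) (cls k1 k2 s)) < e"
    by (rule order_tendstoD(2)[OF P(3) assms(3)])
  have "\<not> (\<forall>\<^sub>F j in sequentially. ennreal c \<le> ennreal (mass gn (k1 + k2) (coord_space \<beta>) (P j)))"
  proof
    assume "\<forall>\<^sub>F j in sequentially. ennreal c \<le> ennreal (mass gn (k1 + k2) (coord_space \<beta>) (P j))"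
    hence "ennreal c \<le> liminf (\<lambda>j. ennreal (mass gn (k1 + k2) (coord_space \<beta>) (P j)))"
      by (rule Liminf_bounded)
    thus False using P(2) by (meson leD)
  qed
  hence "\<exists>\<^sub>F j in sequentially. ennreal (mass gn (k1 + k2) (coord_space \<beta>) (P j)) < ennreal c"
    by (simp add: frequently_def not_less)
  then obtain j where j: "ennreal (tmass k1 k2 (P j)) < ennreal c"
    "Fnorm k1 k2 (fdiff gn \<alpha> \<beta> k1 k2 (flat_of gn \<alpha> \<beta> k1 k2 (P j)) (cls k1 k2 s)) < e"
    using frequently_eventually_conj[OF _ ev] frequently_ex unfolding tmass_def by blast
  have "\<forall>\<^sub>F i in sequentially. FN k1 k2 (P j - s i) < e"
    by (rule order_tendstoD(2)[OF flat_dist_tendsto[OF P(1) assms(1)] j(2)])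
  hence "\<forall>\<^sub>F i in sequentially. FN k1 k2 (s i - P j) < e"
    by (simp add: flat_norm_diff_commute[OF cauchy_seqs_chain[OF assms(1)] P(1)])
  moreover have "tmass k1 k2 (P j) < c" using j(1) tmass_nonneg[OF P(1)] by (simp add: ennreal_less_iff)
  ultimately show ?thesis using that P(1) by blast
qed

text \<open>Summable masses make the partial sums Cauchy because the flat norm is at most the mass.
  The uniform mass bound is the input that \<open>flat_mass_le\<close> turns into a bound for the
  limit.\<close>

lemma cauchy_seqs_series:
  assumes "Q \<in> Ch k1 k2" "\<And>l. R l \<in> Ch k1 k2" "summable (\<lambda>l. tmass k1 k2 (R l))"
  shows "(\<lambda>j. Q + (\<Sum>l<j. R l)) \<in> CS k1 k2"
    and "tmass k1 k2 (Q + (\<Sum>l<j. R l)) \<le> tmass k1 k2 Q + (suminf (\<lambda>l. tmass k1 k2 (R l)))"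
proof -
  have sub: "(Q + (\<Sum>l<j. R l)) - (Q + (\<Sum>l<i. R l)) = (\<Sum>l\<in>{i..<j}. R l)" if "i \<le> j" for i j
    using sum_diff_nat_ivl[of 0 i j R] that by (simp add: lessThan_atLeast0)
  have mem: "Q + (\<Sum>l<j. R l) \<in> Ch k1 k2" for j
    by (intro tensor_chains_add assms(1,2) tensor_chains_sum)
  have le: "FN k1 k2 ((Q + (\<Sum>l<j. R l)) - (Q + (\<Sum>l<i. R l))) \<le> (\<Sum>l\<in>{i..<j}. tmass k1 k2 (R l))" if "i \<le> j" for i j
  proof -
    have "FN k1 k2 (\<Sum>l\<in>{i..<j}. R l) \<le> tmass k1 k2 (\<Sum>l\<in>{i..<j}. R l)"
      by (intro flat_norm_le_mass tensor_chains_sum assms(2))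
    also have "\<dots> \<le> (\<Sum>l\<in>{i..<j}. tmass k1 k2 (R l))" by (intro tmass_sum assms(2))
    finally show ?thesis unfolding sub[OF that] .
  qed
  show "(\<lambda>j. Q + (\<Sum>l<j. R l)) \<in> CS k1 k2"
  proof (rule cauchy_seqsI[OF mem])
    fix e :: real assume "e > 0"
    then obtain N where N: "\<And>m n. m \<ge> N \<Longrightarrow> norm (\<Sum>l\<in>{m..<n}. tmass k1 k2 (R l)) < e"
      using assms(3) unfolding summable_Cauchy by blast
    have less: "FN k1 k2 ((Q + (\<Sum>l<j. R l)) - (Q + (\<Sum>l<i. R l))) < e" if "N \<le> i" "i \<le> j" for i j
      using le[OF that(2)] N[OF that(1), of j] by simp
    show "\<exists>N. \<forall>i\<ge>N. \<forall>j\<ge>N. FN k1 k2 ((Q + (\<Sum>l<i. R l)) - (Q + (\<Sum>l<j. R l))) < e"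
    proof (intro exI[of _ N] allI impI)
      fix i j assume ij: "N \<le> i" "N \<le> j"
      show "FN k1 k2 ((Q + (\<Sum>l<i. R l)) - (Q + (\<Sum>l<j. R l))) < e"
      proof (cases "i \<le> j")
        case True
        show ?thesis unfolding flat_norm_diff_commute[OF mem[of i] mem[of j]] by (rule less[OF ij(1) True])
      next
        case False
        thus ?thesis using less[OF ij(2), of i] by simp
      qed
    qed
  qed
  have "tmass k1 k2 (Q + (\<Sum>l<j. R l)) \<le> tmass k1 k2 Q + tmass k1 k2 (\<Sum>l<j. R l)"
    by (intro tmass_add assms(1,2) tensor_chains_sum)
  also have "tmass k1 k2 (\<Sum>l<j. R l) \<le> (\<Sum>l<j. tmass k1 k2 (R l))" by (intro tmass_sum assms(2))
  also have "\<dots> \<le> (suminf (\<lambda>l. tmass k1 k2 (R l)))"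
    by (intro sum_le_suminf assms(3) ballI tmass_nonneg assms(2)) simp
  finally show "tmass k1 k2 (Q + (\<Sum>l<j. R l)) \<le> tmass k1 k2 Q + (suminf (\<lambda>l. tmass k1 k2 (R l)))" by simp
qed

section \<open>Comparison of the flat norm with the masses of decompositions\<close>

definition fassemble where
  "fassemble k1 k2 B00 B10 B01 B11 =
    fadd gn \<alpha> \<beta> k1 k2
      (fadd gn \<alpha> \<beta> k1 k2
        (fadd gn \<alpha> \<beta> k1 k2 B00 (fbd1 gn \<alpha> \<beta> (Suc k1) k2 B10))
        (fbd2 gn \<alpha> \<beta> k1 (Suc k2) B01))
      (fbd1 gn \<alpha> \<beta> (Suc k1) k2 (fbd2 gn \<alpha> \<beta> (Suc k1) (Suc k2) B11))"

lemma fassemble_fclass: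
  assumes "s00 \<in> CS k1 k2" "s10 \<in> CS (Suc k1) k2" "s01 \<in> CS k1 (Suc k2)" "s11 \<in> CS (Suc k1) (Suc k2)"
  shows "fassemble k1 k2 (cls k1 k2 s00) (cls (Suc k1) k2 s10) (cls k1 (Suc k2) s01) (cls (Suc k1) (Suc k2) s11)
      = cls k1 k2 (\<lambda>j. assemble k1 k2 (s00 j) (s10 j) (s01 j) (s11 j))"
    and "(\<lambda>j. assemble k1 k2 (s00 j) (s10 j) (s01 j) (s11 j)) \<in> CS k1 k2"
proof -
  note m = cauchy_seqs_bd1[OF assms(2)] cauchy_seqs_bd2[OF assms(3)]
    cauchy_seqs_bd1[OF cauchy_seqs_bd2[OF assms(4)]]
  note a = cauchy_seqs_add[OF assms(1) m(1)]
  note a' = cauchy_seqs_add[OF a m(2)]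
  show "(\<lambda>j. assemble k1 k2 (s00 j) (s10 j) (s01 j) (s11 j)) \<in> CS k1 k2"
    unfolding assemble_def by (rule cauchy_seqs_add[OF a' m(3)])
  show "fassemble k1 k2 (cls k1 k2 s00) (cls (Suc k1) k2 s10) (cls k1 (Suc k2) s01) (cls (Suc k1) (Suc k2) s11)
      = cls k1 k2 (\<lambda>j. assemble k1 k2 (s00 j) (s10 j) (s01 j) (s11 j))"
    unfolding fassemble_def assemble_def fbd1_fclass[OF assms(2)] fbd2_fclass[OF assms(3)]
      fbd2_fclass[OF assms(4)] fbd1_fclass[OF cauchy_seqs_bd2[OF assms(4)]]
      fadd_fclass[OF assms(1) m(1)] fadd_fclass[OF a m(2)] fadd_fclass[OF a' m(3)] ..
qed

abbreviation "total_Fmass k1 k2 B00 B10 B01 B11 \<equiv>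
  Fmass k1 k2 B00 + Fmass (Suc k1) k2 B10 + Fmass k1 (Suc k2) B01 + Fmass (Suc k1) (Suc k2) B11"

text \<open>The approximations assemble to a chain whose flat norm is at most their total mass. By
  \<open>flat_norm_assemble\<close>, its distance to the given flat chain is at most the sum of the
  four errors.\<close>

lemma flat_norm_le_flat_mass:
  assumes "B00 \<in> FC k1 k2" "B10 \<in> FC (Suc k1) k2" "B01 \<in> FC k1 (Suc k2)" "B11 \<in> FC (Suc k1) (Suc k2)"
  shows "ennreal (Fnorm k1 k2 (fassemble k1 k2 B00 B10 B01 B11)) \<le>
    total_Fmass k1 k2 B00 B10 B01 B11"
    (is "_ \<le> ?M00 + ?M10 + ?M01 + ?M11")
proof (rule ennreal_le_epsilon)
  fix e :: real assume e: "e > 0" and fin: "?M00 + ?M10 + ?M01 + ?M11 < top"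
  obtain b00 where b00: "b00 \<in> CS k1 k2" "B00 = cls k1 k2 b00" by (rule flat_chainsE[OF assms(1)])
  obtain b10 where b10: "b10 \<in> CS (Suc k1) k2" "B10 = cls (Suc k1) k2 b10" by (rule flat_chainsE[OF assms(2)])
  obtain b01 where b01: "b01 \<in> CS k1 (Suc k2)" "B01 = cls k1 (Suc k2) b01" by (rule flat_chainsE[OF assms(3)])
  obtain b11 where b11: "b11 \<in> CS (Suc k1) (Suc k2)" "B11 = cls (Suc k1) (Suc k2) b11" by (rule flat_chainsE[OF assms(4)])
  \<comment> \<open>Each of the four pieces costs \<open>d\<close> in distance and \<open>d\<close>
    in mass, eight times \<open>d\<close> in all.\<close>
  define d where "d = e / 8"
  have d: "d > 0" using e by (simp add: d_def)
  have approx: "\<exists>P. P \<in> Ch l1 l2 \<and> ennreal (tmass l1 l2 P) \<le> Fmass l1 l2 (cls l1 l2 b) + ennreal d \<and>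
      (\<forall>\<^sub>F j in sequentially. FN l1 l2 (b j - P) < d)"
    if b: "b \<in> CS l1 l2" and less_top: "Fmass l1 l2 (cls l1 l2 b) < top" for l1 l2 b
  proof -
    obtain m where m: "m \<ge> 0" "Fmass l1 l2 (cls l1 l2 b) = ennreal m"
      using less_top by (cases "Fmass l1 l2 (cls l1 l2 b)") auto
    have "Fmass l1 l2 (cls l1 l2 b) < ennreal (m + d)"
      using m d by (simp add: ennreal_less_iff)
    then obtain P where P: "P \<in> Ch l1 l2" "tmass l1 l2 P < m + d" "\<forall>\<^sub>F j in sequentially. FN l1 l2 (b j - P) < d"
      by (rule flat_mass_less[OF b _ d])
    have "ennreal (tmass l1 l2 P) \<le> ennreal (m + d)" using P(2) by (intro ennreal_leI) simp
    also have "\<dots> = ennreal m + ennreal d" using m(1) d by simp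
    finally have "ennreal (tmass l1 l2 P) \<le> ennreal m + ennreal d" .
    thus ?thesis using P m by auto
  qed
  have fins: "?M00 < top" "?M10 < top" "?M01 < top" "?M11 < top"
    using fin by (auto simp: less_top)
  obtain P00 where P00: "P00 \<in> Ch k1 k2" "ennreal (tmass k1 k2 P00) \<le> ?M00 + ennreal d"
    "\<forall>\<^sub>F j in sequentially. FN k1 k2 (b00 j - P00) < d"
    using approx[OF b00(1)] fins(1) b00(2) by blast
  obtain P10 where P10: "P10 \<in> Ch (Suc k1) k2" "ennreal (tmass (Suc k1) k2 P10) \<le> ?M10 + ennreal d"
    "\<forall>\<^sub>F j in sequentially. FN (Suc k1) k2 (b10 j - P10) < d"
    using approx[OF b10(1)] fins(2) b10(2) by blast
  obtain P01 where P01: "P01 \<in> Ch k1 (Suc k2)" "ennreal (tmass k1 (Suc k2) P01) \<le> ?M01 + ennreal d"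
    "\<forall>\<^sub>F j in sequentially. FN k1 (Suc k2) (b01 j - P01) < d"
    using approx[OF b01(1)] fins(3) b01(2) by blast
  obtain P11 where P11: "P11 \<in> Ch (Suc k1) (Suc k2)" "ennreal (tmass (Suc k1) (Suc k2) P11) \<le> ?M11 + ennreal d"
    "\<forall>\<^sub>F j in sequentially. FN (Suc k1) (Suc k2) (b11 j - P11) < d"
    using approx[OF b11(1)] fins(4) b11(2) by blast
  let ?s = "\<lambda>j. assemble k1 k2 (b00 j) (b10 j) (b01 j) (b11 j)"
  let ?P = "assemble k1 k2 P00 P10 P01 P11"
  let ?m = "total_mass k1 k2 P00 P10 P01 P11"
  have ms: "?s j \<in> Ch k1 k2" for j
    by (intro assemble_in cauchy_seqs_chain[OF b00(1)] cauchy_seqs_chain[OF b10(1)]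
      cauchy_seqs_chain[OF b01(1)] cauchy_seqs_chain[OF b11(1)])
  have mP: "?P \<in> Ch k1 k2" by (rule assemble_in[OF P00(1) P10(1) P01(1) P11(1)])
  have "\<forall>\<^sub>F j in sequentially. FN k1 k2 (?s j) \<le> 4 * d + ?m"
    using P00(3) P10(3) P01(3) P11(3)
  proof eventually_elim
    case (elim j)
    have mem: "b00 j - P00 \<in> Ch k1 k2" "b10 j - P10 \<in> Ch (Suc k1) k2" "b01 j - P01 \<in> Ch k1 (Suc k2)"
      "b11 j - P11 \<in> Ch (Suc k1) (Suc k2)"
      by (intro tensor_chains_diff P00(1) P10(1) P01(1) P11(1) cauchy_seqs_chain[OF b00(1)] cauchy_seqs_chain[OF b10(1)]
        cauchy_seqs_chain[OF b01(1)] cauchy_seqs_chain[OF b11(1)])+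
    have "?s j = ?P + assemble k1 k2 (b00 j - P00) (b10 j - P10) (b01 j - P01) (b11 j - P11)"
      using assemble_add[OF P00(1) P10(1) P01(1) P11(1) mem] by simp
    hence "FN k1 k2 (?s j) \<le> FN k1 k2 ?P + FN k1 k2 (assemble k1 k2 (b00 j - P00) (b10 j - P10) (b01 j - P01) (b11 j - P11))"
      using flat_norm_add[OF mP assemble_in[OF mem]] by simp
    thus ?case
      using flat_norm_assemble[OF mem] flat_norm_le[OF P00(1) P10(1) P01(1) P11(1)] elim by linarith
  qed
  hence "Fnorm k1 k2 (cls k1 k2 ?s) \<le> 4 * d + ?m"
    by (intro tendsto_upperbound[OF flat_norm_tendsto[OF fassemble_fclass(2)[OF b00(1) b10(1) b01(1) b11(1)]]]) simp_all
  hence "ennreal (Fnorm k1 k2 (fassemble k1 k2 B00 B10 B01 B11)) \<le> ennreal (4 * d + ?m)"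
    unfolding b00(2) b10(2) b01(2) b11(2) fassemble_fclass(1)[OF b00(1) b10(1) b01(1) b11(1)] by (rule ennreal_leI)
  also have "\<dots> = ennreal (4 * d) + (ennreal (tmass k1 k2 P00) + ennreal (tmass (Suc k1) k2 P10) +
      ennreal (tmass k1 (Suc k2) P01) + ennreal (tmass (Suc k1) (Suc k2) P11))"
    using d P00(1) P10(1) P01(1) P11(1) by (simp add: ennreal_plus tmass_nonneg)
  also have "\<dots> \<le> ennreal (4 * d) + ((?M00 + ennreal d) + (?M10 + ennreal d) + (?M01 + ennreal d) + (?M11 + ennreal d))"
    by (intro add_mono order_refl P00(2) P10(2) P01(2) P11(2))
  also have "\<dots> = (?M00 + ?M10 + ?M01 + ?M11) + (ennreal (4 * d) + ennreal d + ennreal d + ennreal d + ennreal d)"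
    by (simp add: ac_simps)
  also have "ennreal (4 * d) + ennreal d + ennreal d + ennreal d + ennreal d = ennreal e"
    using d by (simp add: ennreal_plus[symmetric] d_def del: ennreal_plus)
  finally show "ennreal (Fnorm k1 k2 (fassemble k1 k2 B00 B10 B01 B11)) \<le>
    ?M00 + ?M10 + ?M01 + ?M11 + ennreal e" .
qed

text \<open>Geometric decay of the increments makes the total masses of their almost optimal
  decompositions summable.\<close>

lemma fast_subsequence:
  assumes "a \<in> CS k1 k2" "e > 0"
  obtains r where "(a, \<lambda>j. a (r j)) \<in> SR k1 k2"
    "\<And>j. FN k1 k2 (a (r (Suc j)) - a (r j)) < e * (1 / 2) ^ j"
    "FN k1 k2 (a (r 0)) < Fnorm k1 k2 (cls k1 k2 a) + e"
proof -
  have "\<exists>N. \<forall>i\<ge>N. \<forall>l\<ge>N. FN k1 k2 (a i - a l) < e * (1 / 2) ^ j" for j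
    using cauchy_seqsD[OF assms(1), of "e * (1 / 2) ^ j"] assms(2) by (metis mult_pos_pos zero_less_divide_1_iff zero_less_numeral zero_less_power)
  then obtain N where N: "\<And>j i l. i \<ge> N j \<Longrightarrow> l \<ge> N j \<Longrightarrow> FN k1 k2 (a i - a l) < e * (1 / 2) ^ j"
    by metis
  have "\<forall>\<^sub>F j in sequentially. FN k1 k2 (a j) < Fnorm k1 k2 (cls k1 k2 a) + e"
    using assms(2) by (intro order_tendstoD(2)[OF flat_norm_tendsto[OF assms(1)]]) simp
  then obtain M where M: "\<And>j. j \<ge> M \<Longrightarrow> FN k1 k2 (a j) < Fnorm k1 k2 (cls k1 k2 a) + e"
    by (auto simp: eventually_sequentially)
  \<comment> \<open>The sum of all \<open>N l\<close> up to \<open>j\<close> dominates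
    \<open>N j\<close>, also at the next index; \<open>M\<close> serves the bound on the first term,
    and \<open>j\<close> sends the indices to infinity.\<close>
  define r where "r = (\<lambda>j. M + j + (\<Sum>l\<le>j. N l))"
  have rN: "r j \<ge> N j" "r (Suc j) \<ge> N j" "r j \<ge> j" for j
    using member_le_sum[of j "{..j}" N] member_le_sum[of j "{..Suc j}" N] by (auto simp: r_def)
  have ar: "(\<lambda>j. a (r j)) \<in> CS k1 k2"
  proof (rule cauchy_seqsI)
    fix c :: real assume "c > 0"
    obtain K where K: "\<And>i j. i \<ge> K \<Longrightarrow> j \<ge> K \<Longrightarrow> FN k1 k2 (a i - a j) < c"
      using cauchy_seqsD[OF assms(1) \<open>c > 0\<close>] by blast
    thus "\<exists>K. \<forall>i\<ge>K. \<forall>j\<ge>K. FN k1 k2 (a (r i) - a (r j)) < c"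
      using rN(3) by (meson order_trans)
  qed (rule cauchy_seqs_chain[OF assms(1)])
  have "(\<lambda>j. FN k1 k2 (a j - a (r j))) \<longlonglongrightarrow> 0"
  proof (rule LIMSEQ_I)
    fix c :: real assume "c > 0"
    obtain K where K: "\<And>i j. i \<ge> K \<Longrightarrow> j \<ge> K \<Longrightarrow> FN k1 k2 (a i - a j) < c"
      using cauchy_seqsD[OF assms(1) \<open>c > 0\<close>] by blast
    have "norm (FN k1 k2 (a j - a (r j)) - 0) < c" if "j \<ge> K" for j
      using K[OF that order_trans[OF that rN(3)]]
        flat_norm_nonneg[OF tensor_chains_diff[OF cauchy_seqs_chain[OF assms(1)] cauchy_seqs_chain[OF assms(1)]]]
      by simp
    thus "\<exists>K. \<forall>j\<ge>K. norm (FN k1 k2 (a j - a (r j)) - 0) < c" by blast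
  qed
  hence "(a, \<lambda>j. a (r j)) \<in> SR k1 k2" using assms(1) ar by (simp add: seq_rel_iff)
  moreover have "FN k1 k2 (a (r 0)) < Fnorm k1 k2 (cls k1 k2 a) + e" by (rule M) (simp add: r_def)
  moreover have "FN k1 k2 (a (r (Suc j)) - a (r j)) < e * (1 / 2) ^ j" for j by (rule N[OF rN(2) rN(1)])
  ultimately show ?thesis using that by blast
qed

text \<open>One \<open>e\<close> is spent on the first term of the fast subsequence, together with
  its decomposition, and \<open>2 * e\<close> on the geometric series of the increments.\<close>

lemma flat_mass_decomposition:
  assumes "A \<in> FC k1 k2" "e > 0"
  obtains B00 B10 B01 B11 where "B00 \<in> FC k1 k2" "B10 \<in> FC (Suc k1) k2" "B01 \<in> FC k1 (Suc k2)"
    "B11 \<in> FC (Suc k1) (Suc k2)" "A = fassemble k1 k2 B00 B10 B01 B11"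
    "total_Fmass k1 k2 B00 B10 B01 B11
     \<le> ennreal (Fnorm k1 k2 A + 3 * e)"
proof -
  obtain a where a: "a \<in> CS k1 k2" "A = cls k1 k2 a" by (rule flat_chainsE[OF assms(1)])
  obtain r where r: "(a, \<lambda>j. a (r j)) \<in> SR k1 k2"
    "\<And>j. FN k1 k2 (a (r (Suc j)) - a (r j)) < e * (1 / 2) ^ j"
    "FN k1 k2 (a (r 0)) < Fnorm k1 k2 A + e"
    using fast_subsequence[OF a(1) assms(2)] a(2) by metis
  note ca = cauchy_seqs_chain[OF a(1)]
  obtain Q00 Q10 Q01 Q11 where Q: "Q00 \<in> Ch k1 k2" "Q10 \<in> Ch (Suc k1) k2" "Q01 \<in> Ch k1 (Suc k2)"
    "Q11 \<in> Ch (Suc k1) (Suc k2)" "a (r 0) = assemble k1 k2 Q00 Q10 Q01 Q11"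
    "total_mass k1 k2 Q00 Q10 Q01 Q11
      < Fnorm k1 k2 A + e"
    by (rule flat_norm_less[OF ca r(3)])
  have "\<exists>R00 R10 R01 R11. R00 \<in> Ch k1 k2 \<and> R10 \<in> Ch (Suc k1) k2 \<and> R01 \<in> Ch k1 (Suc k2) \<and>
    R11 \<in> Ch (Suc k1) (Suc k2) \<and> a (r (Suc j)) - a (r j) = assemble k1 k2 R00 R10 R01 R11 \<and>
    total_mass k1 k2 R00 R10 R01 R11
      < e * (1 / 2) ^ j" for j
    by (rule flat_norm_less[OF tensor_chains_diff[OF ca ca] r(2)[of j]]) blast
  then obtain R00 R10 R01 R11 where R: "\<And>j. R00 j \<in> Ch k1 k2" "\<And>j. R10 j \<in> Ch (Suc k1) k2"
    "\<And>j. R01 j \<in> Ch k1 (Suc k2)" "\<And>j. R11 j \<in> Ch (Suc k1) (Suc k2)"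
    "\<And>j. a (r (Suc j)) - a (r j) = assemble k1 k2 (R00 j) (R10 j) (R01 j) (R11 j)"
    "\<And>j. tmass k1 k2 (R00 j) + tmass (Suc k1) k2 (R10 j) + tmass k1 (Suc k2) (R01 j) + tmass (Suc k1) (Suc k2) (R11 j)
      < e * (1 / 2) ^ j"
    by metis
  have geo: "summable (\<lambda>j. e * (1 / 2) ^ j)" by (intro summable_mult summable_geometric) simp
  note nn = tmass_nonneg[OF R(1)] tmass_nonneg[OF R(2)] tmass_nonneg[OF R(3)] tmass_nonneg[OF R(4)]
  have sm: "summable (\<lambda>j. tmass k1 k2 (R00 j))" "summable (\<lambda>j. tmass (Suc k1) k2 (R10 j))"
    "summable (\<lambda>j. tmass k1 (Suc k2) (R01 j))" "summable (\<lambda>j. tmass (Suc k1) (Suc k2) (R11 j))"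
  proof -
    have "tmass k1 k2 (R00 j) \<le> e * (1 / 2) ^ j" "tmass (Suc k1) k2 (R10 j) \<le> e * (1 / 2) ^ j"
      "tmass k1 (Suc k2) (R01 j) \<le> e * (1 / 2) ^ j" "tmass (Suc k1) (Suc k2) (R11 j) \<le> e * (1 / 2) ^ j" for j
      using R(6)[of j] nn(1)[of j] nn(2)[of j] nn(3)[of j] nn(4)[of j] by linarith+
    thus "summable (\<lambda>j. tmass k1 k2 (R00 j))" "summable (\<lambda>j. tmass (Suc k1) k2 (R10 j))"
      "summable (\<lambda>j. tmass k1 (Suc k2) (R01 j))" "summable (\<lambda>j. tmass (Suc k1) (Suc k2) (R11 j))"
      using nn by (auto intro!: summable_comparison_test'[OF geo])
  qed
  define S00 where "S00 = (\<lambda>j. Q00 + (\<Sum>l<j. R00 l))"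
  define S10 where "S10 = (\<lambda>j. Q10 + (\<Sum>l<j. R10 l))"
  define S01 where "S01 = (\<lambda>j. Q01 + (\<Sum>l<j. R01 l))"
  define S11 where "S11 = (\<lambda>j. Q11 + (\<Sum>l<j. R11 l))"
  note cS = cauchy_seqs_series(1)[OF Q(1) R(1) sm(1), folded S00_def] cauchy_seqs_series(1)[OF Q(2) R(2) sm(2), folded S10_def]
    cauchy_seqs_series(1)[OF Q(3) R(3) sm(3), folded S01_def] cauchy_seqs_series(1)[OF Q(4) R(4) sm(4), folded S11_def]
  \<comment> \<open>Additivity of \<open>assemble\<close> makes the partial sums of the four kinds
    of pieces an exact decomposition of the subsequence at every stage.\<close>
  have ar: "a (r j) = assemble k1 k2 (S00 j) (S10 j) (S01 j) (S11 j)" for j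
  proof (induction j)
    case 0
    show ?case using Q(5) by (simp add: S00_def S10_def S01_def S11_def)
  next
    case (Suc j)
    have "a (r (Suc j)) = a (r j) + (a (r (Suc j)) - a (r j))" by simp
    also have "\<dots> = assemble k1 k2 (S00 j + R00 j) (S10 j + R10 j) (S01 j + R01 j) (S11 j + R11 j)"
      unfolding R(5) unfolding Suc
      by (rule assemble_add[OF cauchy_seqs_chain[OF cS(1)] cauchy_seqs_chain[OF cS(2)] cauchy_seqs_chain[OF cS(3)]
            cauchy_seqs_chain[OF cS(4)] R(1-4), symmetric])
    finally show ?case by (simp add: S00_def S10_def S01_def S11_def add.assoc)
  qed
  define t where "t = (suminf (\<lambda>j. tmass k1 k2 (R00 j))) + (suminf (\<lambda>j. tmass (Suc k1) k2 (R10 j)))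
      + (suminf (\<lambda>j. tmass k1 (Suc k2) (R01 j))) + (suminf (\<lambda>j. tmass (Suc k1) (Suc k2) (R11 j)))"
  have t: "t \<le> 2 * e"
  proof -
    have "t = (suminf (\<lambda>j. tmass k1 k2 (R00 j) + tmass (Suc k1) k2 (R10 j) + tmass k1 (Suc k2) (R01 j) + tmass (Suc k1) (Suc k2) (R11 j)))"
      unfolding t_def by (simp add: suminf_add[symmetric] sm summable_add)
    also have "\<dots> \<le> (suminf (\<lambda>j. e * (1 / 2) ^ j))"
      by (intro suminf_le less_imp_le R(6) geo summable_add sm)
    also have "\<dots> = 2 * e" by (subst suminf_mult) (simp_all add: suminf_geometric summable_geometric)
    finally show ?thesis .
  qed
  note q = tmass_nonneg[OF Q(1)] tmass_nonneg[OF Q(2)] tmass_nonneg[OF Q(3)] tmass_nonneg[OF Q(4)]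
    suminf_nonneg[OF sm(1) nn(1)] suminf_nonneg[OF sm(2) nn(2)] suminf_nonneg[OF sm(3) nn(3)] suminf_nonneg[OF sm(4) nn(4)]
  have "total_Fmass k1 k2 (cls k1 k2 S00) (cls (Suc k1) k2 S10) (cls k1 (Suc k2) S01) (cls (Suc k1) (Suc k2) S11)
    \<le> ennreal (tmass k1 k2 Q00 + (suminf (\<lambda>j. tmass k1 k2 (R00 j)))) + ennreal (tmass (Suc k1) k2 Q10 + (suminf (\<lambda>j. tmass (Suc k1) k2 (R10 j))))
     + ennreal (tmass k1 (Suc k2) Q01 + (suminf (\<lambda>j. tmass k1 (Suc k2) (R01 j))))
     + ennreal (tmass (Suc k1) (Suc k2) Q11 + (suminf (\<lambda>j. tmass (Suc k1) (Suc k2) (R11 j))))"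
    by (intro add_mono flat_mass_le cS; unfold S00_def S10_def S01_def S11_def)
       (intro cauchy_seqs_series(2) Q R sm)+
  also have "\<dots> = ennreal ((tmass k1 k2 Q00 + (suminf (\<lambda>j. tmass k1 k2 (R00 j)))) + (tmass (Suc k1) k2 Q10 + (suminf (\<lambda>j. tmass (Suc k1) k2 (R10 j))))
     + (tmass k1 (Suc k2) Q01 + (suminf (\<lambda>j. tmass k1 (Suc k2) (R01 j))))
     + (tmass (Suc k1) (Suc k2) Q11 + (suminf (\<lambda>j. tmass (Suc k1) (Suc k2) (R11 j)))))"
    using q by simp
  also have "\<dots> \<le> ennreal (Fnorm k1 k2 A + 3 * e)"
    using t Q(6) unfolding t_def by (intro ennreal_leI) linarith
  finally have mass: "total_Fmass k1 k2 (cls k1 k2 S00) (cls (Suc k1) k2 S10) (cls k1 (Suc k2) S01) (cls (Suc k1) (Suc k2) S11)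
    \<le> ennreal (Fnorm k1 k2 A + 3 * e)" .
  have "A = cls k1 k2 (\<lambda>j. a (r j))" unfolding a(2) by (rule fclass_eqI[OF r(1)])
  hence "A = fassemble k1 k2 (cls k1 k2 S00) (cls (Suc k1) k2 S10) (cls k1 (Suc k2) S01) (cls (Suc k1) (Suc k2) S11)"
    unfolding fassemble_fclass(1)[OF cS] by (simp only: ar)
  thus ?thesis by (rule that[OF fclass_in[OF cS(1)] fclass_in[OF cS(2)] fclass_in[OF cS(3)] fclass_in[OF cS(4)] _ mass])
qed

text \<open>Values lie in \<open>ennreal\<close> because the masses of a competing decomposition may
  be infinite.\<close>

lemma flat_norm_eq_Inf_flat_mass:
  assumes "A \<in> FC k1 k2"
  shows "ennreal (flat_norm gn \<alpha> \<beta> k1 k2 A) = Inf {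
    (\<Sum>i1\<in>{0, 1}. \<Sum>i2\<in>{0, 1}. flat_mass gn \<alpha> \<beta> (k1 + i1) (k2 + i2) (B i1 i2)) | B.
    (\<forall>i1\<in>{0, 1}. \<forall>i2\<in>{0, 1}. B i1 i2 \<in> flat_chains gn \<alpha> \<beta> (k1 + i1) (k2 + i2)) \<and>
    A = fadd gn \<alpha> \<beta> k1 k2
          (fadd gn \<alpha> \<beta> k1 k2
            (fadd gn \<alpha> \<beta> k1 k2 (B 0 0) (fbd1 gn \<alpha> \<beta> (k1 + 1) k2 (B 1 0)))
            (fbd2 gn \<alpha> \<beta> k1 (k2 + 1) (B 0 1)))
          (fbd1 gn \<alpha> \<beta> (k1 + 1) k2 (fbd2 gn \<alpha> \<beta> (k1 + 1) (k2 + 1) (B 1 1)))}" (is "_ = Inf ?M")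
proof (rule antisym)
  show "ennreal (Fnorm k1 k2 A) \<le> Inf ?M"
  proof (rule Inf_greatest)
    fix x assume "x \<in> ?M"
    then obtain B where B: "x = (\<Sum>i1\<in>{0, 1}. \<Sum>i2\<in>{0, 1}. Fmass (k1 + i1) (k2 + i2) (B i1 i2))"
      "\<forall>i1\<in>{0, 1}. \<forall>i2\<in>{0, 1}. B i1 i2 \<in> FC (k1 + i1) (k2 + i2)"
      "A = fassemble k1 k2 (B 0 0) (B 1 0) (B 0 1) (B 1 1)"
      unfolding fassemble_def Suc_eq_plus1 by blast
    have mem: "B 0 0 \<in> FC k1 k2" "B 1 0 \<in> FC (Suc k1) k2" "B 0 1 \<in> FC k1 (Suc k2)" "B 1 1 \<in> FC (Suc k1) (Suc k2)"
      using B(2) by simp_all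
    show "ennreal (Fnorm k1 k2 A) \<le> x"
      using flat_norm_le_flat_mass[OF mem] unfolding B(3)[symmetric] B(1) by (simp add: ac_simps)
  qed
  show "Inf ?M \<le> ennreal (Fnorm k1 k2 A)"
  proof (rule ennreal_le_epsilon)
    fix e :: real assume "e > 0"
    obtain B00 B10 B01 B11 where B: "B00 \<in> FC k1 k2" "B10 \<in> FC (Suc k1) k2" "B01 \<in> FC k1 (Suc k2)"
      "B11 \<in> FC (Suc k1) (Suc k2)" "A = fassemble k1 k2 B00 B10 B01 B11"
      "total_Fmass k1 k2 B00 B10 B01 B11
       \<le> ennreal (Fnorm k1 k2 A + 3 * (e / 3))"
      by (rule flat_mass_decomposition[OF assms, of "e / 3"]) (use \<open>e > 0\<close> in auto)
    define B where "B = (\<lambda>(i1 :: nat) (i2 :: nat). if i1 = 0 then if i2 = 0 then B00 else B01 else if i2 = 0 then B10 else B11)"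
    obtain a where a: "a \<in> CS k1 k2" "A = cls k1 k2 a" by (rule flat_chainsE[OF assms])
    have "Inf ?M \<le> (\<Sum>i1\<in>{0, 1}. \<Sum>i2\<in>{0, 1}. Fmass (k1 + i1) (k2 + i2) (B i1 i2))"
      by (rule Inf_lower, intro CollectI exI[of _ B])
         (use B(1-5) in \<open>simp add: B_def fassemble_def\<close>)
    also have "\<dots> \<le> ennreal (Fnorm k1 k2 A + e)"
      using B(6) by (simp add: B_def ac_simps)
    also have "\<dots> = ennreal (Fnorm k1 k2 A) + ennreal e"
      using flat_norm_fclass_nonneg[OF a(1)] \<open>e > 0\<close> a(2) by simp
    finally show "Inf ?M \<le> ennreal (Fnorm k1 k2 A) + ennreal e" .
  qed
qed

end

end

theorem proposition4p8:
  fixes gn :: "'g::ab_group_add \<Rightarrow> real"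
    and n1 n2 k1 k2 :: nat
    and \<alpha> \<beta> :: "'n::{finite,linorder} set"
    and A :: "('n, 'g) fchain"
  assumes "complete_normed_group gn"
    and "CARD('n) = n1 + n2"
    and "\<alpha> = first_indices n1"
    and "k1 \<le> card (\<beta> \<inter> \<alpha>)"
    and "k2 \<le> card (\<beta> - \<alpha>)"
    and "A \<in> flat_chains gn \<alpha> \<beta> k1 k2"
  shows "ennreal (flat_norm gn \<alpha> \<beta> k1 k2 A) = Inf {
    (\<Sum>i1\<in>{0, 1}. \<Sum>i2\<in>{0, 1}. flat_mass gn \<alpha> \<beta> (k1 + i1) (k2 + i2) (B i1 i2)) | B.
    (\<forall>i1\<in>{0, 1}. \<forall>i2\<in>{0, 1}. B i1 i2 \<in> flat_chains gn \<alpha> \<beta> (k1 + i1) (k2 + i2)) \<and>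
    A = fadd gn \<alpha> \<beta> k1 k2
          (fadd gn \<alpha> \<beta> k1 k2
            (fadd gn \<alpha> \<beta> k1 k2 (B 0 0) (fbd1 gn \<alpha> \<beta> (k1 + 1) k2 (B 1 0)))
            (fbd2 gn \<alpha> \<beta> k1 (k2 + 1) (B 0 1)))
          (fbd1 gn \<alpha> \<beta> (k1 + 1) k2 (fbd2 gn \<alpha> \<beta> (k1 + 1) (k2 + 1) (B 1 1)))}"
  by (rule complete_normed_group.flat_norm_eq_Inf_flat_mass[OF assms(1,6)])

end
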